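(* Let $n\ge 1$, let $(w_i)_{i\in[n]}$ be positive weights (which may depend on $n$), and let $W_n=w_I$ with $I$ uniform on $[n]=\{1,\dots,n\}$. Assume the weight regularity conditions: there is a random variable $W$ with $\mathbb E[W]>0$ such that, as $n\to\infty$, (i) $W_n\to W$ in distribution, (ii) $\mathbb E[W_n^2]=\frac1n\sum_{i\in[n]}w_i^2\to\mathbb E[W^2]<\infty$, (iii) $\mathbb E[W_n^3]=\frac1n\sum_{i\in[n]}w_i^3\to\mathbb E[W^3]<\infty$. For $\beta\ge 0$ and $h\in\mathbb R$, consider the inhomogeneous Curie–Weiss measure on $\{-1,1\}^n$, $$\mu_n(\sigma)=\frac{1}{Z_n}\exp\Big(\frac{\beta}{2\ell_n}\Big(\sum_{i\in[n]}w_i\sigma_i\Big)^2+h\sum_{i\in[n]}\sigma_i\Big),\qquad \ell_n=\sum_{i\in[n]}w_i=n\mathbb E[W_n],$$ with $Z_n$ the normalizing constant, and let $m_n=\frac1n\sum_{i\in[n]}\sigma_i$ where $\sigma\sim\mu_n$. Let $x_n^*$ be the solution with the same sign as $h$ (with $x_n^*=0$ when $h=0$) of $$x_n^*=\mathbb E\Big[\tanh\Big(\sqrt{\tfrac{\beta}{\mathbb E[W_n]}}W_nx_n^*+h\Big)\sqrt{\tfrac{\beta}{\mathbb E[W_n]}}W_n\Big],$$ and set, writing $T_n=\tanh\big(\sqrt{\beta/\mathbb E[W_n]}\,W_nx_n^*+h\big)$, $$M_n=\mathbb E[T_n],\qquad \chi_n=1-\mathbb E[T_n^2]+\frac{\frac{\beta}{\mathbb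 E[W_n]}\mathbb E[(1-T_n^2)W_n]^2}{1-\frac{\beta}{\mathbb E[W_n]}\mathbb E[(1-T_n^2)W_n^2]}.$$ Let $X_n=\sqrt n\,(m_n-M_n)/\sqrt{\chi_n}$ and $Z\sim\mathcal N(0,1)$. Let $\beta_c=\mathbb E[W]/\mathbb E[W^2]$ and $\mathcal U=\{(\beta,h):\beta\ge0,h\neq0\}\cup\{(\beta,0):0<\beta<\beta_c\}$. Then for every $(\beta,h)\in\mathcal U$ there is a constant $0<C=C(\beta,h)<\infty$ such that $$d_K(X_n,Z)\le \frac{C}{\sqrt n},$$ where $d_K(X,Y)=\sup_{z\in\mathbb R}|\mathbb P(X\le z)-\mathbb P(Y\le z)|$ is the Kolmogorov distance. Moreover, if only conditions (i)–(ii) (and $\mathbb E[W]>0$) are assumed, then $d_K(X_n,Z)=o(1)$ as $n\to\infty$ for every $(\beta,h)\in\mathcal U$.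
   Context: Expectations of the form $\mathbb E[f(W_n)]$ are with respect to the uniform index $I$, i.e. $\frac1n\sum_{i}f(w_i)$; the law of $X_n$ is computed under $\mu_n$. The fixed point $x_n^*$ is unique in the regime considered (for $n$ large). *)

theory Defs
  imports "HOL-Probability.Probability"
begin

text \<open>Weights: w n i for i < n (index set [n] rendered as {..<n}).\<close>

definition EWn :: "(nat \<Rightarrow> nat \<Rightarrow> real) \<Rightarrow> nat \<Rightarrow> (real \<Rightarrow> real) \<Rightarrow> real" where
  "EWn w n f = (\<Sum>i<n. f (w n i)) / real n"

definition lawWn :: "(nat \<Rightarrow> nat \<Rightarrow> real) \<Rightarrow> nat \<Rightarrow> real measure" where
  "lawWn w n = measure_pmf (map_pmf (w n) (pmf_of_set {..<n}))"

definition Conf :: "nat \<Rightarrow> (nat \<Rightarrow> real) set" where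
  "Conf n = PiE {..<n} (\<lambda>_. {-1, 1})"

definition ell :: "(nat \<Rightarrow> nat \<Rightarrow> real) \<Rightarrow> nat \<Rightarrow> real" where
  "ell w n = (\<Sum>i<n. w n i)"

definition cw_weight :: "(nat \<Rightarrow> nat \<Rightarrow> real) \<Rightarrow> real \<Rightarrow> real \<Rightarrow> nat \<Rightarrow> (nat \<Rightarrow> real) \<Rightarrow> real" where
  "cw_weight w \<beta> h n \<sigma> =
     exp (\<beta> / (2 * ell w n) * (\<Sum>i<n. w n i * \<sigma> i)^2 + h * (\<Sum>i<n. \<sigma> i))"

definition cw_prob :: "(nat \<Rightarrow> nat \<Rightarrow> real) \<Rightarrow> real \<Rightarrow> real \<Rightarrow> nat \<Rightarrow> ((nat \<Rightarrow> real) \<Rightarrow> bool) \<Rightarrow> real" where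
  "cw_prob w \<beta> h n P =
     (\<Sum>\<sigma>\<in>Conf n. if P \<sigma> then cw_weight w \<beta> h n \<sigma> else 0) / (\<Sum>\<sigma>\<in>Conf n. cw_weight w \<beta> h n \<sigma>)"

definition magn :: "nat \<Rightarrow> (nat \<Rightarrow> real) \<Rightarrow> real" where
  "magn n \<sigma> = (\<Sum>i<n. \<sigma> i) / real n"

definition fp_eq :: "(nat \<Rightarrow> nat \<Rightarrow> real) \<Rightarrow> real \<Rightarrow> real \<Rightarrow> nat \<Rightarrow> real \<Rightarrow> bool" where
  "fp_eq w \<beta> h n x \<longleftrightarrow>
     x = EWn w n (\<lambda>v. tanh (sqrt (\<beta> / EWn w n id) * v * x + h) * (sqrt (\<beta> / EWn w n id) * v))"

definition xstar :: "(nat \<Rightarrow> nat \<Rightarrow> real) \<Rightarrow> real \<Rightarrow> real \<Rightarrow> nat \<Rightarrow> real" where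
  "xstar w \<beta> h n = (THE x. fp_eq w \<beta> h n x \<and> sgn x = sgn h)"

definition Tn :: "(nat \<Rightarrow> nat \<Rightarrow> real) \<Rightarrow> real \<Rightarrow> real \<Rightarrow> nat \<Rightarrow> real \<Rightarrow> real" where
  "Tn w \<beta> h n v = tanh (sqrt (\<beta> / EWn w n id) * v * xstar w \<beta> h n + h)"

definition Mn :: "(nat \<Rightarrow> nat \<Rightarrow> real) \<Rightarrow> real \<Rightarrow> real \<Rightarrow> nat \<Rightarrow> real" where
  "Mn w \<beta> h n = EWn w n (Tn w \<beta> h n)"

definition chin :: "(nat \<Rightarrow> nat \<Rightarrow> real) \<Rightarrow> real \<Rightarrow> real \<Rightarrow> nat \<Rightarrow> real" where
  "chin w \<beta> h n =
     (let T = Tn w \<beta> h n; a = \<beta> / EWn w n id in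
      1 - EWn w n (\<lambda>v. (T v)^2)
        + a * (EWn w n (\<lambda>v. (1 - (T v)^2) * v))^2 / (1 - a * EWn w n (\<lambda>v. (1 - (T v)^2) * v^2)))"

definition Xn :: "(nat \<Rightarrow> nat \<Rightarrow> real) \<Rightarrow> real \<Rightarrow> real \<Rightarrow> nat \<Rightarrow> (nat \<Rightarrow> real) \<Rightarrow> real" where
  "Xn w \<beta> h n \<sigma> = sqrt (real n) * (magn n \<sigma> - Mn w \<beta> h n) / sqrt (chin w \<beta> h n)"

definition Phi :: "real \<Rightarrow> real" where
  "Phi z = measure (density lborel std_normal_density) {..z}"

definition dK_normal :: "(nat \<Rightarrow> nat \<Rightarrow> real) \<Rightarrow> real \<Rightarrow> real \<Rightarrow> nat \<Rightarrow> real" where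
  "dK_normal w \<beta> h n = (SUP z. \<bar>cw_prob w \<beta> h n (\<lambda>\<sigma>. Xn w \<beta> h n \<sigma> \<le> z) - Phi z\<bar>)"

end

theory Submission
  imports Defs "HOL-Real_Asymp.Real_Asymp"
begin

text \<open>
  Put \<open>u\<^sub>i = sqrt (\<beta> / E[W\<^sub>n]) * w\<^sub>i\<close>. The Gibbs measure is the \<open>\<sigma>\<close>-marginal of the density
  \<open>exp (- n x\<^sup>2 / 2 + \<Sum>i. \<sigma>\<^sub>i (u\<^sub>i x + h))\<close> in \<open>(x, \<sigma>)\<close>: given \<open>x\<close> the spins are independent with means
  \<open>\<tau>\<^sub>i(x) = tanh (u\<^sub>i x + h)\<close>, and given \<open>\<sigma>\<close> the variable \<open>x\<close> is Gaussian with mean \<open>(\<Sum>i. u\<^sub>i \<sigma>\<^sub>i) / n\<close>.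
  For a function \<open>\<phi>\<close> of the spins these two facts give exact identities for
  \<open>E[(S - \<Sum>i. \<tau>\<^sub>i(x)) \<phi>]\<close> and for \<open>E[n F'(x) \<phi>]\<close>, where \<open>F'(x) = x - (1/n) \<Sum>i. u\<^sub>i \<tau>\<^sub>i(x)\<close> vanishes at the
  fixed point. Both \<open>\<Sum>i. \<tau>\<^sub>i(x) - n M\<close> and \<open>n F'(x)\<close> are linear in \<open>x - x\<^sup>*\<close> up to an error of order
  \<open>n (1 + E[W\<^sub>n\<^sup>3]) (x - x\<^sup>*)\<^sup>2\<close>; eliminating the linear term yields a Stein identity for \<open>S\<close> whose variance
  coefficient is \<open>n \<chi>\<^sub>n\<close> up to \<open>O(n |x - x\<^sup>*|)\<close>. Since \<open>E[(x - x\<^sup>*)\<^sup>2] = O(1/n)\<close>, Stein's method bounds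
  the Kolmogorov distance by a constant times \<open>(1 + E[W\<^sub>n\<^sup>3]) / sqrt n\<close>. Under the second moment assumption
  alone the largest weight is \<open>o(sqrt n)\<close>, so \<open>E[W\<^sub>n\<^sup>3] = o(sqrt n)\<close> and the bound still tends to zero.
\<close>

section \<open>The solution of the Stein equation\<close>

text \<open>Since \<open>x - x0\<close> is of order \<open>1 / sqrt n\<close>, it shifts the
  conditional mean of the spin sum by the order of its fluctuations. The linear term is therefore
  part of the limiting variance and has to be eliminated exactly; only the quadratic remainder,
  bounded in mean, may be estimated. The second moment of \<open>x - x0\<close> comes from
  integrating the derivative of \<open>(x - x0) * marginal x\<close>: it suffices that
  \<open>(x - x0) * drift x\<close> dominates \<open>\<kappa> * (x - x0)^2\<close>. For
  \<open>h = 0\<close> below the critical point this holds on the whole line by contraction. For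
  \<open>h > 0\<close> concavity of tanh gives it on the positive half line at every temperature,
  but a second well may sit on the negative side, so mirror images are compared there. The case
  \<open>h < 0\<close> follows by symmetry. The Stein solution has a kink at \<open>z\<close>, and
  one flip moves the spin sum by 2. The law of the sum near the threshold therefore has to be
  controlled first, by the same Stein identity. Constants depend on bounds for the first two moments
  only; the third enters affinely, so one inequality serves both claims.\<close>

lemma Phi_eq_cdf: "Phi = cdf std_normal_distribution"
  by (simp add: fun_eq_iff Phi_def cdf_def)

interpretation std_normal: real_distribution std_normal_distribution
  by (rule real_dist_normal_dist)

lemma Phi_mono: "x \<le> y \<Longrightarrow> Phi x \<le> Phi y"
  unfolding Phi_eq_cdf by (rule std_normal.cdf_nondecreasing)

lemma Phi_ge_0: "0 \<le> Phi x"
  unfolding Phi_eq_cdf by (rule std_normal.cdf_nonneg)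

lemma Phi_le_1: "Phi x \<le> 1"
  unfolding Phi_eq_cdf by (rule std_normal.cdf_bounded_prob)

lemma continuous_on_std_normal_density: "continuous_on A std_normal_density"
  unfolding std_normal_density_def by (intro continuous_intros) auto

lemma Phi_diff_eq_integral:
  assumes "a \<le> b"
  shows "Phi b - Phi a = integral {a..b} std_normal_density"
proof (cases "a = b")
  case False
  with assms have "a < b" by simp
  have int: "set_integrable lborel {a..b} std_normal_density"
    by (intro borel_integrable_atLeastAtMost' continuous_on_std_normal_density)
  have "Phi b - Phi a = measure std_normal_distribution {a<..b}"
    unfolding Phi_eq_cdf using \<open>a < b\<close> by (rule std_normal.cdf_diff_eq)
  also have "\<dots> = (\<integral>x. indicator {a<..b} x \<partial>std_normal_distribution)"
    by simp
  also have "\<dots> = (\<integral>x. std_normal_density x * indicator {a<..b} x \<partial>lborel)"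
    by (subst integral_density) auto
  also have "\<dots> = (\<integral>x. std_normal_density x * indicator {a..b} x \<partial>lborel)"
  proof (rule integral_cong_AE)
    show "AE x in lborel. std_normal_density x * indicator {a<..b} x
        = std_normal_density x * indicator {a..b} x"
      using AE_lborel_singleton[of a] by eventually_elim (auto simp: indicator_def)
  qed auto
  also have "\<dots> = (LINT x:{a..b}|lborel. std_normal_density x)"
    by (simp add: set_lebesgue_integral_def mult.commute)
  also have "\<dots> = integral {a..b} std_normal_density"
    using set_borel_integral_eq_integral(2)[OF int] by simp
  finally show ?thesis .
qed auto

lemma Phi_has_derivative: "(Phi has_real_derivative std_normal_density x) (at x)"
proof -
  have "((\<lambda>t. integral {x - 1..t} std_normal_density) has_real_derivative std_normal_density x)
      (at x within {x - 1..x + 1})"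
    by (intro integral_has_real_derivative continuous_on_std_normal_density) auto
  hence "((\<lambda>t. integral {x - 1..t} std_normal_density) has_real_derivative std_normal_density x) (at x)"
    by (simp add: at_within_Icc_at)
  hence "((\<lambda>t. Phi (x - 1) + integral {x - 1..t} std_normal_density) has_real_derivative
      std_normal_density x) (at x)"
    using DERIV_add[OF DERIV_const] by fastforce
  moreover have "Phi (x - 1) + integral {x - 1..t} std_normal_density = Phi t" if "t \<in> {x - 1<..}" for t
    using Phi_diff_eq_integral[of "x - 1" t] that by simp
  ultimately show ?thesis
    using has_field_derivative_transform_within_open[of "\<lambda>t. Phi (x - 1) + integral {x - 1..t} std_normal_density"
        "std_normal_density x" x "{x - 1<..}" Phi] by simp
qed

lemma std_normal_density_has_derivative:
  "(std_normal_density has_real_derivative (- x * std_normal_density x)) (at x)"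
  unfolding std_normal_density_def
  by (auto intro!: derivative_eq_intros simp: field_simps)

lemma Phi_minus: "Phi (- x) = 1 - Phi x"
proof -
  have "\<forall>x. DERIV (\<lambda>x. Phi x + Phi (- x)) x :> 0"
    by (auto intro!: derivative_eq_intros DERIV_chain2[OF Phi_has_derivative] Phi_has_derivative
        simp: std_normal_density_def)
  hence const: "Phi y + Phi (- y) = Phi x + Phi (- x)" for y
    by (rule DERIV_isconst_all)
  have "((\<lambda>y. Phi y + Phi (- y)) \<longlongrightarrow> 1 + 0) at_top"
    unfolding Phi_eq_cdf
    by (intro tendsto_add std_normal.cdf_lim_at_top_prob
        filterlim_compose[OF std_normal.cdf_lim_at_bot] filterlim_uminus_at_bot_at_top)
  hence "((\<lambda>y::real. Phi x + Phi (- x)) \<longlongrightarrow> 1) at_top"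
    by (subst (asm) const) simp
  thus ?thesis
    by (simp add: tendsto_const_iff)
qed

text \<open>Right side minus left side has derivative \<open>- std_normal_density y / y^2\<close>,
  so it decreases; it tends to 0 at infinity and is therefore nonnegative.\<close>

lemma mills_ratio_le:
  assumes "x > 0"
  shows "1 - Phi x \<le> std_normal_density x / x"
proof -
  define g where "g = (\<lambda>x. std_normal_density x / x - (1 - Phi x))"
  have g': "(g has_real_derivative (- std_normal_density y / y\<^sup>2)) (at y)" if "y > 0" for y
    unfolding g_def using that
    by (auto intro!: derivative_eq_intros std_normal_density_has_derivative Phi_has_derivative
        simp: field_simps power2_eq_square)
  have dec: "g z \<le> g y" if "0 < y" "y \<le> z" for y z
    using that
    by (intro DERIV_nonpos_imp_nonincreasing[of y z g]) (auto intro!: exI g')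
  have "((\<lambda>y. std_normal_density y / y - (1 - Phi y)) \<longlongrightarrow> 0 - (1 - 1)) at_top"
  proof (intro tendsto_diff tendsto_const)
    show "(Phi \<longlongrightarrow> 1) at_top"
      unfolding Phi_eq_cdf by (rule std_normal.cdf_lim_at_top_prob)
    show "((\<lambda>y. std_normal_density y / y) \<longlongrightarrow> 0) at_top"
    proof (rule tendsto_sandwich[of "\<lambda>_. 0" _ _ "\<lambda>y. 1 / y"])
      show "\<forall>\<^sub>F y in at_top. std_normal_density y / y \<le> 1 / y"
        using eventually_gt_at_top[of 0]
      proof eventually_elim
        case (elim y)
        have "1 / sqrt (2 * pi) * exp (- y\<^sup>2 / 2) \<le> 1 * 1"
          using pi_ge_two by (intro mult_mono) auto
        thus ?case
          using elim by (intro divide_right_mono) (auto simp: std_normal_density_def)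
      qed
      show "\<forall>\<^sub>F y::real in at_top. 0 \<le> std_normal_density y / y"
        using eventually_gt_at_top[of 0] by eventually_elim auto
      show "((\<lambda>y::real. 1 / y) \<longlongrightarrow> 0) at_top"
        by (intro tendsto_divide_0[OF tendsto_const] filterlim_at_top_imp_at_infinity filterlim_ident)
    qed auto
  qed
  hence "(g \<longlongrightarrow> 0) at_top"
    by (simp add: g_def)
  hence "0 \<le> g x"
    by (rule tendsto_upperbound)
      (use dec assms in \<open>auto intro!: eventually_mono[OF eventually_ge_at_top[of x]]\<close>)
  thus ?thesis
    by (simp add: g_def)
qed

text \<open>The bounded solution of Stein's equation
  \<open>f' x - x * f x = of_bool (x \<le> z) - Phi z\<close>. The two branches agree at
  \<open>x = z\<close>, but their derivatives differ there by 1.\<close>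

definition stein_sol :: "real \<Rightarrow> real \<Rightarrow> real" where
  "stein_sol z x =
     (if x \<le> z then Phi x * (1 - Phi z) else Phi z * (1 - Phi x)) / std_normal_density x"

lemma std_normal_density_pos: "std_normal_density x > 0"
  by (simp add: normal_density_pos)

lemma stein_sol_nonneg: "0 \<le> stein_sol z x"
  unfolding stein_sol_def by (auto simp: Phi_ge_0 Phi_le_1)

lemma stein_sol_le_Phi: "stein_sol z x \<le> Phi x / std_normal_density x"
  unfolding stein_sol_def
proof (intro divide_right_mono, goal_cases)
  case 1
  show ?case
    using mult_mono[of "Phi x" "Phi x" "1 - Phi z" 1] mult_mono[of "Phi z" "Phi x" "1 - Phi x" 1]
      Phi_mono[of z x] Phi_ge_0[of x] Phi_ge_0[of z] Phi_le_1[of x] Phi_le_1[of z] by auto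
qed simp

lemma stein_sol_le_1_minus_Phi: "stein_sol z x \<le> (1 - Phi x) / std_normal_density x"
  unfolding stein_sol_def
proof (intro divide_right_mono, goal_cases)
  case 1
  show ?case
    using mult_mono[of "Phi x" 1 "1 - Phi z" "1 - Phi x"] mult_mono[of "Phi z" 1 "1 - Phi x" "1 - Phi x"]
      Phi_mono[of x z] Phi_ge_0[of x] Phi_ge_0[of z] Phi_le_1[of x] Phi_le_1[of z] by auto
qed simp

text \<open>Each sign of \<open>x\<close> uses the bound by the tail on its own side, which Mills'
  ratio controls; for negative \<open>x\<close> that bound is reflected through
  \<open>Phi_minus\<close>.\<close>

lemma abs_mult_stein_sol_le: "\<bar>x * stein_sol z x\<bar> \<le> 1"
proof -
  have "\<bar>x\<bar> * stein_sol z x \<le> 1"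
  proof (cases x "0::real" rule: linorder_cases)
    case greater
    have "x * stein_sol z x \<le> x * ((1 - Phi x) / std_normal_density x)"
      using stein_sol_le_1_minus_Phi greater by (intro mult_left_mono) auto
    also have "\<dots> \<le> x * ((std_normal_density x / x) / std_normal_density x)"
      using mills_ratio_le[OF greater] greater by (intro mult_left_mono divide_right_mono) auto
    also have "\<dots> = 1"
      using greater std_normal_density_pos[of x] by simp
    finally show ?thesis using greater by simp
  next
    case less
    have eq: "std_normal_density (- x) = std_normal_density x"
      by (simp add: std_normal_density_def)
    have "- x * stein_sol z x \<le> - x * (Phi x / std_normal_density x)"
      using stein_sol_le_Phi[of z x] less by (intro mult_left_mono) auto
    also have "\<dots> \<le> - x * ((std_normal_density x / - x) / std_normal_density x)"
      using mills_ratio_le[of "- x"] less Phi_minus[of x] eq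
      by (intro mult_left_mono divide_right_mono) auto
    also have "\<dots> = 1"
      using less std_normal_density_pos[of x] by simp
    finally show ?thesis using less by simp
  qed auto
  thus ?thesis
    by (simp add: abs_mult stein_sol_nonneg)
qed

lemma stein_sol_le: "stein_sol z x \<le> 6"
proof (cases "\<bar>x\<bar> \<le> 1")
  case True
  \<comment> \<open>The constant 6 is the product of the crude bounds 3 for
    \<open>sqrt (2 * pi)\<close> and 2 for \<open>exp (1 / 2)\<close>; outside the unit interval the
    bound on \<open>x * stein_sol z x\<close> is already better.\<close>
  have "sqrt (2 * pi) \<le> 3"
    by (rule real_le_lsqrt) (use pi_less_4 in auto)
  moreover have "exp (1 / 2 :: real) \<le> 2"
  proof -
    have "exp (1 / 2 :: real) ^ 2 \<le> 2 ^ 2"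
      using exp_le by (simp flip: exp_of_nat_mult)
    thus ?thesis by (rule power2_le_imp_le) simp
  qed
  moreover have "exp (x\<^sup>2 / 2) \<le> exp (1 / 2)"
    using True by (simp add: abs_square_le_1)
  ultimately have "sqrt (2 * pi) * exp (x\<^sup>2 / 2) \<le> 3 * 2"
    by (intro mult_mono order.trans[of "exp (x\<^sup>2 / 2)" "exp (1 / 2)" 2]) auto
  moreover have "stein_sol z x \<le> 1 / std_normal_density x"
    by (rule order_trans[OF stein_sol_le_Phi]) (intro divide_right_mono Phi_le_1, simp)
  moreover have "1 / std_normal_density x = sqrt (2 * pi) * exp (x\<^sup>2 / 2)"
    by (simp add: std_normal_density_def exp_minus field_simps)
  ultimately show ?thesis by simp
next
  case False
  have "1 * stein_sol z x \<le> \<bar>x\<bar> * stein_sol z x"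
    using False by (intro mult_right_mono stein_sol_nonneg) auto
  also have "\<dots> \<le> 1"
    using abs_mult_stein_sol_le[of x z] by (simp add: abs_mult stein_sol_nonneg)
  finally show ?thesis by simp
qed

text \<open>The left branch is smooth on the whole line, so the mean value theorem applies up to and
  including the kink; its derivative is read off from Stein's equation.\<close>

lemma stein_sol_mvt_left:
  assumes "x < y" "y \<le> z"
  shows "\<exists>\<xi>. x < \<xi> \<and> \<xi> < y \<and>
    stein_sol z y - stein_sol z x = (y - x) * (\<xi> * stein_sol z \<xi> + 1 - Phi z)"
proof -
  define g where "g t = Phi t * (1 - Phi z) / std_normal_density t" for t
  have "(g has_real_derivative (t * g t + 1 - Phi z)) (at t)" for t
    unfolding g_def using std_normal_density_pos[of t]
    by (auto intro!: derivative_eq_intros Phi_has_derivative std_normal_density_has_derivative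
        simp: field_simps)
  then obtain \<xi> where \<xi>: "x < \<xi>" "\<xi> < y" "g y - g x = (y - x) * (\<xi> * g \<xi> + 1 - Phi z)"
    using MVT2[OF \<open>x < y\<close>, of g "\<lambda>t. t * g t + 1 - Phi z"] by blast
  moreover have "g t = stein_sol z t" if "t \<le> y" for t
    using that assms by (auto simp: g_def stein_sol_def)
  ultimately show ?thesis
    using \<open>x < y\<close> by (intro exI[of _ \<xi>]) auto
qed

lemma stein_sol_mvt_right:
  assumes "x < y" "z \<le> x"
  shows "\<exists>\<xi>. x < \<xi> \<and> \<xi> < y \<and>
    stein_sol z y - stein_sol z x = (y - x) * (\<xi> * stein_sol z \<xi> - Phi z)"
proof -
  define g where "g t = Phi z * (1 - Phi t) / std_normal_density t" for t
  have "(g has_real_derivative (t * g t - Phi z)) (at t)" for t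
    unfolding g_def using std_normal_density_pos[of t]
    by (auto intro!: derivative_eq_intros Phi_has_derivative std_normal_density_has_derivative
        simp: field_simps)
  then obtain \<xi> where \<xi>: "x < \<xi>" "\<xi> < y" "g y - g x = (y - x) * (\<xi> * g \<xi> - Phi z)"
    using MVT2[OF \<open>x < y\<close>, of g "\<lambda>t. t * g t - Phi z"] by blast
  moreover have "g t = stein_sol z t" if "x \<le> t" for t
    using that assms by (cases "t = z") (auto simp: g_def stein_sol_def)
  ultimately show ?thesis
    using \<open>x < y\<close> by (intro exI[of _ \<xi>]) auto
qed

text \<open>Away from \<open>z\<close> the derivative is a term of modulus at most 1 plus a
  difference of modulus at most 1. An interval containing \<open>z\<close> is split there.\<close>

lemma stein_sol_lipschitz: "\<bar>stein_sol z y - stein_sol z x\<bar> \<le> 2 * \<bar>y - x\<bar>"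
proof -
  have left: "\<bar>stein_sol z y - stein_sol z x\<bar> \<le> 2 * (y - x)" if xy: "x \<le> y" "y \<le> z" for x y
  proof (cases "x = y")
    case False
    then obtain \<xi> where
      "stein_sol z y - stein_sol z x = (y - x) * (\<xi> * stein_sol z \<xi> + 1 - Phi z)"
      using stein_sol_mvt_left[of x y z] xy by auto
    moreover have "\<bar>\<xi> * stein_sol z \<xi> + 1 - Phi z\<bar> \<le> 2"
      using abs_mult_stein_sol_le[of \<xi> z] Phi_ge_0[of z] Phi_le_1[of z] by linarith
    ultimately show ?thesis
      using xy mult_left_mono[of "\<bar>\<xi> * stein_sol z \<xi> + 1 - Phi z\<bar>" 2 "y - x"]
      by (simp add: abs_mult)
  qed auto
  have right: "\<bar>stein_sol z y - stein_sol z x\<bar> \<le> 2 * (y - x)" if xy: "x \<le> y" "z \<le> x" for x y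
  proof (cases "x = y")
    case False
    then obtain \<xi> where
      "stein_sol z y - stein_sol z x = (y - x) * (\<xi> * stein_sol z \<xi> - Phi z)"
      using stein_sol_mvt_right[of x y z] xy by auto
    moreover have "\<bar>\<xi> * stein_sol z \<xi> - Phi z\<bar> \<le> 2"
      using abs_mult_stein_sol_le[of \<xi> z] Phi_ge_0[of z] Phi_le_1[of z] by linarith
    ultimately show ?thesis
      using xy mult_left_mono[of "\<bar>\<xi> * stein_sol z \<xi> - Phi z\<bar>" 2 "y - x"]
      by (simp add: abs_mult)
  qed auto
  have "\<bar>stein_sol z y - stein_sol z x\<bar> \<le> 2 * (y - x)" if "x \<le> y" for x y
  proof -
    consider "y \<le> z" | "z \<le> x" | "x \<le> z" "z \<le> y" by linarith
    thus ?thesis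
    proof cases
      case 3
      show ?thesis
        using left[OF 3(1)] right[OF 3(2)] by simp
    qed (use left right that in auto)
  qed
  from this[of x y] this[of y x] show ?thesis
    by (cases "x \<le> y") (auto simp: abs_minus_commute)
qed

text \<open>First-order expansion whose derivative is taken from Stein's equation. If the step
  cannot reach \<open>z\<close>, the derivative varies only through
  \<open>x * stein_sol z x\<close>, which gives the quadratic error; otherwise the Lipschitz bound
  leaves an error of first order, paid only when \<open>x\<close> is within
  \<open>\<bar>e\<bar>\<close> of \<open>z\<close>.\<close>

lemma stein_sol_increment:
  "\<bar>stein_sol z (x + e) - stein_sol z x - e * (x * stein_sol z x + of_bool (x \<le> z) - Phi z)\<bar>
     \<le> \<bar>e\<bar> * (\<bar>e\<bar> * (6 + 2 * \<bar>x\<bar>) + 4 * of_bool (\<bar>x - z\<bar> \<le> \<bar>e\<bar>))"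
proof (cases "e = 0 \<or> \<bar>x - z\<bar> \<le> \<bar>e\<bar>")
  case True
  have "\<bar>x * stein_sol z x + of_bool (x \<le> z) - Phi z\<bar> \<le> 2"
    using abs_mult_stein_sol_le[of x z] Phi_ge_0[of z] Phi_le_1[of z] by auto
  hence "\<bar>e * (x * stein_sol z x + of_bool (x \<le> z) - Phi z)\<bar> \<le> \<bar>e\<bar> * 2"
    by (simp add: abs_mult mult_left_mono)
  moreover have "\<bar>stein_sol z (x + e) - stein_sol z x\<bar> \<le> 2 * \<bar>e\<bar>"
    using stein_sol_lipschitz[of z "x + e" x] by simp
  moreover have "0 \<le> \<bar>e\<bar> * (\<bar>e\<bar> * (6 + 2 * \<bar>x\<bar>))" by simp
  moreover have "\<bar>e\<bar> * 4 \<le> \<bar>e\<bar> * (4 * of_bool (\<bar>x - z\<bar> \<le> \<bar>e\<bar>))"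
    using True by auto
  ultimately show ?thesis
    unfolding distrib_left[of "\<bar>e\<bar>" "\<bar>e\<bar> * _"] by linarith
next
  case False
  \<comment> \<open>Here \<open>x\<close> and \<open>x + e\<close> lie strictly on the same side of
    \<open>z\<close>, so the indicator has one value along the whole step.\<close>
  let ?d = "of_bool (x \<le> z) - Phi z"
  have "\<exists>\<xi>. \<bar>\<xi> - x\<bar> \<le> \<bar>e\<bar> \<and>
      stein_sol z (x + e) - stein_sol z x = e * (\<xi> * stein_sol z \<xi> + ?d)"
  proof (cases "x \<le> z")
    case True
    show ?thesis
    proof (cases "e > 0")
      case e: True
      show ?thesis
        using stein_sol_mvt_left[of x "x + e" z] True False e by force
    next
      case e: False
      then obtain \<xi> where "x + e < \<xi>" "\<xi> < x"
        "stein_sol z x - stein_sol z (x + e) = (x - (x + e)) * (\<xi> * stein_sol z \<xi> + 1 - Phi z)"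
        using stein_sol_mvt_left[of "x + e" x z] True False by auto
      thus ?thesis
        using True by (intro exI[of _ \<xi>]) (auto simp: algebra_simps)
    qed
  next
    case xz: False
    show ?thesis
    proof (cases "e > 0")
      case e: True
      show ?thesis
        using stein_sol_mvt_right[of x "x + e" z] xz e by force
    next
      case e: False
      then obtain \<xi> where "x + e < \<xi>" "\<xi> < x"
        "stein_sol z x - stein_sol z (x + e) = (x - (x + e)) * (\<xi> * stein_sol z \<xi> - Phi z)"
        using stein_sol_mvt_right[of "x + e" x z] xz False by auto
      thus ?thesis
        using xz by (intro exI[of _ \<xi>]) (auto simp: algebra_simps)
    qed
  qed
  then obtain \<xi> where \<xi>: "\<bar>\<xi> - x\<bar> \<le> \<bar>e\<bar>"
    "stein_sol z (x + e) - stein_sol z x = e * (\<xi> * stein_sol z \<xi> + ?d)"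
    by blast
  have "\<bar>\<xi> * stein_sol z \<xi> - x * stein_sol z x\<bar>
      = \<bar>(\<xi> - x) * stein_sol z \<xi> + x * (stein_sol z \<xi> - stein_sol z x)\<bar>"
    by (simp add: algebra_simps)
  also have "\<dots> \<le> \<bar>\<xi> - x\<bar> * \<bar>stein_sol z \<xi>\<bar> + \<bar>x\<bar> * \<bar>stein_sol z \<xi> - stein_sol z x\<bar>"
    by (metis abs_mult abs_triangle_ineq)
  also have "\<dots> \<le> \<bar>e\<bar> * 6 + \<bar>x\<bar> * (2 * \<bar>e\<bar>)"
    using \<xi>(1) stein_sol_le[of z \<xi>] stein_sol_nonneg[of z \<xi>] stein_sol_lipschitz[of z \<xi> x]
    by (intro add_mono mult_mono) auto
  finally have "\<bar>e\<bar> * \<bar>\<xi> * stein_sol z \<xi> - x * stein_sol z x\<bar> \<le> \<bar>e\<bar> * (\<bar>e\<bar> * (6 + 2 * \<bar>x\<bar>))"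
    by (intro mult_left_mono) (auto simp: algebra_simps)
  moreover have "stein_sol z (x + e) - stein_sol z x - e * (x * stein_sol z x + of_bool (x \<le> z) - Phi z)
      = e * (\<xi> * stein_sol z \<xi> - x * stein_sol z x)"
    unfolding \<xi>(2) by (simp add: right_diff_distrib distrib_left)
  ultimately show ?thesis
    using False by (simp add: abs_mult)
qed

section \<open>Hyperbolic functions\<close>

lemma tanh_has_derivative: "(tanh has_real_derivative (1 - tanh x ^ 2)) (at x)" for x :: real
  by (auto intro!: derivative_eq_intros)

lemma abs_tanh_real_le_1: "\<bar>tanh x\<bar> \<le> 1" for x :: real
  using tanh_real_bounds[of x] by (auto simp: abs_le_iff)

lemma tanh_real_sq_le_1: "(tanh x)\<^sup>2 \<le> 1" for x :: real
  using abs_tanh_real_le_1[of x] by (simp add: abs_square_le_1)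

lemma tanh_real_mvt:
  fixes x y :: real
  shows "\<exists>\<xi>. min x y \<le> \<xi> \<and> \<xi> \<le> max x y \<and> tanh y - tanh x = (1 - (tanh \<xi>)\<^sup>2) * (y - x)"
proof (cases x y rule: linorder_cases)
  case less
  then obtain \<xi> where "x < \<xi>" "\<xi> < y" "tanh y - tanh x = (y - x) * (1 - tanh \<xi> ^ 2)"
    using MVT2[of x y tanh "\<lambda>x. 1 - tanh x ^ 2"] tanh_has_derivative by blast
  with less show ?thesis
    by (intro exI[of _ \<xi>]) auto
next
  case greater
  then obtain \<xi> where "y < \<xi>" "\<xi> < x" "tanh x - tanh y = (x - y) * (1 - tanh \<xi> ^ 2)"
    using MVT2[of y x tanh "\<lambda>x. 1 - tanh x ^ 2"] tanh_has_derivative by blast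
  with greater show ?thesis
    by (intro exI[of _ \<xi>]) (auto simp: algebra_simps)
qed auto

lemma tanh_real_lipschitz: "\<bar>tanh y - tanh x\<bar> \<le> \<bar>y - x\<bar>" for x y :: real
proof -
  obtain \<xi> where "tanh y - tanh x = (1 - (tanh \<xi>)\<^sup>2) * (y - x)"
    using tanh_real_mvt by blast
  moreover have "\<bar>1 - (tanh \<xi>)\<^sup>2\<bar> \<le> 1"
    using tanh_real_sq_le_1[of \<xi>] by (simp add: abs_le_iff)
  ultimately show ?thesis
    using mult_right_mono[of "\<bar>1 - (tanh \<xi>)\<^sup>2\<bar>" 1 "\<bar>y - x\<bar>"] by (simp add: abs_mult)
qed

lemma tanh_real_sq_lipschitz: "\<bar>(tanh y)\<^sup>2 - (tanh x)\<^sup>2\<bar> \<le> 2 * \<bar>y - x\<bar>" for x y :: real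
proof -
  have "(tanh y)\<^sup>2 - (tanh x)\<^sup>2 = (tanh y + tanh x) * (tanh y - tanh x)"
    by (simp add: power2_eq_square algebra_simps)
  moreover have "\<bar>tanh y + tanh x\<bar> * \<bar>tanh y - tanh x\<bar> \<le> 2 * \<bar>y - x\<bar>"
    using abs_tanh_real_le_1[of x] abs_tanh_real_le_1[of y] tanh_real_lipschitz[of y x]
    by (intro mult_mono) auto
  ultimately show ?thesis
    by (simp add: abs_mult)
qed

lemma tanh_real_taylor:
  "\<bar>tanh y - tanh x - (1 - (tanh x)\<^sup>2) * (y - x)\<bar> \<le> 2 * (y - x)\<^sup>2" for x y :: real
proof -
  obtain \<xi> where \<xi>: "min x y \<le> \<xi>" "\<xi> \<le> max x y" "tanh y - tanh x = (1 - (tanh \<xi>)\<^sup>2) * (y - x)"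
    using tanh_real_mvt by blast
  have "\<bar>tanh y - tanh x - (1 - (tanh x)\<^sup>2) * (y - x)\<bar> = \<bar>(tanh x)\<^sup>2 - (tanh \<xi>)\<^sup>2\<bar> * \<bar>y - x\<bar>"
    unfolding \<xi>(3) by (simp flip: abs_mult left_diff_distrib)
  also have "\<dots> \<le> (2 * \<bar>x - \<xi>\<bar>) * \<bar>y - x\<bar>"
    by (intro mult_right_mono tanh_real_sq_lipschitz) auto
  also have "\<dots> \<le> (2 * \<bar>y - x\<bar>) * \<bar>y - x\<bar>"
    using \<xi> by (intro mult_right_mono) auto
  finally show ?thesis
    by (simp add: power2_eq_square)
qed

lemma tanh_real_le_tangent:
  fixes x y :: real
  assumes "0 \<le> x" "0 \<le> y"
  shows "tanh y \<le> tanh x + (1 - (tanh x)\<^sup>2) * (y - x)"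
proof -
  obtain \<xi> where \<xi>: "min x y \<le> \<xi>" "\<xi> \<le> max x y" "tanh y - tanh x = (1 - (tanh \<xi>)\<^sup>2) * (y - x)"
    using tanh_real_mvt by blast
  have "(1 - (tanh \<xi>)\<^sup>2) * (y - x) \<le> (1 - (tanh x)\<^sup>2) * (y - x)"
  proof (cases "x \<le> y")
    case True
    hence "(tanh x)\<^sup>2 \<le> (tanh \<xi>)\<^sup>2"
      using \<xi> assms by (intro power_mono) auto
    thus ?thesis using True by (intro mult_right_mono) auto
  next
    case False
    hence "(tanh \<xi>)\<^sup>2 \<le> (tanh x)\<^sup>2"
      using \<xi> assms by (intro power_mono) auto
    thus ?thesis using False by (intro mult_right_mono_neg) auto
  qed
  thus ?thesis using \<xi>(3) by linarith
qed

text \<open>Concavity on the positive half line in chord form: secant slopes starting at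
  \<open>h\<close> decrease. Both tangent inequalities are taken at \<open>p + h\<close>, one
  evaluated at \<open>q + h\<close>, the other at \<open>h\<close>.\<close>

lemma tanh_real_chord:
  fixes h p q :: real
  assumes "0 \<le> h" "0 \<le> p" "p \<le> q"
  shows "p * (tanh (q + h) - tanh h) \<le> q * (tanh (p + h) - tanh h)"
proof -
  have "tanh (q + h) \<le> tanh (p + h) + (1 - (tanh (p + h))\<^sup>2) * (q - p)"
    using tanh_real_le_tangent[of "p + h" "q + h"] assms by simp
  hence 1: "p * (tanh (q + h) - tanh (p + h)) \<le> p * ((1 - (tanh (p + h))\<^sup>2) * (q - p))"
    using assms by (intro mult_left_mono) auto
  have "tanh h \<le> tanh (p + h) - (1 - (tanh (p + h))\<^sup>2) * p"
    using tanh_real_le_tangent[of "p + h" h] assms by simp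
  hence 2: "(q - p) * ((1 - (tanh (p + h))\<^sup>2) * p) \<le> (q - p) * (tanh (p + h) - tanh h)"
    using assms by (intro mult_left_mono) auto
  show ?thesis using 1 2 by (simp add: algebra_simps)
qed

text \<open>A quadratic minorant, so that sums of tanh can be bounded below by the first two moments
  of the weights. It passes through \<open>tanh x \<ge> x / (1 + x)\<close>.\<close>

lemma tanh_real_ge:
  assumes "0 \<le> x"
  shows "x - x\<^sup>2 \<le> tanh (x::real)"
proof -
  have "tanh x = 1 - 2 / (exp (2 * x) + 1)"
    using exp_gt_zero[of "2 * x"] unfolding tanh_real_altdef
    by (simp add: exp_minus divide_simps add_nonneg_eq_0_iff)
  moreover have "2 / (exp (2 * x) + 1) \<le> 1 / (1 + x)"
  proof -
    have "2 / (exp (2 * x) + 1) \<le> 2 / (2 * (1 + x))"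
      using exp_ge_add_one_self[of "2 * x"] assms by (intro frac_le) auto
    also have "2 / (2 * (1 + x)) = 1 / (1 + x)"
      using mult_divide_mult_cancel_left[of "2::real" 1 "1 + x"] by simp
    finally show ?thesis .
  qed
  moreover have "1 - 1 / (1 + x) - (x - x\<^sup>2) = x ^ 3 / (1 + x)"
    using assms by (simp add: field_simps power2_eq_square power3_eq_cube)
  moreover have "x ^ 3 / (1 + x) \<ge> 0"
    using assms by simp
  ultimately show ?thesis by linarith
qed

lemma one_minus_tanh_sq: "1 - (tanh x)\<^sup>2 = 1 / (cosh x)\<^sup>2" for x :: real
proof -
  have "1 - (tanh x)\<^sup>2 = ((cosh x)\<^sup>2 - (sinh x)\<^sup>2) / (cosh x)\<^sup>2"
    by (simp add: tanh_def power_divide diff_divide_distrib)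
  thus ?thesis by (simp add: cosh_square_eq)
qed

lemma one_minus_tanh_sq_ge: "exp (- 2 * \<bar>x\<bar>) \<le> 1 - (tanh x)\<^sup>2" for x :: real
proof -
  have "cosh x \<le> exp \<bar>x\<bar>"
    unfolding cosh_def by (cases "x \<ge> 0") (auto simp: field_simps)
  hence "(cosh x)\<^sup>2 \<le> exp (2 * \<bar>x\<bar>)"
    using power_mono[of "cosh x" "exp \<bar>x\<bar>" 2] by (simp flip: exp_of_nat_mult)
  hence "1 / exp (2 * \<bar>x\<bar>) \<le> 1 / (cosh x)\<^sup>2"
    by (intro divide_left_mono) auto
  thus ?thesis
    by (simp add: one_minus_tanh_sq exp_minus inverse_eq_divide)
qed

text \<open>The quotient of the two cosh values is \<open>(1 - t) / (1 + t)\<close> with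
  \<open>t = tanh h * tanh u\<close>, and this is at most \<open>exp (- t)\<close>. It is the
  contribution of one spin to the comparison of the marginal with its mirror image.\<close>

lemma cosh_reflect_le:
  fixes u h :: real
  assumes "0 \<le> u" "0 \<le> h"
  shows "cosh (u - h) \<le> exp (- (tanh h * tanh u)) * cosh (u + h)"
proof -
  define \<tau> where "\<tau> = tanh h * tanh u"
  have \<tau>: "0 \<le> \<tau>"
    using assms by (simp add: \<tau>_def)
  have p: "cosh (u + h) = cosh u * cosh h * (1 + \<tau>)"
    by (simp add: cosh_add \<tau>_def tanh_def field_simps)
  have m: "cosh (u - h) = cosh u * cosh h * (1 - \<tau>)"
    by (simp add: cosh_diff \<tau>_def tanh_def field_simps)
  have "1 - \<tau> \<le> exp (- \<tau>)"
    using exp_ge_add_one_self[of "- \<tau>"] by simp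
  also have "exp (- \<tau>) \<le> exp (- \<tau>) * (1 + \<tau>)"
    using \<tau> by simp
  finally have "cosh u * cosh h * (1 - \<tau>) \<le> cosh u * cosh h * (exp (- \<tau>) * (1 + \<tau>))"
    by (intro mult_left_mono) auto
  thus ?thesis
    unfolding p m \<tau>_def by (simp add: mult_ac)
qed

section \<open>Hubbard--Stratonovich coupling\<close>

text \<open>A class of functions integrable against every Gaussian and closed under all operations
  used below; the rules in \<open>tame_intros\<close> then discharge the integrability conditions
  automatically.\<close>

definition tame :: "(real \<Rightarrow> real) \<Rightarrow> bool" where
  "tame f \<longleftrightarrow> continuous_on UNIV f \<and> (\<exists>C k. \<forall>x. \<bar>f x\<bar> \<le> C * (1 + \<bar>x\<bar>) ^ k)"

named_theorems tame_intros

lemma tameI: "continuous_on UNIV f \<Longrightarrow> (\<And>x. \<bar>f x\<bar> \<le> C * (1 + \<bar>x\<bar>) ^ k) \<Longrightarrow> tame f"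
  by (auto simp: tame_def)

lemma tame_const [tame_intros]: "tame (\<lambda>_. c)"
  by (rule tameI[of _ "\<bar>c\<bar>" 0]) auto

lemma tame_id [tame_intros]: "tame (\<lambda>x. x)"
  by (rule tameI[of _ 1 1]) auto

lemma tame_tanh [tame_intros]: "tame (\<lambda>x. tanh (a * x + b))"
  by (rule tameI[of _ 1 0]) (auto intro!: continuous_intros abs_tanh_real_le_1)

lemma tame_minus [tame_intros]: "tame f \<Longrightarrow> tame (\<lambda>x. - f x)"
  by (auto simp: tame_def intro!: continuous_intros)

lemma tame_abs [tame_intros]: "tame f \<Longrightarrow> tame (\<lambda>x. \<bar>f x\<bar>)"
  by (auto simp: tame_def intro!: continuous_intros)

lemma tame_add [tame_intros]:
  assumes "tame f" "tame g"
  shows "tame (\<lambda>x. f x + g x)"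
proof -
  obtain C k where f: "\<And>x. \<bar>f x\<bar> \<le> C * (1 + \<bar>x\<bar>) ^ k" using assms by (auto simp: tame_def)
  obtain D l where g: "\<And>x. \<bar>g x\<bar> \<le> D * (1 + \<bar>x\<bar>) ^ l" using assms by (auto simp: tame_def)
  have C: "0 \<le> C" "0 \<le> D"
    using f[of 0] g[of 0] by auto
  show ?thesis
  proof (rule tameI)
    show "continuous_on UNIV (\<lambda>x. f x + g x)"
      using assms by (auto simp: tame_def intro!: continuous_intros)
    fix x
    have "C * (1 + \<bar>x\<bar>) ^ k \<le> C * (1 + \<bar>x\<bar>) ^ (k + l)" "D * (1 + \<bar>x\<bar>) ^ l \<le> D * (1 + \<bar>x\<bar>) ^ (k + l)"
      using C by (auto intro!: mult_left_mono power_increasing)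
    thus "\<bar>f x + g x\<bar> \<le> (C + D) * (1 + \<bar>x\<bar>) ^ (k + l)"
      using f[of x] g[of x] unfolding distrib_right by linarith
  qed
qed

lemma tame_mult [tame_intros]:
  assumes "tame f" "tame g"
  shows "tame (\<lambda>x. f x * g x)"
proof -
  obtain C k where f: "\<And>x. \<bar>f x\<bar> \<le> C * (1 + \<bar>x\<bar>) ^ k" using assms by (auto simp: tame_def)
  obtain D l where g: "\<And>x. \<bar>g x\<bar> \<le> D * (1 + \<bar>x\<bar>) ^ l" using assms by (auto simp: tame_def)
  have C: "0 \<le> C" "0 \<le> D"
    using f[of 0] g[of 0] by auto
  show ?thesis
  proof (rule tameI)
    show "continuous_on UNIV (\<lambda>x. f x * g x)"
      using assms by (auto simp: tame_def intro!: continuous_intros)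
    fix x
    have "\<bar>f x\<bar> * \<bar>g x\<bar> \<le> (C * (1 + \<bar>x\<bar>) ^ k) * (D * (1 + \<bar>x\<bar>) ^ l)"
      using C by (intro mult_mono f g) auto
    thus "\<bar>f x * g x\<bar> \<le> (C * D) * (1 + \<bar>x\<bar>) ^ (k + l)"
      by (simp add: abs_mult power_add mult_ac)
  qed
qed

lemma tame_diff [tame_intros]: "tame f \<Longrightarrow> tame g \<Longrightarrow> tame (\<lambda>x. f x - g x)"
  using tame_add[of f "\<lambda>x. - g x"] tame_minus[of g] by simp

lemma tame_divide [tame_intros]: "tame f \<Longrightarrow> tame (\<lambda>x. f x / c)"
  using tame_mult[of f "\<lambda>_. 1 / c"] tame_const[of "1 / c"] by simp

lemma tame_power [tame_intros]: "tame f \<Longrightarrow> tame (\<lambda>x. f x ^ k)"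
  by (induction k) (auto intro: tame_intros)

lemma tame_sum [tame_intros]: "(\<And>i. i \<in> A \<Longrightarrow> tame (f i)) \<Longrightarrow> tame (\<lambda>x. \<Sum>i\<in>A. f i x)"
  by (induction A rule: infinite_finite_induct) (auto intro: tame_intros)

text \<open>The growth bound is recentred at \<open>\<mu>\<close> by \<open>1 + \<bar>x\<bar> \<le>
  (1 + \<bar>\<mu>\<bar>) * (2 * max 1 \<bar>x - \<mu>\<bar>)\<close>, which leaves absolute central
  moments of the Gaussian.\<close>

lemma integrable_normal_density_tame:
  assumes "0 < s" "tame f"
  shows "integrable lborel (\<lambda>x. normal_density \<mu> s x * f x)"
proof -
  obtain C k where f: "\<And>x. \<bar>f x\<bar> \<le> C * (1 + \<bar>x\<bar>) ^ k" using assms by (auto simp: tame_def)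
  have C: "0 \<le> C"
    using f[of 0] by auto
  let ?g = "\<lambda>x. C * 2 ^ k * (1 + \<bar>\<mu>\<bar>) ^ k * (normal_density \<mu> s x + normal_density \<mu> s x * \<bar>x - \<mu>\<bar> ^ k)"
  have meas: "f \<in> borel_measurable borel"
    using assms by (auto simp: tame_def intro: borel_measurable_continuous_onI)
  have "integrable lborel ?g"
    using assms integrable_normal_moment_abs[of s \<mu> k] by (intro integrable_mult_right integrable_add) auto
  moreover have "(\<lambda>x. normal_density \<mu> s x * f x) \<in> borel_measurable lborel"
    using meas by auto
  moreover have "norm (normal_density \<mu> s x * f x) \<le> norm (?g x)" for x
  proof -
    have "(1 + \<bar>x\<bar>) ^ k \<le> ((1 + \<bar>\<mu>\<bar>) * (2 * max 1 \<bar>x - \<mu>\<bar>)) ^ k"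
    proof (rule power_mono)
      have "1 + \<bar>x\<bar> \<le> (1 + \<bar>\<mu>\<bar>) + \<bar>x - \<mu>\<bar>" by simp
      also have "\<dots> \<le> (1 + \<bar>\<mu>\<bar>) * max 1 \<bar>x - \<mu>\<bar> + (1 + \<bar>\<mu>\<bar>) * max 1 \<bar>x - \<mu>\<bar>"
      proof (rule add_mono)
        show "1 + \<bar>\<mu>\<bar> \<le> (1 + \<bar>\<mu>\<bar>) * max 1 \<bar>x - \<mu>\<bar>"
          using mult_left_mono[of 1 "max 1 \<bar>x - \<mu>\<bar>" "1 + \<bar>\<mu>\<bar>"] by simp
        show "\<bar>x - \<mu>\<bar> \<le> (1 + \<bar>\<mu>\<bar>) * max 1 \<bar>x - \<mu>\<bar>"
          using mult_mono[of 1 "1 + \<bar>\<mu>\<bar>" "\<bar>x - \<mu>\<bar>" "max 1 \<bar>x - \<mu>\<bar>"] by simp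
      qed
      finally show "1 + \<bar>x\<bar> \<le> (1 + \<bar>\<mu>\<bar>) * (2 * max 1 \<bar>x - \<mu>\<bar>)" by simp
    qed auto
    also have "\<dots> = 2 ^ k * (1 + \<bar>\<mu>\<bar>) ^ k * max 1 \<bar>x - \<mu>\<bar> ^ k"
      by (simp add: power_mult_distrib)
    also have "\<dots> \<le> 2 ^ k * (1 + \<bar>\<mu>\<bar>) ^ k * (1 + \<bar>x - \<mu>\<bar> ^ k)"
      by (intro mult_left_mono) (auto simp: max_def)
    finally have "C * (1 + \<bar>x\<bar>) ^ k \<le> C * (2 ^ k * (1 + \<bar>\<mu>\<bar>) ^ k * (1 + \<bar>x - \<mu>\<bar> ^ k))"
      using C by (intro mult_left_mono)
    hence "\<bar>f x\<bar> \<le> C * (2 ^ k * (1 + \<bar>\<mu>\<bar>) ^ k * (1 + \<bar>x - \<mu>\<bar> ^ k))"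
      using f[of x] by linarith
    hence "normal_density \<mu> s x * \<bar>f x\<bar>
        \<le> normal_density \<mu> s x * (C * (2 ^ k * (1 + \<bar>\<mu>\<bar>) ^ k * (1 + \<bar>x - \<mu>\<bar> ^ k)))"
      by (intro mult_left_mono) auto
    also have "\<dots> = ?g x" by (simp add: algebra_simps)
    finally show ?thesis using C by (simp add: abs_mult)
  qed
  ultimately show ?thesis
    by (rule Bochner_Integration.integrable_bound[OF _ _ AE_I2])
qed

section \<open>Spin flips on the configuration space\<close>

definition flip :: "nat \<Rightarrow> (nat \<Rightarrow> real) \<Rightarrow> nat \<Rightarrow> real" where
  "flip i \<sigma> = \<sigma>(i := - \<sigma> i)"

lemma flip_flip [simp]: "flip i (flip i \<sigma>) = \<sigma>"
  by (simp add: flip_def)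

lemma flip_Conf: "i < n \<Longrightarrow> \<sigma> \<in> Conf n \<Longrightarrow> flip i \<sigma> \<in> Conf n"
  by (auto simp: flip_def Conf_def PiE_iff extensional_def)

lemma sum_flip: "i < n \<Longrightarrow> (\<Sum>\<sigma>\<in>Conf n. g (flip i \<sigma>)) = (\<Sum>\<sigma>\<in>Conf n. g \<sigma>)"
  by (rule sum.reindex_bij_witness[of _ "flip i" "flip i"]) (auto intro: flip_Conf)

lemma finite_Conf [simp]: "finite (Conf n)"
  by (auto simp: Conf_def intro!: finite_PiE)

lemma Conf_cases: "\<sigma> \<in> Conf n \<Longrightarrow> i < n \<Longrightarrow> \<sigma> i = 1 \<or> \<sigma> i = - 1"
  by (auto simp: Conf_def PiE_iff)

lemma Conf_nonempty: "Conf n \<noteq> {}"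
  by (auto simp: Conf_def PiE_eq_empty_iff)

section \<open>The joint weight of spins and auxiliary coordinate, and its exact identities\<close>

locale tilted_spins =
  fixes n :: nat and u :: "nat \<Rightarrow> real" and h :: real
  assumes n_pos: "0 < n" and u_nonneg: "\<And>i. i < n \<Longrightarrow> 0 \<le> u i"
begin

definition joint :: "real \<Rightarrow> (nat \<Rightarrow> real) \<Rightarrow> real" where
  "joint x \<sigma> = exp (- real n * x\<^sup>2 / 2 + (\<Sum>i<n. \<sigma> i * (u i * x + h)))"

definition \<tau> :: "nat \<Rightarrow> real \<Rightarrow> real" where
  "\<tau> i x = tanh (u i * x + h)"

text \<open>The discrete derivative in coordinate \<open>i\<close>: on \<open>Conf n\<close> it is
  half the difference of \<open>\<phi>\<close> at spin 1 and at spin -1, whichever value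
  \<open>\<sigma> i\<close> has.\<close>

definition spin_diff :: "nat \<Rightarrow> ((nat \<Rightarrow> real) \<Rightarrow> real) \<Rightarrow> (nat \<Rightarrow> real) \<Rightarrow> real" where
  "spin_diff i \<phi> \<sigma> = \<sigma> i * (\<phi> \<sigma> - \<phi> (flip i \<sigma>)) / 2"

definition avg :: "(nat \<Rightarrow> real) \<Rightarrow> real" where
  "avg f = (\<Sum>i<n. f i) / real n"

lemma joint_pos: "0 < joint x \<sigma>"
  by (simp add: joint_def)

text \<open>For fixed \<open>x\<close> the spins are independent, so this is integration by parts
  for one two-valued variable with mean \<open>\<tau> i x\<close> and variance
  \<open>1 - (\<tau> i x)^2\<close>. Pairing each configuration with its flip reduces it to two
  terms differing only in the factor \<open>exp (\<sigma> i * y)\<close>.\<close>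

lemma spin_sum_identity:
  assumes i: "i < n"
  shows "(\<Sum>\<sigma>\<in>Conf n. joint x \<sigma> * ((\<sigma> i - \<tau> i x) * \<phi> \<sigma>))
    = (\<Sum>\<sigma>\<in>Conf n. joint x \<sigma> * ((1 - (\<tau> i x)\<^sup>2) * spin_diff i \<phi> \<sigma>))"
proof -
  define y where "y = u i * x + h"
  define A where "A \<sigma> = joint x \<sigma> * ((\<sigma> i - \<tau> i x) * \<phi> \<sigma>)" for \<sigma>
  define B where "B \<sigma> = joint x \<sigma> * ((1 - (\<tau> i x)\<^sup>2) * spin_diff i \<phi> \<sigma>)" for \<sigma>
  have ep: "exp y = cosh y * (1 + tanh y)" and em: "exp (- y) = cosh y * (1 - tanh y)"
    by (simp_all add: tanh_def field_simps sinh_plus_cosh cosh_minus_sinh cosh_plus_sinh)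
  have pair: "A \<sigma> + A (flip i \<sigma>) = B \<sigma> + B (flip i \<sigma>)" if \<sigma>: "\<sigma> \<in> Conf n" for \<sigma>
  proof -
    define E where "E = exp (- real n * x\<^sup>2 / 2 + (\<Sum>j\<in>{..<n} - {i}. \<sigma> j * (u j * x + h)))"
    have 1: "joint x \<sigma> = E * exp (\<sigma> i * y)"
      unfolding joint_def E_def y_def using i
      by (subst sum.remove[of _ i]) (auto simp: algebra_simps simp flip: exp_add)
    have "(\<Sum>j\<in>{..<n} - {i}. flip i \<sigma> j * (u j * x + h)) = (\<Sum>j\<in>{..<n} - {i}. \<sigma> j * (u j * x + h))"
      by (intro sum.cong) (auto simp: flip_def)
    hence 2: "joint x (flip i \<sigma>) = E * exp (- \<sigma> i * y)"
      unfolding joint_def E_def y_def using i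
      by (subst sum.remove[of _ i]) (auto simp: flip_def algebra_simps simp flip: exp_add)
    have 3: "flip i \<sigma> i = - \<sigma> i" by (simp add: flip_def)
    show ?thesis
      using Conf_cases[OF \<sigma> i] unfolding A_def B_def spin_diff_def 1 2 3 \<tau>_def y_def[symmetric]
      by (elim disjE) (simp_all add: ep em field_simps power2_eq_square)
  qed
  have "2 * (\<Sum>\<sigma>\<in>Conf n. A \<sigma>) = (\<Sum>\<sigma>\<in>Conf n. A \<sigma> + A (flip i \<sigma>))"
    using sum_flip[OF i, of A] by (simp add: sum.distrib)
  also have "\<dots> = (\<Sum>\<sigma>\<in>Conf n. B \<sigma> + B (flip i \<sigma>))"
    by (intro sum.cong refl pair)
  also have "\<dots> = 2 * (\<Sum>\<sigma>\<in>Conf n. B \<sigma>)"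
    using sum_flip[OF i, of B] by (simp add: sum.distrib)
  finally show ?thesis by (simp add: A_def B_def)
qed

definition R :: "(nat \<Rightarrow> real) \<Rightarrow> real" where
  "R \<sigma> = (\<Sum>i<n. u i * \<sigma> i)"

definition S :: "(nat \<Rightarrow> real) \<Rightarrow> real" where
  "S \<sigma> = (\<Sum>i<n. \<sigma> i)"

text \<open>With \<open>u i = sqrt (\<beta> / EWn w n id) * w n i\<close> this is
  \<open>cw_weight\<close>, because \<open>ell w n = n * EWn w n id\<close>.\<close>

definition gibbs :: "(nat \<Rightarrow> real) \<Rightarrow> real" where
  "gibbs \<sigma> = exp ((R \<sigma>)\<^sup>2 / (2 * real n) + h * S \<sigma>)"

text \<open>Hubbard--Stratonovich: given the spins, the auxiliary coordinate is Gaussian.\<close>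

lemma joint_eq_normal_density:
  "joint x \<sigma> = sqrt (2 * pi / real n) * gibbs \<sigma> * normal_density (R \<sigma> / real n) (1 / sqrt (real n)) x"
proof -
  have "(\<Sum>i<n. \<sigma> i * (u i * x + h)) = R \<sigma> * x + h * S \<sigma>"
    by (simp add: R_def S_def sum_distrib_left sum_distrib_right sum.distrib algebra_simps)
  hence 1: "- real n * x\<^sup>2 / 2 + (\<Sum>i<n. \<sigma> i * (u i * x + h))
      = ((R \<sigma>)\<^sup>2 / (2 * real n) + h * S \<sigma>) + (- (x - R \<sigma> / real n)\<^sup>2 / (2 * (1 / sqrt (real n))\<^sup>2))"
      (is "_ = _ + ?e")
    using n_pos by (simp add: field_simps power2_eq_square)
  have 2: "sqrt (2 * pi / real n) * (1 / sqrt (2 * pi * (1 / sqrt (real n))\<^sup>2)) = 1"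
    using n_pos by (simp add: power_divide)
  have "joint x \<sigma> = gibbs \<sigma> * exp ?e"
    unfolding joint_def gibbs_def 1 by (rule exp_add)
  also have "\<dots> = (sqrt (2 * pi / real n) * (1 / sqrt (2 * pi * (1 / sqrt (real n))\<^sup>2))) *
      (gibbs \<sigma> * exp ?e)"
    unfolding 2 by simp
  finally show ?thesis
    unfolding normal_density_def by (simp only: mult_ac)
qed

lemma integrable_joint_tame:
  assumes "tame f"
  shows "integrable lborel (\<lambda>x. joint x \<sigma> * f x)"
proof -
  have "integrable lborel (\<lambda>x. (sqrt (2 * pi / real n) * gibbs \<sigma>) *
      (normal_density (R \<sigma> / real n) (1 / sqrt (real n)) x * f x))"
    using n_pos assms by (intro integrable_mult_right integrable_normal_density_tame) auto
  thus ?thesis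
    by (simp add: joint_eq_normal_density mult_ac)
qed

text \<open>The unnormalized joint expectation. Its total mass \<open>J (\<lambda>_ _. 1)\<close> is
  kept as a factor on the right of all estimates and divided out only at the end.\<close>

definition J :: "(real \<Rightarrow> (nat \<Rightarrow> real) \<Rightarrow> real) \<Rightarrow> real" where
  "J g = (\<integral>x. (\<Sum>\<sigma>\<in>Conf n. joint x \<sigma> * g x \<sigma>) \<partial>lborel)"

definition adm :: "(real \<Rightarrow> (nat \<Rightarrow> real) \<Rightarrow> real) \<Rightarrow> bool" where
  "adm g \<longleftrightarrow> (\<forall>\<sigma>. tame (\<lambda>x. g x \<sigma>))"

lemma adm_integrable: "adm g \<Longrightarrow> integrable lborel (\<lambda>x. \<Sum>\<sigma>\<in>Conf n. joint x \<sigma> * g x \<sigma>)"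
  by (intro Bochner_Integration.integrable_sum integrable_joint_tame) (auto simp: adm_def)

lemma J_add: "adm f \<Longrightarrow> adm g \<Longrightarrow> J (\<lambda>x \<sigma>. f x \<sigma> + g x \<sigma>) = J f + J g"
  unfolding J_def by (simp add: distrib_left sum.distrib adm_integrable)

lemma J_diff: "adm f \<Longrightarrow> adm g \<Longrightarrow> J (\<lambda>x \<sigma>. f x \<sigma> - g x \<sigma>) = J f - J g"
  unfolding J_def by (simp add: right_diff_distrib sum_subtractf adm_integrable)

lemma J_cmult: "J (\<lambda>x \<sigma>. c * g x \<sigma>) = c * J g"
proof -
  have "(\<Sum>\<sigma>\<in>Conf n. joint x \<sigma> * (c * g x \<sigma>)) = c * (\<Sum>\<sigma>\<in>Conf n. joint x \<sigma> * g x \<sigma>)" for x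
    by (simp add: sum_distrib_left mult_ac)
  thus ?thesis by (simp add: J_def)
qed

lemma J_sum:
  assumes "finite A" "\<And>i. i \<in> A \<Longrightarrow> adm (g i)"
  shows "J (\<lambda>x \<sigma>. \<Sum>i\<in>A. g i x \<sigma>) = (\<Sum>i\<in>A. J (g i))"
  using assms
proof (induction A)
  case (insert a A)
  moreover have "adm (\<lambda>x \<sigma>. \<Sum>i\<in>A. g i x \<sigma>)"
    using insert by (auto simp: adm_def intro!: tame_intros)
  ultimately show ?case
    by (simp add: J_add)
qed (simp add: J_def)

lemma J_mono:
  assumes "adm f" "adm g" "\<And>x \<sigma>. \<sigma> \<in> Conf n \<Longrightarrow> f x \<sigma> \<le> g x \<sigma>"
  shows "J f \<le> J g"
  unfolding J_def using assms(1,2)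
  by (intro integral_mono adm_integrable sum_mono mult_left_mono assms(3))
    (auto intro: less_imp_le joint_pos)

lemma J_abs_le:
  assumes "adm f" "adm g" "\<And>x \<sigma>. \<sigma> \<in> Conf n \<Longrightarrow> \<bar>f x \<sigma>\<bar> \<le> g x \<sigma>"
  shows "\<bar>J f\<bar> \<le> J g"
proof -
  have "J f \<le> J g"
    using assms(3) by (intro J_mono assms) (auto simp: abs_le_iff)
  moreover have "J (\<lambda>x \<sigma>. (- 1) * f x \<sigma>) \<le> J g"
    using assms by (intro J_mono) (auto simp: abs_le_iff adm_def intro!: tame_intros)
  ultimately show ?thesis
    unfolding J_cmult by simp
qed

text \<open>Each Gaussian factor integrates to 1 and leaves a constant independent of the spins,
  which cancels in Gibbs probabilities.\<close>

lemma J_spins: "J (\<lambda>x \<sigma>. \<phi> \<sigma>) = sqrt (2 * pi / real n) * (\<Sum>\<sigma>\<in>Conf n. gibbs \<sigma> * \<phi> \<sigma>)"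
proof -
  have "J (\<lambda>x \<sigma>. \<phi> \<sigma>) = (\<Sum>\<sigma>\<in>Conf n. \<integral>x. joint x \<sigma> * \<phi> \<sigma> \<partial>lborel)"
    unfolding J_def by (intro Bochner_Integration.integral_sum integrable_joint_tame tame_intros)
  also have "\<dots> = (\<Sum>\<sigma>\<in>Conf n. sqrt (2 * pi / real n) * (gibbs \<sigma> * \<phi> \<sigma>))"
    using n_pos by (intro sum.cong refl) (simp add: joint_eq_normal_density)
  finally show ?thesis by (simp add: sum_distrib_left)
qed

text \<open>Given the spins, \<open>x\<close> has mean \<open>R \<sigma> / n\<close>, and
  \<open>\<phi>\<close> does not involve \<open>x\<close>; the first central moment
  vanishes.\<close>

lemma J_gaussian_ibp: "J (\<lambda>x \<sigma>. (real n * x - R \<sigma>) * \<phi> \<sigma>) = 0"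
proof -
  have "J (\<lambda>x \<sigma>. (real n * x - R \<sigma>) * \<phi> \<sigma>)
      = (\<Sum>\<sigma>\<in>Conf n. \<integral>x. joint x \<sigma> * ((real n * x - R \<sigma>) * \<phi> \<sigma>) \<partial>lborel)"
    unfolding J_def by (intro Bochner_Integration.integral_sum integrable_joint_tame tame_intros)
  also have "\<dots> = (\<Sum>\<sigma>\<in>Conf n. \<integral>x. (sqrt (2 * pi / real n) * gibbs \<sigma> * real n * \<phi> \<sigma>) *
      (normal_density (R \<sigma> / real n) (1 / sqrt (real n)) x * (x - R \<sigma> / real n)) \<partial>lborel)"
    using n_pos
    by (intro sum.cong refl Bochner_Integration.integral_cong)
      (auto simp: joint_eq_normal_density field_simps)
  also have "\<dots> = 0"
    using n_pos integral_normal_moment_odd[of "1 / sqrt (real n)" _ 0] by simp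
  finally show ?thesis .
qed

lemma J_spin_identity:
  assumes "i < n"
  shows "J (\<lambda>x \<sigma>. (\<sigma> i - \<tau> i x) * \<phi> \<sigma>) = J (\<lambda>x \<sigma>. (1 - (\<tau> i x)\<^sup>2) * spin_diff i \<phi> \<sigma>)"
  unfolding J_def using spin_sum_identity[OF assms] by simp

lemma J_one_pos: "0 < J (\<lambda>_ _. 1)"
  unfolding J_spins using n_pos Conf_nonempty
  by (intro mult_pos_pos sum_pos) (auto simp: gibbs_def)

end

section \<open>Approximate Stein identity\<close>

text \<open>The arithmetic-geometric mean inequality. With \<open>r\<close> of order
  \<open>sqrt n\<close> or \<open>1 / sqrt n\<close> it turns second moments into first moments, in
  place of the Cauchy-Schwarz inequality.\<close>

lemma abs_le_scaled_square: "0 < r \<Longrightarrow> \<bar>y\<bar> \<le> (r * y\<^sup>2 + 1 / r) / 2" for r y :: real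
proof -
  assume r: "0 < r"
  have "0 \<le> (r * \<bar>y\<bar> - 1)\<^sup>2 / r" using r by simp
  also have "\<dots> = r * y\<^sup>2 + 1 / r - 2 * \<bar>y\<bar>"
    using r by (simp add: power2_eq_square field_simps)
  finally show ?thesis by simp
qed

context tilted_spins
begin

lemma avg_mono: "(\<And>i. i < n \<Longrightarrow> f i \<le> g i) \<Longrightarrow> avg f \<le> avg g"
  unfolding avg_def by (intro divide_right_mono sum_mono) auto

lemma avg_nonneg: "(\<And>i. i < n \<Longrightarrow> 0 \<le> f i) \<Longrightarrow> 0 \<le> avg f"
  unfolding avg_def by (intro divide_nonneg_nonneg sum_nonneg) auto

lemma avg_abs_le: "(\<And>i. i < n \<Longrightarrow> \<bar>f i\<bar> \<le> g i) \<Longrightarrow> \<bar>avg f\<bar> \<le> avg g"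
  unfolding avg_def abs_divide
  by (auto intro!: divide_right_mono order.trans[OF sum_abs] sum_mono)

lemma avg_add: "avg (\<lambda>i. f i + g i) = avg f + avg g"
  by (simp add: avg_def sum.distrib add_divide_distrib)

lemma avg_diff: "avg (\<lambda>i. f i - g i) = avg f - avg g"
  by (simp add: avg_def sum_subtractf diff_divide_distrib)

lemma avg_cmult: "avg (\<lambda>i. c * f i) = c * avg f"
  by (simp add: avg_def sum_distrib_left)

lemma avg_mult_right: "avg (\<lambda>i. f i * c) = avg f * c"
  by (simp add: avg_def sum_distrib_right)

lemma avg_const: "avg (\<lambda>i. c) = c"
  using n_pos by (simp add: avg_def)

text \<open>The derivative of the effective potential: \<open>- n * drift x\<close> is the
  logarithmic derivative of the density \<open>marginal\<close> introduced below.\<close>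

definition drift :: "real \<Rightarrow> real" where
  "drift x = x - avg (\<lambda>i. u i * \<tau> i x)"

lemma tame_\<tau> [tame_intros]: "tame (\<tau> i)"
  unfolding \<tau>_def by (intro tame_intros)

lemma tame_avg [tame_intros]: "(\<And>i. tame (f i)) \<Longrightarrow> tame (\<lambda>x. avg (\<lambda>i. f i x))"
  unfolding avg_def by (intro tame_intros)

lemma tame_drift [tame_intros]: "tame drift"
  unfolding drift_def by (intro tame_intros)

lemma \<tau>_sq_le_1: "(\<tau> i x)\<^sup>2 \<le> 1"
  by (simp add: \<tau>_def tanh_real_sq_le_1)

lemma abs_\<tau>_le_1: "\<bar>\<tau> i x\<bar> \<le> 1"
  by (simp add: \<tau>_def abs_tanh_real_le_1)

lemma \<tau>_lipschitz: "i < n \<Longrightarrow> \<bar>\<tau> i x - \<tau> i y\<bar> \<le> u i * \<bar>x - y\<bar>"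
  using tanh_real_lipschitz[of "u i * x + h" "u i * y + h"] u_nonneg[of i]
  by (simp add: \<tau>_def abs_mult flip: right_diff_distrib)

lemma \<tau>_sq_lipschitz: "i < n \<Longrightarrow> \<bar>(\<tau> i x)\<^sup>2 - (\<tau> i y)\<^sup>2\<bar> \<le> 2 * u i * \<bar>x - y\<bar>"
  using tanh_real_sq_lipschitz[of "u i * x + h" "u i * y + h"] u_nonneg[of i]
  by (simp add: \<tau>_def abs_mult flip: right_diff_distrib)

lemma \<tau>_taylor:
  "i < n \<Longrightarrow> \<bar>\<tau> i x - \<tau> i y - (1 - (\<tau> i y)\<^sup>2) * (u i * (x - y))\<bar> \<le> 2 * ((u i)\<^sup>2 * (x - y)\<^sup>2)"
  using tanh_real_taylor[of "u i * x + h" "u i * y + h"]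
  by (simp add: \<tau>_def power_mult_distrib flip: right_diff_distrib)

lemma S_flip:
  assumes "i < n"
  shows "S (flip i \<sigma>) = S \<sigma> - 2 * \<sigma> i"
proof -
  have "(\<Sum>j\<in>{..<n} - {i}. flip i \<sigma> j) = (\<Sum>j\<in>{..<n} - {i}. \<sigma> j)"
    by (intro sum.cong) (auto simp: flip_def)
  thus ?thesis
    using assms sum.remove[of "{..<n}" i "flip i \<sigma>"] sum.remove[of "{..<n}" i \<sigma>]
    by (simp add: S_def flip_def)
qed

lemma S_identity: "J (\<lambda>x \<sigma>. (S \<sigma> - (\<Sum>i<n. \<tau> i x)) * \<phi> \<sigma>)
    = J (\<lambda>x \<sigma>. \<Sum>i<n. (1 - (\<tau> i x)\<^sup>2) * spin_diff i \<phi> \<sigma>)"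
proof -
  have "J (\<lambda>x \<sigma>. (S \<sigma> - (\<Sum>i<n. \<tau> i x)) * \<phi> \<sigma>) = J (\<lambda>x \<sigma>. \<Sum>i<n. (\<sigma> i - \<tau> i x) * \<phi> \<sigma>)"
    by (simp add: S_def sum_subtractf flip: sum_distrib_right)
  also have "\<dots> = (\<Sum>i<n. J (\<lambda>x \<sigma>. (\<sigma> i - \<tau> i x) * \<phi> \<sigma>))"
    by (intro J_sum) (auto simp: adm_def intro!: tame_intros)
  also have "\<dots> = (\<Sum>i<n. J (\<lambda>x \<sigma>. (1 - (\<tau> i x)\<^sup>2) * spin_diff i \<phi> \<sigma>))"
    by (intro sum.cong J_spin_identity) auto
  also have "\<dots> = J (\<lambda>x \<sigma>. \<Sum>i<n. (1 - (\<tau> i x)\<^sup>2) * spin_diff i \<phi> \<sigma>)"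
    by (intro J_sum[symmetric]) (auto simp: adm_def intro!: tame_intros)
  finally show ?thesis .
qed

text \<open>\<open>n * drift x\<close> splits into \<open>n * x - R \<sigma>\<close>, which averages
  to zero given the spins, and the sum of \<open>u i * (\<sigma> i - \<tau> i x)\<close>, to which
  the spin identity applies.\<close>

lemma drift_identity: "J (\<lambda>x \<sigma>. real n * drift x * \<phi> \<sigma>)
    = J (\<lambda>x \<sigma>. \<Sum>i<n. u i * ((1 - (\<tau> i x)\<^sup>2) * spin_diff i \<phi> \<sigma>))"
proof -
  have nd: "real n * drift x = real n * x - (\<Sum>i<n. u i * \<tau> i x)" for x
    using n_pos by (simp add: drift_def avg_def field_simps)
  have "real n * drift x * \<phi> \<sigma>
      = (real n * x - R \<sigma>) * \<phi> \<sigma> + (\<Sum>i<n. u i * ((\<sigma> i - \<tau> i x) * \<phi> \<sigma>))" for x \<sigma>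
    unfolding nd by (simp add: R_def algebra_simps sum_subtractf sum_distrib_left sum_distrib_right)
  hence "J (\<lambda>x \<sigma>. real n * drift x * \<phi> \<sigma>)
      = J (\<lambda>x \<sigma>. (real n * x - R \<sigma>) * \<phi> \<sigma> + (\<Sum>i<n. u i * ((\<sigma> i - \<tau> i x) * \<phi> \<sigma>)))"
    by simp
  also have "\<dots> = J (\<lambda>x \<sigma>. (real n * x - R \<sigma>) * \<phi> \<sigma>)
      + J (\<lambda>x \<sigma>. \<Sum>i<n. u i * ((\<sigma> i - \<tau> i x) * \<phi> \<sigma>))"
    by (intro J_add) (auto simp: adm_def intro!: tame_intros)
  also have "\<dots> = (\<Sum>i<n. J (\<lambda>x \<sigma>. u i * ((\<sigma> i - \<tau> i x) * \<phi> \<sigma>)))"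
    unfolding J_gaussian_ibp by (subst J_sum) (auto simp: adm_def intro!: tame_intros)
  also have "\<dots> = (\<Sum>i<n. J (\<lambda>x \<sigma>. u i * ((1 - (\<tau> i x)\<^sup>2) * spin_diff i \<phi> \<sigma>)))"
    unfolding J_cmult by (intro sum.cong arg_cong[of _ _ "(*) _"] J_spin_identity) auto
  also have "\<dots> = J (\<lambda>x \<sigma>. \<Sum>i<n. u i * ((1 - (\<tau> i x)\<^sup>2) * spin_diff i \<phi> \<sigma>))"
    by (intro J_sum[symmetric]) (auto simp: adm_def intro!: tame_intros)
  finally show ?thesis .
qed

text \<open>The spin identity applied to the centred sum, whose discrete derivatives all equal 1.
  The test function depends on \<open>x\<close> here, so the identity is used for each fixed
  \<open>x\<close> before integrating.\<close>

lemma conditional_variance_S: "J (\<lambda>x \<sigma>. (S \<sigma> - (\<Sum>i<n. \<tau> i x))\<^sup>2) \<le> real n * J (\<lambda>_ _. 1)"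
proof -
  have "(\<Sum>\<sigma>\<in>Conf n. joint x \<sigma> * (S \<sigma> - (\<Sum>i<n. \<tau> i x))\<^sup>2)
      = (\<Sum>\<sigma>\<in>Conf n. joint x \<sigma> * (\<Sum>i<n. 1 - (\<tau> i x)\<^sup>2))" for x
  proof -
    define \<phi> where "\<phi> \<sigma> = S \<sigma> - (\<Sum>i<n. \<tau> i x)" for \<sigma>
    have sd: "spin_diff i \<phi> \<sigma> = 1" if "i < n" "\<sigma> \<in> Conf n" for i \<sigma>
      using Conf_cases[OF that(2,1)] S_flip[OF that(1)] by (auto simp: spin_diff_def \<phi>_def)
    have "(\<Sum>\<sigma>\<in>Conf n. joint x \<sigma> * (\<phi> \<sigma>)\<^sup>2)
        = (\<Sum>\<sigma>\<in>Conf n. \<Sum>i<n. joint x \<sigma> * ((\<sigma> i - \<tau> i x) * \<phi> \<sigma>))"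
    proof (intro sum.cong refl)
      fix \<sigma>
      have "(\<phi> \<sigma>)\<^sup>2 = (\<Sum>i<n. \<sigma> i - \<tau> i x) * \<phi> \<sigma>"
        by (simp add: \<phi>_def S_def power2_eq_square sum_subtractf)
      thus "joint x \<sigma> * (\<phi> \<sigma>)\<^sup>2 = (\<Sum>i<n. joint x \<sigma> * ((\<sigma> i - \<tau> i x) * \<phi> \<sigma>))"
        by (simp add: sum_distrib_left sum_distrib_right)
    qed
    also have "\<dots> = (\<Sum>i<n. \<Sum>\<sigma>\<in>Conf n. joint x \<sigma> * ((\<sigma> i - \<tau> i x) * \<phi> \<sigma>))"
      by (rule sum.swap)
    also have "\<dots> = (\<Sum>i<n. \<Sum>\<sigma>\<in>Conf n. joint x \<sigma> * ((1 - (\<tau> i x)\<^sup>2) * spin_diff i \<phi> \<sigma>))"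
      by (intro sum.cong spin_sum_identity) auto
    also have "\<dots> = (\<Sum>i<n. \<Sum>\<sigma>\<in>Conf n. joint x \<sigma> * (1 - (\<tau> i x)\<^sup>2))"
      by (intro sum.cong) (auto simp: sd)
    also have "\<dots> = (\<Sum>\<sigma>\<in>Conf n. joint x \<sigma> * (\<Sum>i<n. 1 - (\<tau> i x)\<^sup>2))"
      unfolding sum_distrib_left by (rule sum.swap)
    finally show ?thesis by (simp add: \<phi>_def)
  qed
  hence "J (\<lambda>x \<sigma>. (S \<sigma> - (\<Sum>i<n. \<tau> i x))\<^sup>2) = J (\<lambda>x \<sigma>. \<Sum>i<n. 1 - (\<tau> i x)\<^sup>2)"
    unfolding J_def by simp
  also have "\<dots> \<le> J (\<lambda>x \<sigma>. real n * 1)"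
  proof (rule J_mono)
    fix x \<sigma>
    show "(\<Sum>i<n. 1 - (\<tau> i x)\<^sup>2) \<le> real n * 1"
      using sum_mono[of "{..<n}" "\<lambda>i. 1 - (\<tau> i x)\<^sup>2" "\<lambda>_. 1"] by simp
  qed (auto simp: adm_def intro!: tame_intros)
  also have "\<dots> = real n * J (\<lambda>_ _. 1)" by (rule J_cmult)
  finally show ?thesis .
qed

end

text \<open>Quantitative input for Stein's method: \<open>A\<close> bounds the first two moments of
  \<open>u\<close>, \<open>\<kappa>\<close> bounds the curvature of the potential at
  \<open>x0\<close> from below, \<open>V / n\<close> bounds the second moment of
  \<open>x - x0\<close>, and \<open>chi0\<close> keeps the limiting variance away from zero. The
  later estimates depend on these numbers and the third moment alone, hence are uniform in
  \<open>n\<close>.\<close>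

locale spins_at_fixpoint = tilted_spins +
  fixes x0 A \<kappa> V chi0 :: real
  assumes fixpoint: "x0 = avg (\<lambda>i. u i * \<tau> i x0)"
    and A: "1 \<le> A" "avg u \<le> A" "avg (\<lambda>i. (u i)\<^sup>2) \<le> A"
    and \<kappa>: "0 < \<kappa>" "\<kappa> \<le> 1 - avg (\<lambda>i. (1 - (\<tau> i x0)\<^sup>2) * (u i)\<^sup>2)"
    and V: "0 \<le> V" "J (\<lambda>x \<sigma>. (x - x0)\<^sup>2) \<le> V / real n * J (\<lambda>_ _. 1)"
    and chi0: "0 < chi0" "chi0 \<le> avg (\<lambda>i. 1 - (\<tau> i x0)\<^sup>2)"
begin

definition M :: real where
  "M = avg (\<lambda>i. \<tau> i x0)"

definition c :: real where
  "c = avg (\<lambda>i. (1 - (\<tau> i x0)\<^sup>2) * u i) / (1 - avg (\<lambda>i. (1 - (\<tau> i x0)\<^sup>2) * (u i)\<^sup>2))"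

text \<open>The total coefficient of \<open>spin_diff i\<close> when the spin identity is added to
  \<open>c\<close> times the drift identity; its average at \<open>x0\<close> is the limiting
  variance.\<close>

definition \<alpha> :: "nat \<Rightarrow> real \<Rightarrow> real" where
  "\<alpha> i x = (1 - (\<tau> i x)\<^sup>2) * (1 + c * u i)"

definition chi :: real where
  "chi = avg (\<lambda>i. \<alpha> i x0)"

text \<open>The second-order Taylor constant of the linearization; among the constants of this
  locale it alone contains the third moment.\<close>

definition E2 :: real where
  "E2 = 2 * A + A / \<kappa> * (2 * avg (\<lambda>i. u i ^ 3))"

text \<open>\<open>L\<close> is a Lipschitz constant at \<open>x0\<close> of the averaged
  \<open>\<alpha>\<close>, \<open>U\<close> its upper bound, and \<open>Y * sqrt n\<close> bounds
  the mean absolute deviation of \<open>S\<close>.\<close>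

abbreviation (input) "L \<equiv> 2 * A * (1 + A / \<kappa>)"
abbreviation (input) "U \<equiv> 1 + A / \<kappa> * A"
abbreviation (input) "Y \<equiv> 2 + A\<^sup>2 * V"
abbreviation "Z \<equiv> J (\<lambda>_ _. 1)"

lemma c_bounds: "0 \<le> c" "c \<le> A / \<kappa>"
proof -
  have "avg (\<lambda>i. (1 - (\<tau> i x0)\<^sup>2) * u i) \<le> avg u"
    using \<tau>_sq_le_1 u_nonneg by (intro avg_mono) (auto intro!: mult_left_le_one_le)
  hence *: "avg (\<lambda>i. (1 - (\<tau> i x0)\<^sup>2) * u i) \<le> A" using A by simp
  have "0 \<le> avg (\<lambda>i. (1 - (\<tau> i x0)\<^sup>2) * u i)"
    using \<tau>_sq_le_1 u_nonneg by (intro avg_nonneg) auto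
  thus "0 \<le> c" "c \<le> A / \<kappa>"
    unfolding c_def using \<kappa> A * by (auto intro!: frac_le)
qed

lemma \<alpha>_nonneg: "i < n \<Longrightarrow> 0 \<le> \<alpha> i x"
  unfolding \<alpha>_def using \<tau>_sq_le_1 c_bounds u_nonneg by auto

lemma tame_\<alpha> [tame_intros]: "tame (\<alpha> i)"
  unfolding \<alpha>_def by (intro tame_intros)

lemma avg_\<alpha>_le: "avg (\<lambda>i. \<alpha> i x) \<le> U"
proof -
  have "avg (\<lambda>i. \<alpha> i x) \<le> avg (\<lambda>i. 1 + c * u i)"
    unfolding \<alpha>_def using \<tau>_sq_le_1 c_bounds u_nonneg
    by (intro avg_mono mult_left_le_one_le) auto
  also have "\<dots> = 1 + c * avg u" by (simp add: avg_add avg_cmult avg_const)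
  also have "\<dots> \<le> 1 + A / \<kappa> * A"
    using c_bounds A \<kappa> avg_nonneg[of u] u_nonneg by (intro add_left_mono mult_mono) auto
  finally show ?thesis .
qed

text \<open>The square of tanh is 2-Lipschitz, and the extra factor \<open>u i\<close> meets the
  factor \<open>1 + c * u i\<close>, so second moments suffice.\<close>

lemma avg_\<alpha>_lipschitz: "\<bar>avg (\<lambda>i. \<alpha> i x) - chi\<bar> \<le> L * \<bar>x - x0\<bar>"
proof -
  have "avg (\<lambda>i. \<alpha> i x) - chi = avg (\<lambda>i. \<alpha> i x - \<alpha> i x0)"
    by (simp add: chi_def avg_diff)
  also have "\<bar>\<dots>\<bar> \<le> avg (\<lambda>i. (2 * \<bar>x - x0\<bar>) * (u i + c * (u i)\<^sup>2))"
  proof (rule avg_abs_le)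
    fix i assume i: "i < n"
    have "\<bar>\<alpha> i x - \<alpha> i x0\<bar> = \<bar>(\<tau> i x)\<^sup>2 - (\<tau> i x0)\<^sup>2\<bar> * (1 + c * u i)"
    proof -
      have "\<alpha> i x - \<alpha> i x0 = - ((\<tau> i x)\<^sup>2 - (\<tau> i x0)\<^sup>2) * (1 + c * u i)"
        by (simp add: \<alpha>_def algebra_simps)
      thus ?thesis
        using c_bounds u_nonneg[OF i] by (simp only: abs_mult abs_minus) simp
    qed
    also have "\<dots> \<le> (2 * u i * \<bar>x - x0\<bar>) * (1 + c * u i)"
      using \<tau>_sq_lipschitz[OF i] c_bounds u_nonneg[OF i] by (intro mult_right_mono) auto
    also have "\<dots> = (2 * \<bar>x - x0\<bar>) * (u i + c * (u i)\<^sup>2)"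
      by (simp add: algebra_simps power2_eq_square)
    finally show "\<bar>\<alpha> i x - \<alpha> i x0\<bar> \<le> (2 * \<bar>x - x0\<bar>) * (u i + c * (u i)\<^sup>2)" .
  qed
  also have "\<dots> = 2 * \<bar>x - x0\<bar> * (avg u + c * avg (\<lambda>i. (u i)\<^sup>2))"
    by (simp add: avg_add avg_cmult)
  also have "\<dots> \<le> 2 * \<bar>x - x0\<bar> * (A + A / \<kappa> * A)"
    using c_bounds A \<kappa> avg_nonneg[of "\<lambda>i. (u i)\<^sup>2"]
    by (intro mult_left_mono add_mono mult_mono) auto
  also have "\<dots> = L * \<bar>x - x0\<bar>" by (simp add: algebra_simps)
  finally show ?thesis .
qed

lemma chi0_le: "chi0 \<le> chi"
proof -
  have "avg (\<lambda>i. 1 - (\<tau> i x0)\<^sup>2) \<le> chi"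
    unfolding chi_def \<alpha>_def
  proof (rule avg_mono)
    fix i assume "i < n"
    hence "(1 - (\<tau> i x0)\<^sup>2) * 1 \<le> (1 - (\<tau> i x0)\<^sup>2) * (1 + c * u i)"
      using \<tau>_sq_le_1 c_bounds u_nonneg by (intro mult_left_mono) auto
    thus "1 - (\<tau> i x0)\<^sup>2 \<le> (1 - (\<tau> i x0)\<^sup>2) * (1 + c * u i)" by simp
  qed
  thus ?thesis using chi0 by simp
qed

lemma E2_nonneg: "0 \<le> E2"
  unfolding E2_def using A \<kappa> avg_nonneg[of "\<lambda>i. u i ^ 3"] u_nonneg
  by (intro add_nonneg_nonneg mult_nonneg_nonneg divide_nonneg_nonneg) auto

text \<open>Two Taylor expansions at \<open>x0\<close>: the mean spin has slope \<open>b\<close> and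
  \<open>drift\<close> has slope \<open>F2\<close>, and \<open>c = b / F2\<close>. In the expansion
  of \<open>drift\<close> the quadratic error carries one more factor \<open>u i\<close>, which
  produces the third moment.\<close>

lemma linearization_error: "\<bar>avg (\<lambda>i. \<tau> i x) - M - c * drift x\<bar> \<le> E2 * (x - x0)\<^sup>2"
proof -
  define b where "b = avg (\<lambda>i. (1 - (\<tau> i x0)\<^sup>2) * u i)"
  define F2 where "F2 = 1 - avg (\<lambda>i. (1 - (\<tau> i x0)\<^sup>2) * (u i)\<^sup>2)"
  define e where "e i = \<tau> i x - \<tau> i x0 - (1 - (\<tau> i x0)\<^sup>2) * (u i * (x - x0))" for i
  have e: "\<bar>e i\<bar> \<le> 2 * ((u i)\<^sup>2 * (x - x0)\<^sup>2)" if "i < n" for i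
    unfolding e_def by (rule \<tau>_taylor[OF that])
  have "avg e = avg (\<lambda>i. \<tau> i x) - M - b * (x - x0)"
    unfolding e_def b_def M_def avg_diff mult.assoc[symmetric] avg_mult_right by simp
  moreover have "\<bar>avg e\<bar> \<le> avg (\<lambda>i. 2 * ((u i)\<^sup>2 * (x - x0)\<^sup>2))"
    by (rule avg_abs_le[OF e])
  ultimately have 1: "\<bar>avg (\<lambda>i. \<tau> i x) - M - b * (x - x0)\<bar> \<le> 2 * (avg (\<lambda>i. (u i)\<^sup>2) * (x - x0)\<^sup>2)"
    by (simp add: avg_cmult avg_mult_right)
  have "(\<lambda>i. u i * e i) = (\<lambda>i. u i * \<tau> i x - u i * \<tau> i x0 - (1 - (\<tau> i x0)\<^sup>2) * (u i)\<^sup>2 * (x - x0))"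
    by (simp add: fun_eq_iff e_def algebra_simps power2_eq_square)
  hence "avg (\<lambda>i. u i * e i) = F2 * (x - x0) - drift x"
    by (simp only: avg_diff avg_mult_right drift_def F2_def fixpoint[symmetric]) (simp add: left_diff_distrib)
  moreover have "\<bar>avg (\<lambda>i. u i * e i)\<bar> \<le> avg (\<lambda>i. 2 * (u i ^ 3 * (x - x0)\<^sup>2))"
  proof (rule avg_abs_le)
    fix i assume i: "i < n"
    have "\<bar>u i * e i\<bar> \<le> u i * (2 * ((u i)\<^sup>2 * (x - x0)\<^sup>2))"
      using e[OF i] u_nonneg[OF i] by (simp add: abs_mult mult_left_mono)
    also have "\<dots> = 2 * (u i ^ 3 * (x - x0)\<^sup>2)"
      by (simp add: power2_eq_square power3_eq_cube)
    finally show "\<bar>u i * e i\<bar> \<le> 2 * (u i ^ 3 * (x - x0)\<^sup>2)" .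
  qed
  ultimately have 2: "\<bar>F2 * (x - x0) - drift x\<bar> \<le> 2 * (avg (\<lambda>i. u i ^ 3) * (x - x0)\<^sup>2)"
    by (simp add: avg_cmult avg_mult_right)
  have F2: "F2 > 0" using \<kappa> by (simp add: F2_def)
  have cF: "c * F2 = b" using F2 by (simp add: c_def b_def F2_def)
  have "avg (\<lambda>i. \<tau> i x) - M - c * drift x
      = (avg (\<lambda>i. \<tau> i x) - M - b * (x - x0)) + c * (F2 * (x - x0) - drift x)"
    by (simp add: algebra_simps flip: cF)
  also have "\<bar>\<dots>\<bar> \<le> \<bar>avg (\<lambda>i. \<tau> i x) - M - b * (x - x0)\<bar> + c * \<bar>F2 * (x - x0) - drift x\<bar>"
    using c_bounds by (intro order.trans[OF abs_triangle_ineq]) (simp add: abs_mult)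
  also have "\<dots> \<le> 2 * (A * (x - x0)\<^sup>2) + A / \<kappa> * (2 * (avg (\<lambda>i. u i ^ 3) * (x - x0)\<^sup>2))"
  proof (intro add_mono mult_mono)
    show "\<bar>avg (\<lambda>i. \<tau> i x) - M - b * (x - x0)\<bar> \<le> 2 * (A * (x - x0)\<^sup>2)"
      using 1 A mult_right_mono[OF A(3), of "(x - x0)\<^sup>2"] by simp
  qed (use 2 c_bounds A \<kappa> in auto)
  also have "\<dots> = E2 * (x - x0)\<^sup>2"
    by (simp add: E2_def algebra_simps)
  finally show ?thesis .
qed

text \<open>The constant \<open>c\<close> is the one that cancels the term linear in \<open>x - x0\<close>.\<close>

lemma stein_identity:
  assumes Q: "\<And>\<sigma>. \<sigma> \<in> Conf n \<Longrightarrow> \<bar>\<phi> \<sigma>\<bar> \<le> Q"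
  shows "\<bar>J (\<lambda>x \<sigma>. (S \<sigma> - real n * M) * \<phi> \<sigma>) - J (\<lambda>x \<sigma>. \<Sum>i<n. \<alpha> i x * spin_diff i \<phi> \<sigma>)\<bar>
    \<le> Q * E2 * V * Z"
proof -
  have "Conf n \<noteq> {}" by (rule Conf_nonempty)
  then obtain \<sigma>0 where "\<sigma>0 \<in> Conf n" by blast
  hence Q0: "0 \<le> Q" using Q[of \<sigma>0] by simp
  define err where "err x \<sigma> = real n * (avg (\<lambda>i. \<tau> i x) - M - c * drift x) * \<phi> \<sigma>" for x \<sigma>
  have "J (\<lambda>x \<sigma>. (S \<sigma> - real n * M) * \<phi> \<sigma>)
      = J (\<lambda>x \<sigma>. ((S \<sigma> - (\<Sum>i<n. \<tau> i x)) * \<phi> \<sigma> + c * (real n * drift x * \<phi> \<sigma>)) + err x \<sigma>)"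
    using n_pos by (intro arg_cong[of _ _ J] ext) (simp add: err_def avg_def field_simps)
  also have "\<dots> = J (\<lambda>x \<sigma>. (S \<sigma> - (\<Sum>i<n. \<tau> i x)) * \<phi> \<sigma> + c * (real n * drift x * \<phi> \<sigma>)) + J err"
    by (intro J_add) (auto simp: adm_def err_def intro!: tame_intros)
  also have "J (\<lambda>x \<sigma>. (S \<sigma> - (\<Sum>i<n. \<tau> i x)) * \<phi> \<sigma> + c * (real n * drift x * \<phi> \<sigma>))
      = J (\<lambda>x \<sigma>. (S \<sigma> - (\<Sum>i<n. \<tau> i x)) * \<phi> \<sigma>) + J (\<lambda>x \<sigma>. c * (real n * drift x * \<phi> \<sigma>))"
    by (intro J_add) (auto simp: adm_def intro!: tame_intros)
  also have "\<dots> = J (\<lambda>x \<sigma>. \<Sum>i<n. (1 - (\<tau> i x)\<^sup>2) * spin_diff i \<phi> \<sigma>)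
      + J (\<lambda>x \<sigma>. c * (\<Sum>i<n. u i * ((1 - (\<tau> i x)\<^sup>2) * spin_diff i \<phi> \<sigma>)))"
    unfolding J_cmult S_identity drift_identity ..
  also have "\<dots> = J (\<lambda>x \<sigma>. (\<Sum>i<n. (1 - (\<tau> i x)\<^sup>2) * spin_diff i \<phi> \<sigma>)
      + c * (\<Sum>i<n. u i * ((1 - (\<tau> i x)\<^sup>2) * spin_diff i \<phi> \<sigma>)))"
    by (intro J_add[symmetric]) (auto simp: adm_def intro!: tame_intros)
  also have "\<dots> = J (\<lambda>x \<sigma>. \<Sum>i<n. \<alpha> i x * spin_diff i \<phi> \<sigma>)"
    by (intro arg_cong[of _ _ J] ext)
      (simp add: \<alpha>_def sum_distrib_left algebra_simps flip: sum.distrib)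
  finally have "J (\<lambda>x \<sigma>. (S \<sigma> - real n * M) * \<phi> \<sigma>) - J (\<lambda>x \<sigma>. \<Sum>i<n. \<alpha> i x * spin_diff i \<phi> \<sigma>) = J err"
    by simp
  also have "\<bar>J err\<bar> \<le> J (\<lambda>x \<sigma>. real n * E2 * Q * (x - x0)\<^sup>2)"
  proof (rule J_abs_le)
    fix x \<sigma> assume \<sigma>: "\<sigma> \<in> Conf n"
    have "\<bar>err x \<sigma>\<bar> = real n * \<bar>avg (\<lambda>i. \<tau> i x) - M - c * drift x\<bar> * \<bar>\<phi> \<sigma>\<bar>"
      by (simp add: err_def abs_mult)
    also have "\<dots> \<le> real n * (E2 * (x - x0)\<^sup>2) * Q"
      using linearization_error Q[OF \<sigma>] E2_nonneg
      by (intro mult_mono mult_left_mono mult_nonneg_nonneg) auto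
    finally show "\<bar>err x \<sigma>\<bar> \<le> real n * E2 * Q * (x - x0)\<^sup>2"
      by (simp add: mult_ac)
  qed (auto simp: adm_def err_def intro!: tame_intros)
  also have "\<dots> = real n * E2 * Q * J (\<lambda>x \<sigma>. (x - x0)\<^sup>2)"
    by (rule J_cmult)
  also have "\<dots> \<le> real n * E2 * Q * (V / real n * Z)"
    using E2_nonneg Q0 by (intro mult_left_mono V) auto
  also have "\<dots> = Q * E2 * V * Z"
    using n_pos by simp
  finally show ?thesis .
qed

text \<open>The scale \<open>sqrt n\<close> balances the two terms of the arithmetic-geometric mean
  inequality, since the second moment is of order \<open>1 / n\<close>.\<close>

lemma J_abs_deviation: "J (\<lambda>x \<sigma>. \<bar>x - x0\<bar>) \<le> (V + 1) / (2 * sqrt (real n)) * Z"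
proof -
  let ?r = "sqrt (real n)"
  have r: "0 < ?r" using n_pos by simp
  have "J (\<lambda>x \<sigma>. \<bar>x - x0\<bar>) \<le> J (\<lambda>x \<sigma>. ?r / 2 * (x - x0)\<^sup>2 + 1 / (2 * ?r) * 1)"
  proof (rule J_mono)
    fix x \<sigma>
    show "\<bar>x - x0\<bar> \<le> ?r / 2 * (x - x0)\<^sup>2 + 1 / (2 * ?r) * 1"
      using abs_le_scaled_square[OF r, of "x - x0"] by (simp add: add_divide_distrib)
  qed (auto simp: adm_def intro!: tame_intros)
  also have "\<dots> = ?r / 2 * J (\<lambda>x \<sigma>. (x - x0)\<^sup>2) + 1 / (2 * ?r) * Z"
    unfolding J_cmult[symmetric] by (intro J_add) (auto simp: adm_def intro!: tame_intros)
  also have "\<dots> \<le> ?r / 2 * (V / real n * Z) + 1 / (2 * ?r) * Z"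
    using r by (intro add_mono mult_left_mono V) auto
  also have "?r / 2 * (V / real n * Z) = V / (2 * ?r) * Z"
    using n_pos by (simp add: field_simps)
  finally show ?thesis
    by (simp add: add_divide_distrib algebra_simps)
qed

text \<open>The deviation is split into the fluctuation given \<open>x\<close>, of variance at most
  \<open>n\<close>, and the displacement of the conditional mean, at most
  \<open>n * A * \<bar>x - x0\<bar>\<close>.\<close>

lemma J_abs_S: "J (\<lambda>x \<sigma>. \<bar>S \<sigma> - real n * M\<bar>) \<le> Y * sqrt (real n) * Z"
proof -
  let ?r = "sqrt (real n)"
  have r: "0 < ?r" using n_pos by simp
  have "J (\<lambda>x \<sigma>. (S \<sigma> - real n * M)\<^sup>2)
      \<le> J (\<lambda>x \<sigma>. 2 * (S \<sigma> - (\<Sum>i<n. \<tau> i x))\<^sup>2 + 2 * (real n)\<^sup>2 * A\<^sup>2 * (x - x0)\<^sup>2)"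
  proof (rule J_mono)
    fix x \<sigma>
    have "\<bar>(\<Sum>i<n. \<tau> i x) - real n * M\<bar> = real n * \<bar>avg (\<lambda>i. \<tau> i x - \<tau> i x0)\<bar>"
      using n_pos by (simp add: avg_def M_def sum_subtractf abs_divide)
    also have "\<dots> \<le> real n * avg (\<lambda>i. u i * \<bar>x - x0\<bar>)"
      by (intro mult_left_mono avg_abs_le \<tau>_lipschitz) auto
    also have "\<dots> \<le> real n * (A * \<bar>x - x0\<bar>)"
      unfolding avg_mult_right by (intro mult_left_mono mult_right_mono A) auto
    finally have "((\<Sum>i<n. \<tau> i x) - real n * M)\<^sup>2 \<le> (real n * (A * \<bar>x - x0\<bar>))\<^sup>2"
      by (metis abs_ge_zero power2_abs power_mono)
    hence "((\<Sum>i<n. \<tau> i x) - real n * M)\<^sup>2 \<le> (real n)\<^sup>2 * A\<^sup>2 * (x - x0)\<^sup>2"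
      by (simp add: power_mult_distrib)
    moreover have "(S \<sigma> - real n * M)\<^sup>2
        \<le> 2 * (S \<sigma> - (\<Sum>i<n. \<tau> i x))\<^sup>2 + 2 * ((\<Sum>i<n. \<tau> i x) - real n * M)\<^sup>2"
      using sum_squares_ge_zero[of "(S \<sigma> - (\<Sum>i<n. \<tau> i x)) - ((\<Sum>i<n. \<tau> i x) - real n * M)" 0]
      by (simp add: power2_eq_square algebra_simps)
    ultimately show "(S \<sigma> - real n * M)\<^sup>2
        \<le> 2 * (S \<sigma> - (\<Sum>i<n. \<tau> i x))\<^sup>2 + 2 * (real n)\<^sup>2 * A\<^sup>2 * (x - x0)\<^sup>2"
      by simp
  qed (auto simp: adm_def intro!: tame_intros)
  also have "\<dots> = 2 * J (\<lambda>x \<sigma>. (S \<sigma> - (\<Sum>i<n. \<tau> i x))\<^sup>2) + 2 * (real n)\<^sup>2 * A\<^sup>2 * J (\<lambda>x \<sigma>. (x - x0)\<^sup>2)"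
    by (subst J_add) (auto simp: adm_def J_cmult intro!: tame_intros)
  also have "\<dots> \<le> 2 * (real n * Z) + 2 * (real n)\<^sup>2 * A\<^sup>2 * (V / real n * Z)"
    by (intro add_mono mult_left_mono conditional_variance_S V) auto
  also have "\<dots> = 2 * (1 + A\<^sup>2 * V) * real n * Z"
    using n_pos by (simp add: field_simps power2_eq_square)
  finally have sq: "J (\<lambda>x \<sigma>. (S \<sigma> - real n * M)\<^sup>2) \<le> 2 * (1 + A\<^sup>2 * V) * real n * Z" .
  have "J (\<lambda>x \<sigma>. \<bar>S \<sigma> - real n * M\<bar>)
      \<le> J (\<lambda>x \<sigma>. 1 / (2 * ?r) * (S \<sigma> - real n * M)\<^sup>2 + ?r / 2 * 1)"
  proof (rule J_mono)
    fix x \<sigma>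
    show "\<bar>S \<sigma> - real n * M\<bar> \<le> 1 / (2 * ?r) * (S \<sigma> - real n * M)\<^sup>2 + ?r / 2 * 1"
      using abs_le_scaled_square[of "1 / ?r" "S \<sigma> - real n * M"] r by (simp add: add_divide_distrib)
  qed (auto simp: adm_def intro!: tame_intros)
  also have "\<dots> = 1 / (2 * ?r) * J (\<lambda>x \<sigma>. (S \<sigma> - real n * M)\<^sup>2) + ?r / 2 * Z"
    unfolding J_cmult[symmetric] by (intro J_add) (auto simp: adm_def intro!: tame_intros)
  also have "\<dots> \<le> 1 / (2 * ?r) * (2 * (1 + A\<^sup>2 * V) * real n * Z) + ?r / 2 * Z"
    using r by (intro add_mono mult_left_mono sq) auto
  also have "1 / (2 * ?r) * (2 * (1 + A\<^sup>2 * V) * real n * Z) = (1 + A\<^sup>2 * V) * ?r * Z"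
  proof -
    have "1 / (2 * ?r) * (2 * k * real n * z) = k * (real n / ?r) * z" for k z :: real
      by simp
    thus ?thesis by (simp only: real_div_sqrt of_nat_0_le_iff)
  qed
  also have "(1 + A\<^sup>2 * V) * ?r * Z + ?r / 2 * Z \<le> Y * ?r * Z"
    using r J_one_pos by (simp add: algebra_simps)
  finally show ?thesis .
qed

text \<open>Concentration of \<open>S\<close>, obtained from the Stein identity applied to a truncated linear function.\<close>

lemma J_window:
  "real n * chi * J (\<lambda>x \<sigma>. of_bool (\<bar>S \<sigma> - s0\<bar> \<le> 2))
     \<le> (4 * Y + L * (V + 1) + 4 * E2 * V) * sqrt (real n) * Z"
proof -
  let ?r = "sqrt (real n)"
  have r: "1 \<le> ?r" using n_pos by simp
  \<comment> \<open>One flip moves \<open>S\<close> by 2. Truncating at 4 leaves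
    \<open>\<phi>\<close> linear on both configurations when \<open>S\<close> is within 2 of
    \<open>s0\<close>, so the discrete derivative is 1 there; monotonicity keeps it nonnegative
    elsewhere.\<close>
  define \<phi> where "\<phi> \<sigma> = max (- 4) (min 4 (S \<sigma> - s0))" for \<sigma>
  let ?win = "\<lambda>\<sigma>. of_bool (\<bar>S \<sigma> - s0\<bar> \<le> 2) :: real"
  have \<phi>_bound: "\<bar>\<phi> \<sigma>\<bar> \<le> 4" for \<sigma>
    by (auto simp: \<phi>_def)
  have sd: "?win \<sigma> \<le> spin_diff i \<phi> \<sigma>" if "i < n" "\<sigma> \<in> Conf n" for i \<sigma>
    using Conf_cases[OF that(2,1)] S_flip[OF that(1), of \<sigma>]
    by (auto simp: spin_diff_def \<phi>_def max_def min_def)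
  \<comment> \<open>The random coefficient is replaced by \<open>chi\<close> at the price
    \<open>n * L * \<bar>x - x0\<bar>\<close>; outside the window the resulting lower bound is at
    most zero.\<close>
  have "real n * chi * J (\<lambda>x \<sigma>. ?win \<sigma>) - real n * L * J (\<lambda>x \<sigma>. \<bar>x - x0\<bar>)
      = J (\<lambda>x \<sigma>. real n * chi * ?win \<sigma> - real n * L * \<bar>x - x0\<bar>)"
    by (subst J_diff) (auto simp: adm_def J_cmult intro!: tame_intros)
  also have "\<dots> \<le> J (\<lambda>x \<sigma>. \<Sum>i<n. \<alpha> i x * spin_diff i \<phi> \<sigma>)"
  proof (rule J_mono)
    fix x \<sigma> assume \<sigma>: "\<sigma> \<in> Conf n"
    have "real n * chi * ?win \<sigma> - real n * L * \<bar>x - x0\<bar> \<le> real n * avg (\<lambda>i. \<alpha> i x) * ?win \<sigma>"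
    proof (cases "\<bar>S \<sigma> - s0\<bar> \<le> 2")
      case True
      have "chi - L * \<bar>x - x0\<bar> \<le> avg (\<lambda>i. \<alpha> i x)"
        using avg_\<alpha>_lipschitz[of x] by linarith
      hence "real n * (chi - L * \<bar>x - x0\<bar>) \<le> real n * avg (\<lambda>i. \<alpha> i x)"
        by (intro mult_left_mono) auto
      thus ?thesis using True by (simp add: right_diff_distrib mult.assoc)
    next
      case False
      have "0 \<le> real n * L * \<bar>x - x0\<bar>"
        using A \<kappa> by (intro mult_nonneg_nonneg) auto
      thus ?thesis using False by simp
    qed
    also have "\<dots> = (\<Sum>i<n. \<alpha> i x * ?win \<sigma>)"
      using n_pos by (simp add: avg_def sum_distrib_right)
    also have "\<dots> \<le> (\<Sum>i<n. \<alpha> i x * spin_diff i \<phi> \<sigma>)"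
      using sd \<sigma> \<alpha>_nonneg by (intro sum_mono mult_left_mono) auto
    finally show "real n * chi * ?win \<sigma> - real n * L * \<bar>x - x0\<bar> \<le> (\<Sum>i<n. \<alpha> i x * spin_diff i \<phi> \<sigma>)" .
  qed (auto simp: adm_def intro!: tame_intros)
  also have "\<dots> \<le> J (\<lambda>x \<sigma>. (S \<sigma> - real n * M) * \<phi> \<sigma>) + 4 * E2 * V * Z"
    using stein_identity[of \<phi> 4, OF \<phi>_bound] by linarith
  also have "J (\<lambda>x \<sigma>. (S \<sigma> - real n * M) * \<phi> \<sigma>) \<le> J (\<lambda>x \<sigma>. 4 * \<bar>S \<sigma> - real n * M\<bar>)"
  proof (rule J_mono)
    fix x \<sigma>
    have "(S \<sigma> - real n * M) * \<phi> \<sigma> \<le> \<bar>S \<sigma> - real n * M\<bar> * \<bar>\<phi> \<sigma>\<bar>"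
      by (metis abs_ge_self abs_mult)
    also have "\<dots> \<le> \<bar>S \<sigma> - real n * M\<bar> * 4"
      by (intro mult_left_mono) (auto simp: \<phi>_def)
    finally show "(S \<sigma> - real n * M) * \<phi> \<sigma> \<le> 4 * \<bar>S \<sigma> - real n * M\<bar>" by simp
  qed (auto simp: adm_def intro!: tame_intros)
  also have "\<dots> \<le> 4 * (Y * ?r * Z)"
    unfolding J_cmult by (intro mult_left_mono J_abs_S) auto
  finally have 1: "real n * chi * J (\<lambda>x \<sigma>. ?win \<sigma>)
      \<le> 4 * (Y * ?r * Z) + 4 * E2 * V * Z + real n * L * J (\<lambda>x \<sigma>. \<bar>x - x0\<bar>)"
    by simp
  have "real n * L * J (\<lambda>x \<sigma>. \<bar>x - x0\<bar>) \<le> real n * L * ((V + 1) / (2 * ?r) * Z)"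
    using A \<kappa> by (intro mult_left_mono J_abs_deviation) auto
  also have "\<dots> = L * (V + 1) * ?r * Z / 2"
  proof -
    have "real n * l * (v / (2 * ?r) * z) = l * v * (real n / ?r) * z / 2" for l v z :: real
      by (simp add: mult_ac)
    thus ?thesis by (simp only: real_div_sqrt of_nat_0_le_iff)
  qed
  also have "\<dots> \<le> L * (V + 1) * ?r * Z"
    using A \<kappa> V J_one_pos r by simp
  finally have 2: "real n * L * J (\<lambda>x \<sigma>. \<bar>x - x0\<bar>) \<le> L * (V + 1) * ?r * Z" .
  have "4 * E2 * V * Z * 1 \<le> 4 * E2 * V * Z * ?r"
    using E2_nonneg V J_one_pos r by (intro mult_left_mono) auto
  hence 3: "4 * E2 * V * Z \<le> 4 * E2 * V * ?r * Z" by (simp add: mult_ac)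
  have eq: "(k + l + m) * ?r * Z = k * ?r * Z + l * ?r * Z + m * ?r * Z" for k l m
    by (simp only: distrib_right)
  show ?thesis
    unfolding eq using 1 2 3 by linarith
qed

end

section \<open>Stein's method for the standardized spin sum\<close>

context spins_at_fixpoint
begin

text \<open>By Stein's equation the error is the difference of the means of \<open>D\<phi>\<close>
  and \<open>X * \<phi>\<close>. Both are compared with \<open>1 / s\<close> times the weighted sum
  of discrete derivatives: the second through \<open>stein_identity\<close>, the first through
  \<open>stein_sol_increment\<close>.\<close>

lemma J_standardized:
  defines "r \<equiv> 1 / sqrt chi0"
  shows "\<bar>J (\<lambda>x \<sigma>. of_bool ((S \<sigma> - real n * M) / sqrt (real n * chi) \<le> z)) - Phi z * Z\<bar>
    \<le> (L * (V + 1) * r\<^sup>2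
        + U * r\<^sup>2 * (12 * r + 4 * Y * r\<^sup>2 + 4 * ((4 * Y + L * (V + 1) + 4 * E2 * V) * r\<^sup>2))
        + 6 * E2 * V * r) / sqrt (real n) * Z"
proof -
  define s where "s = sqrt (real n * chi)"
  define X where "X \<sigma> = (S \<sigma> - real n * M) / s" for \<sigma>
  define \<phi> where "\<phi> \<sigma> = stein_sol z (X \<sigma>)" for \<sigma>
  \<comment> \<open>The derivative of the Stein solution at \<open>X \<sigma>\<close> as given by
    Stein's equation, with the left-hand value at the kink.\<close>
  define D\<phi> where "D\<phi> \<sigma> = X \<sigma> * \<phi> \<sigma> + of_bool (X \<sigma> \<le> z) - Phi z" for \<sigma>
  \<comment> \<open>In the scale of \<open>X\<close> this window has half-width
    \<open>2 / s\<close>, exactly the displacement caused by one flip: a flip can meet the kink only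
    from inside it.\<close>
  define win where "win \<sigma> = (of_bool (\<bar>S \<sigma> - (real n * M + s * z)\<bar> \<le> 2) :: real)" for \<sigma>
  define ew where "ew \<sigma> = 2 / s * (6 + 2 * \<bar>X \<sigma>\<bar>) + 4 * win \<sigma>" for \<sigma>
  define q where "q = sqrt (real n)"
  have q: "0 < q" using n_pos by (simp add: q_def)
  have chi: "0 < chi" using chi0 chi0_le by simp
  have s: "0 < s" "s\<^sup>2 = real n * chi" using n_pos chi by (auto simp: s_def)
  have r: "0 < r" "r\<^sup>2 = 1 / chi0" using chi0 by (auto simp: r_def power_divide)
  have inv_s: "1 / s \<le> r / q"
  proof -
    have "sqrt (real n * chi0) \<le> s"
      unfolding s_def using chi0_le by (intro real_sqrt_le_mono mult_left_mono) auto
    hence "1 / s \<le> 1 / sqrt (real n * chi0)"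
      using n_pos chi0 s by (intro divide_left_mono) auto
    also have "\<dots> = r / q" by (simp add: r_def q_def real_sqrt_mult)
    finally show ?thesis .
  qed
  have inv_chi: "1 / chi \<le> r\<^sup>2"
    unfolding r using chi0 chi0_le by (intro divide_left_mono) auto
  have L: "0 \<le> L" and U: "0 \<le> U" and Y: "0 \<le> Y"
    using A \<kappa> V by (auto intro!: mult_nonneg_nonneg add_nonneg_nonneg)
  have Z: "0 < Z" by (rule J_one_pos)
  have ew_nonneg: "0 \<le> ew \<sigma>" for \<sigma>
    using s by (auto simp: ew_def win_def)

  have D\<phi>_bound: "\<bar>D\<phi> \<sigma>\<bar> \<le> 2" for \<sigma>
    using abs_mult_stein_sol_le[of "X \<sigma>" z] Phi_ge_0[of z] Phi_le_1[of z]
    by (auto simp: D\<phi>_def \<phi>_def)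
  have sd: "\<bar>D\<phi> \<sigma> / s - spin_diff i \<phi> \<sigma>\<bar> \<le> 1 / s * ew \<sigma>" if i: "i < n" and \<sigma>: "\<sigma> \<in> Conf n" for i \<sigma>
  proof -
    define e where "e = - 2 * \<sigma> i / s"
    have \<sigma>i: "\<sigma> i * \<sigma> i = 1" "\<bar>\<sigma> i\<bar> = 1"
      using Conf_cases[OF \<sigma> i] by auto
    have e: "\<bar>e\<bar> = 2 / s" using \<sigma>i s by (simp add: e_def abs_mult)
    have "X (flip i \<sigma>) = X \<sigma> + e"
      using s by (simp add: X_def S_flip[OF i] e_def diff_divide_distrib)
    hence \<phi>f: "\<phi> (flip i \<sigma>) = stein_sol z (X \<sigma> + e)" by (simp add: \<phi>_def)
    have "\<bar>X \<sigma> - z\<bar> \<le> 2 / s \<longleftrightarrow> \<bar>S \<sigma> - (real n * M + s * z)\<bar> \<le> 2"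
    proof -
      have "\<bar>S \<sigma> - (real n * M + s * z)\<bar> = s * \<bar>X \<sigma> - z\<bar>"
      proof -
        have "S \<sigma> - (real n * M + s * z) = s * (X \<sigma> - z)"
          using s by (simp add: X_def field_simps)
        thus ?thesis using s by (simp add: abs_mult)
      qed
      thus ?thesis using s by (simp add: field_simps)
    qed
    hence inc: "\<bar>\<phi> (flip i \<sigma>) - \<phi> \<sigma> - e * D\<phi> \<sigma>\<bar> \<le> 2 / s * ew \<sigma>"
      using stein_sol_increment[of z "X \<sigma>" e]
      unfolding e \<phi>f D\<phi>_def \<phi>_def[of \<sigma>] ew_def win_def by simp
    have "D\<phi> \<sigma> / s - spin_diff i \<phi> \<sigma> = \<sigma> i / 2 * (\<phi> (flip i \<sigma>) - \<phi> \<sigma> - e * D\<phi> \<sigma>)"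
    proof -
      have "\<sigma> i / 2 * (e * D\<phi> \<sigma>) = - (\<sigma> i * \<sigma> i) * D\<phi> \<sigma> / s"
        by (simp add: e_def)
      thus ?thesis
        unfolding \<sigma>i by (simp add: spin_diff_def field_simps)
    qed
    hence "\<bar>D\<phi> \<sigma> / s - spin_diff i \<phi> \<sigma>\<bar> = \<bar>\<sigma> i\<bar> / \<bar>2\<bar> * \<bar>\<phi> (flip i \<sigma>) - \<phi> \<sigma> - e * D\<phi> \<sigma>\<bar>"
      by (simp only: abs_mult abs_divide)
    also have "\<dots> = \<bar>\<phi> (flip i \<sigma>) - \<phi> \<sigma> - e * D\<phi> \<sigma>\<bar> / 2"
      using \<sigma>i by simp
    also have "\<dots> \<le> 2 / s * ew \<sigma> / 2"
      using inc by (intro divide_right_mono) auto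
    finally show ?thesis by simp
  qed
  have pointwise: "\<bar>D\<phi> \<sigma> - 1 / s * (\<Sum>i<n. \<alpha> i x * spin_diff i \<phi> \<sigma>)\<bar>
      \<le> 2 * L / chi * \<bar>x - x0\<bar> + U / chi * ew \<sigma>" if \<sigma>: "\<sigma> \<in> Conf n" for x \<sigma>
  proof -
    define a where "a = avg (\<lambda>i. \<alpha> i x)"
    have sum_\<alpha>: "(\<Sum>i<n. \<alpha> i x) = s\<^sup>2 / chi * a"
      unfolding s(2) using n_pos chi by (simp add: a_def avg_def)
    \<comment> \<open>Two errors are separated: the averaged coefficient differs from
      \<open>chi\<close>, and the discrete derivatives differ from
      \<open>D\<phi> \<sigma> / s\<close>.\<close>
    have decomp: "D\<phi> \<sigma> - 1 / s * (\<Sum>i<n. \<alpha> i x * spin_diff i \<phi> \<sigma>)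
        = D\<phi> \<sigma> * (chi - a) / chi + 1 / s * (\<Sum>i<n. \<alpha> i x * (D\<phi> \<sigma> / s - spin_diff i \<phi> \<sigma>))"
    proof -
      have "1 / s * (\<Sum>i<n. \<alpha> i x * (D\<phi> \<sigma> / s - spin_diff i \<phi> \<sigma>))
          = 1 / s * ((\<Sum>i<n. \<alpha> i x) * (D\<phi> \<sigma> / s)) - 1 / s * (\<Sum>i<n. \<alpha> i x * spin_diff i \<phi> \<sigma>)"
        by (simp only: right_diff_distrib sum_subtractf sum_distrib_right)
      also have "1 / s * ((\<Sum>i<n. \<alpha> i x) * (D\<phi> \<sigma> / s)) = D\<phi> \<sigma> * a / chi"
        unfolding sum_\<alpha> using s(1) by (simp add: power2_eq_square)
      finally show ?thesis using chi by (simp add: right_diff_distrib diff_divide_distrib)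
    qed
    have "\<bar>D\<phi> \<sigma> - 1 / s * (\<Sum>i<n. \<alpha> i x * spin_diff i \<phi> \<sigma>)\<bar> \<le> \<bar>D\<phi> \<sigma> * (chi - a) / chi\<bar>
        + \<bar>1 / s * (\<Sum>i<n. \<alpha> i x * (D\<phi> \<sigma> / s - spin_diff i \<phi> \<sigma>))\<bar>"
      unfolding decomp by (rule abs_triangle_ineq)
    also have "\<dots> \<le> 2 * (L * \<bar>x - x0\<bar>) / chi + U / chi * ew \<sigma>"
    proof (rule add_mono)
      have "\<bar>D\<phi> \<sigma> * (chi - a) / chi\<bar> = \<bar>D\<phi> \<sigma>\<bar> * \<bar>a - chi\<bar> / chi"
        using chi by (simp add: abs_mult abs_minus_commute)
      also have "\<dots> \<le> 2 * (L * \<bar>x - x0\<bar>) / chi"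
        unfolding a_def using chi by (intro divide_right_mono mult_mono avg_\<alpha>_lipschitz D\<phi>_bound) auto
      finally show "\<bar>D\<phi> \<sigma> * (chi - a) / chi\<bar> \<le> 2 * (L * \<bar>x - x0\<bar>) / chi" .
      have "\<bar>\<Sum>i<n. \<alpha> i x * (D\<phi> \<sigma> / s - spin_diff i \<phi> \<sigma>)\<bar> \<le> (\<Sum>i<n. \<alpha> i x * (1 / s * ew \<sigma>))"
      proof (rule order.trans[OF sum_abs], rule sum_mono)
        fix i assume "i \<in> {..<n}"
        thus "\<bar>\<alpha> i x * (D\<phi> \<sigma> / s - spin_diff i \<phi> \<sigma>)\<bar> \<le> \<alpha> i x * (1 / s * ew \<sigma>)"
          using sd[of i \<sigma>] \<sigma> \<alpha>_nonneg[of i x] by (simp only: abs_mult abs_of_nonneg lessThan_iff mult_left_mono)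
      qed
      hence "\<bar>1 / s * (\<Sum>i<n. \<alpha> i x * (D\<phi> \<sigma> / s - spin_diff i \<phi> \<sigma>))\<bar>
          \<le> 1 / s * (\<Sum>i<n. \<alpha> i x * (1 / s * ew \<sigma>))"
        using s by (simp add: abs_mult divide_right_mono)
      also have "\<dots> = 1 / s * ((\<Sum>i<n. \<alpha> i x) * (1 / s * ew \<sigma>))"
        by (simp only: sum_distrib_right)
      also have "\<dots> = a / chi * ew \<sigma>"
        unfolding sum_\<alpha> using s(1) by (simp add: power2_eq_square)
      also have "\<dots> \<le> U / chi * ew \<sigma>"
        unfolding a_def using chi ew_nonneg by (intro mult_right_mono divide_right_mono avg_\<alpha>_le) auto
      finally show "\<bar>1 / s * (\<Sum>i<n. \<alpha> i x * (D\<phi> \<sigma> / s - spin_diff i \<phi> \<sigma>))\<bar> \<le> U / chi * ew \<sigma>" .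
    qed
    finally show ?thesis by simp
  qed

  have eq1: "J (\<lambda>x \<sigma>. D\<phi> \<sigma>) - 1 / s * J (\<lambda>x \<sigma>. \<Sum>i<n. \<alpha> i x * spin_diff i \<phi> \<sigma>)
      = J (\<lambda>x \<sigma>. D\<phi> \<sigma> - 1 / s * (\<Sum>i<n. \<alpha> i x * spin_diff i \<phi> \<sigma>))"
    unfolding J_cmult[symmetric] by (intro J_diff[symmetric]) (auto simp: adm_def intro!: tame_intros)
  have "\<bar>J (\<lambda>x \<sigma>. D\<phi> \<sigma> - 1 / s * (\<Sum>i<n. \<alpha> i x * spin_diff i \<phi> \<sigma>))\<bar>
      \<le> J (\<lambda>x \<sigma>. 2 * L / chi * \<bar>x - x0\<bar> + U / chi * ew \<sigma>)"
    by (intro J_abs_le pointwise) (auto simp: adm_def intro!: tame_intros)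
  also have "\<dots> = 2 * L / chi * J (\<lambda>x \<sigma>. \<bar>x - x0\<bar>) + U / chi * J (\<lambda>x \<sigma>. ew \<sigma>)"
    unfolding J_cmult[symmetric] by (intro J_add) (auto simp: adm_def intro!: tame_intros)
  finally have 1: "\<bar>J (\<lambda>x \<sigma>. D\<phi> \<sigma>) - 1 / s * J (\<lambda>x \<sigma>. \<Sum>i<n. \<alpha> i x * spin_diff i \<phi> \<sigma>)\<bar>
      \<le> 2 * L / chi * J (\<lambda>x \<sigma>. \<bar>x - x0\<bar>) + U / chi * J (\<lambda>x \<sigma>. ew \<sigma>)"
    unfolding eq1 .

  have "J (\<lambda>x \<sigma>. X \<sigma> * \<phi> \<sigma>) = 1 / s * J (\<lambda>x \<sigma>. (S \<sigma> - real n * M) * \<phi> \<sigma>)"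
    unfolding J_cmult[symmetric] by (simp add: X_def)
  hence "\<bar>J (\<lambda>x \<sigma>. X \<sigma> * \<phi> \<sigma>) - 1 / s * J (\<lambda>x \<sigma>. \<Sum>i<n. \<alpha> i x * spin_diff i \<phi> \<sigma>)\<bar>
      = 1 / s * \<bar>J (\<lambda>x \<sigma>. (S \<sigma> - real n * M) * \<phi> \<sigma>) - J (\<lambda>x \<sigma>. \<Sum>i<n. \<alpha> i x * spin_diff i \<phi> \<sigma>)\<bar>"
    using s by (simp add: abs_mult flip: diff_divide_distrib)
  also have "\<dots> \<le> 1 / s * (6 * E2 * V * Z)"
    using s stein_sol_le stein_sol_nonneg
    by (intro mult_left_mono stein_identity) (auto simp: \<phi>_def)
  finally have 2: "\<bar>J (\<lambda>x \<sigma>. X \<sigma> * \<phi> \<sigma>) - 1 / s * J (\<lambda>x \<sigma>. \<Sum>i<n. \<alpha> i x * spin_diff i \<phi> \<sigma>)\<bar>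
      \<le> 1 / s * (6 * E2 * V * Z)" .

  have "J (\<lambda>x \<sigma>. D\<phi> \<sigma>) = J (\<lambda>x \<sigma>. X \<sigma> * \<phi> \<sigma>) + J (\<lambda>x \<sigma>. of_bool (X \<sigma> \<le> z)) - J (\<lambda>x \<sigma>. Phi z * 1)"
    unfolding D\<phi>_def
    by (subst J_diff, simp_all add: adm_def tame_intros, subst J_add, simp_all add: adm_def tame_intros)
  hence "\<bar>J (\<lambda>x \<sigma>. of_bool (X \<sigma> \<le> z)) - Phi z * Z\<bar>
      = \<bar>J (\<lambda>x \<sigma>. D\<phi> \<sigma>) - J (\<lambda>x \<sigma>. X \<sigma> * \<phi> \<sigma>)\<bar>"
    unfolding J_cmult by simp
  also have "\<dots> \<le> 2 * L / chi * J (\<lambda>x \<sigma>. \<bar>x - x0\<bar>) + U / chi * J (\<lambda>x \<sigma>. ew \<sigma>)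
      + 1 / s * (6 * E2 * V * Z)"
    using 1 2 by linarith
  finally have main: "\<bar>J (\<lambda>x \<sigma>. of_bool (X \<sigma> \<le> z)) - Phi z * Z\<bar>
      \<le> 2 * L / chi * J (\<lambda>x \<sigma>. \<bar>x - x0\<bar>) + U / chi * J (\<lambda>x \<sigma>. ew \<sigma>)
      + 1 / s * (6 * E2 * V * Z)" .

  have t1: "2 * L / chi * J (\<lambda>x \<sigma>. \<bar>x - x0\<bar>) \<le> L * (V + 1) * r\<^sup>2 / q * Z"
  proof -
    have "2 * L / chi * J (\<lambda>x \<sigma>. \<bar>x - x0\<bar>) \<le> 2 * L / chi * ((V + 1) / (2 * q) * Z)"
      unfolding q_def using L chi by (intro mult_left_mono J_abs_deviation divide_nonneg_pos) auto
    also have "\<dots> = (L * (V + 1) / q * Z) * (1 / chi)" by simp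
    also have "\<dots> \<le> (L * (V + 1) / q * Z) * r\<^sup>2"
      using inv_chi L V q Z by (intro mult_left_mono) auto
    finally show ?thesis by (simp add: mult_ac)
  qed
  have t3: "1 / s * (6 * E2 * V * Z) \<le> 6 * E2 * V * r / q * Z"
  proof -
    have "1 / s * (6 * E2 * V * Z) \<le> r / q * (6 * E2 * V * Z)"
      using inv_s E2_nonneg V Z by (intro mult_right_mono) auto
    thus ?thesis by (simp add: mult_ac)
  qed
  define P where "P = 4 * Y + L * (V + 1) + 4 * E2 * V"
  have P: "0 \<le> P"
    unfolding P_def using A \<kappa> V E2_nonneg by (intro add_nonneg_nonneg mult_nonneg_nonneg) auto
  have Jwin: "J (\<lambda>x \<sigma>. win \<sigma>) \<le> P * r\<^sup>2 / q * Z"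
  proof -
    have "real n * chi * J (\<lambda>x \<sigma>. win \<sigma>) \<le> P * q * Z"
      unfolding win_def q_def P_def by (rule J_window)
    hence "J (\<lambda>x \<sigma>. win \<sigma>) \<le> P * q * Z / (real n * chi)"
      using n_pos chi by (simp add: field_simps)
    also have "\<dots> = (P / q * Z) * (1 / chi)"
    proof -
      have "real n = q * q" by (simp add: q_def)
      thus ?thesis using q by simp
    qed
    also have "\<dots> \<le> (P / q * Z) * r\<^sup>2"
      using inv_chi P q Z by (intro mult_left_mono) auto
    finally show ?thesis by (simp add: mult_ac)
  qed
  have JX: "J (\<lambda>x \<sigma>. \<bar>X \<sigma>\<bar>) \<le> Y * r * Z"
  proof -
    have "J (\<lambda>x \<sigma>. \<bar>X \<sigma>\<bar>) = 1 / s * J (\<lambda>x \<sigma>. \<bar>S \<sigma> - real n * M\<bar>)"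
      unfolding J_cmult[symmetric] using s by (simp add: X_def abs_divide)
    also have "\<dots> \<le> 1 / s * (Y * q * Z)"
      unfolding q_def using s by (intro mult_left_mono J_abs_S) auto
    also have "\<dots> \<le> r / q * (Y * q * Z)"
      using inv_s Y q Z by (intro mult_right_mono) auto
    also have "\<dots> = Y * r * Z" using q by simp
    finally show ?thesis .
  qed
  have Jew: "J (\<lambda>x \<sigma>. ew \<sigma>) \<le> (12 * r + 4 * Y * r\<^sup>2 + 4 * (P * r\<^sup>2)) / q * Z"
  proof -
    have "J (\<lambda>x \<sigma>. ew \<sigma>) = J (\<lambda>x \<sigma>. (12 / s * 1 + 4 / s * \<bar>X \<sigma>\<bar>) + 4 * win \<sigma>)"
      by (simp add: ew_def algebra_simps)
    also have "\<dots> = J (\<lambda>x \<sigma>. 12 / s * 1 + 4 / s * \<bar>X \<sigma>\<bar>) + J (\<lambda>x \<sigma>. 4 * win \<sigma>)"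
      by (intro J_add) (auto simp: adm_def intro!: tame_intros)
    also have "\<dots> = J (\<lambda>x \<sigma>. 12 / s * 1) + J (\<lambda>x \<sigma>. 4 / s * \<bar>X \<sigma>\<bar>) + J (\<lambda>x \<sigma>. 4 * win \<sigma>)"
      by (intro arg_cong2[of _ _ _ _ "(+)"] refl J_add) (auto simp: adm_def intro!: tame_intros)
    also have "\<dots> = 12 * (1 / s) * Z + 4 * (1 / s) * J (\<lambda>x \<sigma>. \<bar>X \<sigma>\<bar>) + 4 * J (\<lambda>x \<sigma>. win \<sigma>)"
      unfolding J_cmult by simp
    also have "\<dots> \<le> 12 * (r / q) * Z + 4 * (r / q) * (Y * r * Z) + 4 * (P * r\<^sup>2 / q * Z)"
    proof (intro add_mono)
      show "12 * (1 / s) * Z \<le> 12 * (r / q) * Z"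
        using inv_s Z by (intro mult_right_mono mult_left_mono) auto
      have "4 * (1 / s) * J (\<lambda>x \<sigma>. \<bar>X \<sigma>\<bar>) \<le> 4 * (1 / s) * (Y * r * Z)"
        using JX s by (intro mult_left_mono) auto
      also have "\<dots> \<le> 4 * (r / q) * (Y * r * Z)"
        using inv_s Y r Z by (intro mult_right_mono mult_left_mono) auto
      finally show "4 * (1 / s) * J (\<lambda>x \<sigma>. \<bar>X \<sigma>\<bar>) \<le> 4 * (r / q) * (Y * r * Z)" .
      show "4 * J (\<lambda>x \<sigma>. win \<sigma>) \<le> 4 * (P * r\<^sup>2 / q * Z)"
        using Jwin by simp
    qed
    also have "\<dots> = (12 * r + 4 * Y * r\<^sup>2 + 4 * (P * r\<^sup>2)) / q * Z"
    proof -
      have "12 * (r / q) * Z + 4 * (r / q) * (y * r * Z) + 4 * (P * r\<^sup>2 / q * Z)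
          = (12 * r + 4 * y * r\<^sup>2 + 4 * (P * r\<^sup>2)) / q * Z" for y
        using q by (simp add: field_simps power2_eq_square)
      thus ?thesis .
    qed
    finally show ?thesis .
  qed
  have t2: "U / chi * J (\<lambda>x \<sigma>. ew \<sigma>) \<le> U * r\<^sup>2 * (12 * r + 4 * Y * r\<^sup>2 + 4 * (P * r\<^sup>2)) / q * Z"
  proof -
    have "U / chi * J (\<lambda>x \<sigma>. ew \<sigma>)
        \<le> U / chi * ((12 * r + 4 * Y * r\<^sup>2 + 4 * (P * r\<^sup>2)) / q * Z)"
      using U chi by (intro mult_left_mono Jew divide_nonneg_pos) auto
    also have "\<dots> = (U * ((12 * r + 4 * Y * r\<^sup>2 + 4 * (P * r\<^sup>2)) / q * Z)) * (1 / chi)"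
      by simp
    also have "\<dots> \<le> (U * ((12 * r + 4 * Y * r\<^sup>2 + 4 * (P * r\<^sup>2)) / q * Z)) * r\<^sup>2"
      using inv_chi A \<kappa> V chi0 P q Z r
      by (intro mult_left_mono mult_nonneg_nonneg add_nonneg_nonneg divide_nonneg_nonneg) auto
    finally show ?thesis by (simp add: mult_ac)
  qed
  have eq: "(k + l + m) / q * Z = k / q * Z + l / q * Z + m / q * Z" for k l m
    by (simp only: distrib_right add_divide_distrib)
  show ?thesis
    unfolding s_def[symmetric] X_def[symmetric] P_def[symmetric] q_def[symmetric] eq
    using main t1 t2 t3 by linarith
qed

end

section \<open>Concentration of the auxiliary coordinate\<close>

lemma linear_times_gaussian_tendsto_0:
  fixes N :: real
  assumes "0 < N"
  shows "((\<lambda>x. (x - x0) * exp (- N * x\<^sup>2 / 2 + (b * x + c))) \<longlongrightarrow> 0) at_top"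
    and "((\<lambda>x. (x - x0) * exp (- N * x\<^sup>2 / 2 + (b * x + c))) \<longlongrightarrow> 0) at_bot"
  using assms by real_asymp+

section \<open>The unnormalized density of the auxiliary coordinate and its second moment\<close>

context tilted_spins
begin

definition marginal :: "real \<Rightarrow> real" where
  "marginal x = (\<Sum>\<sigma>\<in>Conf n. joint x \<sigma>)"

lemma J_marginal: "J (\<lambda>x \<sigma>. f x) = (\<integral>x. marginal x * f x \<partial>lborel)"
  by (simp add: J_def marginal_def sum_distrib_right)

lemma marginal_pos: "0 < marginal x"
  unfolding marginal_def using Conf_nonempty by (intro sum_pos joint_pos) auto

lemma integrable_marginal: "tame f \<Longrightarrow> integrable lborel (\<lambda>x. marginal x * f x)"
  unfolding marginal_def sum_distrib_right
  by (intro Bochner_Integration.integrable_sum integrable_joint_tame)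

lemma joint_alt: "joint x \<sigma> = exp (- real n * x\<^sup>2 / 2 + (R \<sigma> * x + h * S \<sigma>))"
proof -
  have "(\<Sum>i<n. \<sigma> i * (u i * x + h)) = R \<sigma> * x + h * S \<sigma>"
    by (simp add: R_def S_def sum_distrib_left sum_distrib_right sum.distrib algebra_simps)
  thus ?thesis by (simp add: joint_def)
qed

text \<open>Differentiating each exponential produces \<open>R \<sigma> - n * x\<close>. The spin
  identity with a constant test function replaces each spin by its conditional mean.\<close>

lemma marginal_has_derivative:
  "(marginal has_real_derivative (- real n * drift x * marginal x)) (at x)"
proof -
  have "((\<lambda>x. joint x \<sigma>) has_real_derivative joint x \<sigma> * (R \<sigma> - real n * x)) (at x)" for \<sigma>
    unfolding joint_alt by (auto intro!: derivative_eq_intros simp: algebra_simps)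
  hence "(marginal has_real_derivative (\<Sum>\<sigma>\<in>Conf n. joint x \<sigma> * (R \<sigma> - real n * x))) (at x)"
    unfolding marginal_def by (auto intro!: derivative_intros)
  moreover have "(\<Sum>\<sigma>\<in>Conf n. joint x \<sigma> * (R \<sigma> - real n * x)) = - real n * drift x * marginal x"
  proof -
    have z: "(\<Sum>\<sigma>\<in>Conf n. joint x \<sigma> * (\<sigma> i - \<tau> i x)) = 0" if "i < n" for i
      using spin_sum_identity[OF that, of x "\<lambda>_. 1"] by (simp add: spin_diff_def)
    have "(\<Sum>\<sigma>\<in>Conf n. joint x \<sigma> * (\<Sum>i<n. u i * (\<sigma> i - \<tau> i x)))
        = (\<Sum>i<n. u i * (\<Sum>\<sigma>\<in>Conf n. joint x \<sigma> * (\<sigma> i - \<tau> i x)))"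
      unfolding sum_distrib_left by (subst sum.swap) (simp add: mult_ac)
    also have "\<dots> = 0" by (simp add: z)
    finally have 0: "(\<Sum>\<sigma>\<in>Conf n. joint x \<sigma> * (\<Sum>i<n. u i * (\<sigma> i - \<tau> i x))) = 0" .
    have "R \<sigma> - real n * x = (\<Sum>i<n. u i * (\<sigma> i - \<tau> i x)) - real n * drift x" for \<sigma>
      using n_pos by (simp add: R_def drift_def avg_def right_diff_distrib sum_subtractf)
    hence "(\<Sum>\<sigma>\<in>Conf n. joint x \<sigma> * (R \<sigma> - real n * x))
        = (\<Sum>\<sigma>\<in>Conf n. joint x \<sigma> * (\<Sum>i<n. u i * (\<sigma> i - \<tau> i x))) - (\<Sum>\<sigma>\<in>Conf n. joint x \<sigma> * (real n * drift x))"
      by (simp only: right_diff_distrib sum_subtractf)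
    moreover have "(\<Sum>\<sigma>\<in>Conf n. joint x \<sigma> * (real n * drift x)) = marginal x * (real n * drift x)"
      by (simp only: marginal_def sum_distrib_right)
    ultimately show ?thesis
      unfolding 0 by simp
  qed
  ultimately show ?thesis by simp
qed

lemma continuous_on_marginal: "continuous_on A marginal"
  by (meson marginal_has_derivative DERIV_isCont continuous_at_imp_continuous_on)

lemma marginal_linear_tendsto_0:
  "((\<lambda>x. (x - x0) * marginal x) \<longlongrightarrow> 0) at_top"
  "((\<lambda>x. (x - x0) * marginal x) \<longlongrightarrow> 0) at_bot"
  unfolding marginal_def sum_distrib_left joint_alt using n_pos
  by (intro tendsto_null_sum linear_times_gaussian_tendsto_0; simp)+

text \<open>Integrate the derivative of \<open>(x - x0) * marginal x\<close> over the half line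
  above \<open>l\<close>. Gaussian decay removes the boundary term at infinity, and
  \<open>B \<le> 0\<close> gives the one at \<open>l\<close> the favourable sign, so the mass
  dominates \<open>n\<close> times the integral of \<open>(x - x0) * drift x\<close>. The extended
  real \<open>l\<close> covers both the whole line and the positive half line.\<close>

lemma integral_deviation_le:
  fixes l :: ereal
  assumes l: "l < \<infinity>"
    and lim: "(((\<lambda>x. (x - x0) * marginal x) \<circ> real_of_ereal) \<longlongrightarrow> B) (at_right l)" "B \<le> 0"
    and drift: "\<And>x. l < ereal x \<Longrightarrow> \<kappa> * (x - x0)\<^sup>2 \<le> (x - x0) * drift x"
  shows "real n * \<kappa> * (\<integral>x. indicator (einterval l \<infinity>) x * (marginal x * (x - x0)\<^sup>2) \<partial>lborel)
    \<le> (\<integral>x. indicator (einterval l \<infinity>) x * marginal x \<partial>lborel)"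
proof -
  let ?I = "indicator (einterval l \<infinity>) :: real \<Rightarrow> real"
  let ?f = "\<lambda>x. marginal x * (1 - real n * ((x - x0) * drift x))"
  have tame: "tame (\<lambda>x. 1 - real n * ((x - x0) * drift x))" "tame (\<lambda>x. (x - x0) * drift x)"
    "tame (\<lambda>x. (x - x0)\<^sup>2)"
    by (intro tame_intros)+
  have int: "integrable lborel (\<lambda>x. ?I x * (marginal x * f x))" if "tame f" for f
    using integrable_real_mult_indicator[of "einterval l \<infinity>" lborel, OF _ integrable_marginal[OF that]]
    by (simp add: mult.commute)
  have cont: "continuous_on UNIV drift"
    using tame_drift by (simp add: tame_def)
  have "(LBINT x=l..\<infinity>. ?f x) = 0 - B"
  proof (rule interval_integral_FTC_integrable[OF l _ _ _ lim(1)])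
    fix x :: real
    show "((\<lambda>x. (x - x0) * marginal x) has_vector_derivative ?f x) (at x)"
      unfolding has_real_derivative_iff_has_vector_derivative[symmetric]
      by (auto intro!: derivative_eq_intros marginal_has_derivative simp: algebra_simps)
    have "continuous_on UNIV ?f"
      by (intro continuous_intros continuous_on_marginal cont)
    thus "isCont ?f x"
      by (simp add: continuous_on_eq_continuous_at)
  next
    show "set_integrable lborel (einterval l \<infinity>) ?f"
      using int[OF tame(1)] by (simp add: set_integrable_def)
    show "(((\<lambda>x. (x - x0) * marginal x) \<circ> real_of_ereal) \<longlongrightarrow> 0) (at_left \<infinity>)"
      using marginal_linear_tendsto_0(1)[of x0] by (simp add: ereal_tendsto_simps)
  qed
  hence "(\<integral>x. ?I x * ?f x \<partial>lborel) \<ge> 0"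
    using l lim(2) by (simp add: interval_lebesgue_integral_def set_lebesgue_integral_def less_imp_le)
  moreover have "(\<integral>x. ?I x * ?f x \<partial>lborel)
      = (\<integral>x. ?I x * marginal x - real n * (?I x * (marginal x * ((x - x0) * drift x))) \<partial>lborel)"
    by (intro Bochner_Integration.integral_cong) (auto simp: algebra_simps)
  moreover have "\<dots> = (\<integral>x. ?I x * marginal x \<partial>lborel)
      - real n * (\<integral>x. ?I x * (marginal x * ((x - x0) * drift x)) \<partial>lborel)"
    using int[OF tame_const[of 1]] int[OF tame(2)] by simp
  moreover have "real n * (\<kappa> * (\<integral>x. ?I x * (marginal x * (x - x0)\<^sup>2) \<partial>lborel))
      \<le> real n * (\<integral>x. ?I x * (marginal x * ((x - x0) * drift x)) \<partial>lborel)"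
  proof (rule mult_left_mono)
    have "\<kappa> * (\<integral>x. ?I x * (marginal x * (x - x0)\<^sup>2) \<partial>lborel)
        = (\<integral>x. \<kappa> * (?I x * (marginal x * (x - x0)\<^sup>2)) \<partial>lborel)"
      by simp
    also have "\<dots> \<le> (\<integral>x. ?I x * (marginal x * ((x - x0) * drift x)) \<partial>lborel)"
    proof (rule integral_mono)
      fix x
      show "\<kappa> * (?I x * (marginal x * (x - x0)\<^sup>2)) \<le> ?I x * (marginal x * ((x - x0) * drift x))"
        using drift[of x] mult_left_mono[of "\<kappa> * (x - x0)\<^sup>2" "(x - x0) * drift x" "marginal x"] marginal_pos[of x]
        by (auto simp: indicator_def einterval_def mult_ac)
    qed (use int tame in auto)
    finally show "\<kappa> * (\<integral>x. ?I x * (marginal x * (x - x0)\<^sup>2) \<partial>lborel)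
        \<le> (\<integral>x. ?I x * (marginal x * ((x - x0) * drift x)) \<partial>lborel)" .
  qed simp
  ultimately show ?thesis by (simp add: mult_ac)
qed

lemma variance_convex:
  assumes "0 < \<kappa>" "\<And>x. \<kappa> * (x - x0)\<^sup>2 \<le> (x - x0) * drift x"
  shows "J (\<lambda>x \<sigma>. (x - x0)\<^sup>2) \<le> 1 / \<kappa> / real n * J (\<lambda>_ _. 1)"
proof -
  have "real n * \<kappa> * (\<integral>x. indicator (einterval (- \<infinity>) \<infinity>) x * (marginal x * (x - x0)\<^sup>2) \<partial>lborel)
    \<le> (\<integral>x. indicator (einterval (- \<infinity>) \<infinity>) x * marginal x \<partial>lborel)"
    using assms marginal_linear_tendsto_0(2)[of x0]
    by (intro integral_deviation_le[where B = 0]) (auto simp: ereal_tendsto_simps)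
  hence "real n * \<kappa> * J (\<lambda>x \<sigma>. (x - x0)\<^sup>2) \<le> J (\<lambda>_ _. 1)"
    unfolding J_marginal by simp
  thus ?thesis
    using n_pos assms(1) by (simp add: field_simps)
qed

lemma marginal_eq_prod: "marginal x = exp (- real n * x\<^sup>2 / 2) * (\<Prod>i<n. 2 * cosh (u i * x + h))"
proof -
  have "(\<Prod>i<n. 2 * cosh (u i * x + h)) = (\<Prod>i<n. \<Sum>s\<in>{- 1, 1}. exp (s * (u i * x + h)))"
    by (intro prod.cong) (auto simp: cosh_def)
  also have "\<dots> = (\<Sum>\<sigma>\<in>Conf n. \<Prod>i<n. exp (\<sigma> i * (u i * x + h)))"
    unfolding Conf_def by (rule prod_sum_PiE) auto
  finally show ?thesis
    by (simp only: marginal_def joint_def exp_add exp_sum finite_lessThan sum_distrib_left)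
qed

text \<open>The density factorizes over the spins, so the comparison for a single cosh can be
  multiplied up.\<close>

lemma marginal_reflect_le:
  assumes "0 \<le> h" "0 \<le> x"
  shows "marginal (- x) \<le> exp (- tanh h * (\<Sum>i<n. tanh (u i * x))) * marginal x"
proof -
  have "(\<Prod>i<n. 2 * cosh (u i * (- x) + h)) = (\<Prod>i<n. 2 * cosh (u i * x - h))"
    by (intro prod.cong refl) (metis (no_types) add.commute cosh_minus minus_diff_eq mult_minus_right uminus_add_conv_diff)
  also have "\<dots> \<le> (\<Prod>i<n. exp (- (tanh h * tanh (u i * x))) * (2 * cosh (u i * x + h)))"
  proof (rule prod_mono)
    fix i assume "i \<in> {..<n}"
    hence "0 \<le> u i * x" using u_nonneg assms by auto
    thus "0 \<le> 2 * cosh (u i * x - h) \<and>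
        2 * cosh (u i * x - h) \<le> exp (- (tanh h * tanh (u i * x))) * (2 * cosh (u i * x + h))"
      using cosh_reflect_le[of "u i * x" h] assms by auto
  qed
  also have "\<dots> = exp (- tanh h * (\<Sum>i<n. tanh (u i * x))) * (\<Prod>i<n. 2 * cosh (u i * x + h))"
    by (simp add: prod.distrib sum_distrib_left flip: exp_sum sum_negf)
  finally show ?thesis
    unfolding marginal_eq_prod by (simp add: mult_ac)
qed

text \<open>At low temperature \<open>drift\<close> need not be monotone on the negative axis; that part of the marginal is
  compared with its mirror image.\<close>

lemma variance_positive_field:
  assumes h: "0 < h" and x0: "0 < x0"
    and drift: "\<And>x. 0 \<le> x \<Longrightarrow> tanh h * (x - x0)\<^sup>2 \<le> (x - x0) * drift x"
    and \<delta>: "0 < \<delta>" "\<delta> * real n \<le> (\<Sum>i<n. tanh (u i * (x0 / 2)))"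
  shows "J (\<lambda>x \<sigma>. (x - x0)\<^sup>2)
    \<le> (12 / tanh h + 8 * x0\<^sup>2 / (tanh h * \<delta>)) / real n * J (\<lambda>_ _. 1)"
proof -
  define \<kappa> where "\<kappa> = tanh h"
  have \<kappa>: "0 < \<kappa>" using h by (simp add: \<kappa>_def)
  define \<epsilon> where "\<epsilon> = 8 * x0\<^sup>2 / (\<kappa> * \<delta> * real n)"
  have \<epsilon>: "0 \<le> \<epsilon>" using \<kappa> \<delta> by (simp add: \<epsilon>_def)
  let ?I = "indicator {0..} :: real \<Rightarrow> real"
  \<comment> \<open>For \<open>x\<close> below \<open>x0 / 2\<close> the distance of
    \<open>- x\<close> from \<open>x0\<close> is at most three times that of \<open>x\<close>,
    whence a factor 9. Beyond, the density ratio is exponentially small in \<open>n\<close>, and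
    \<open>\<epsilon>\<close> absorbs the term with \<open>8 * x0^2\<close>. The number 11 exceeds
    both 9 and 2, and with the positive half line it makes 12.\<close>
  have reflect: "marginal (- x) * (- x - x0)\<^sup>2 \<le> marginal x * (11 * (x - x0)\<^sup>2 + \<epsilon>)"
    if x: "0 \<le> x" for x
  proof (cases "x < x0 / 2")
    case True
    have "0 \<le> (\<Sum>i<n. tanh (u i * x))"
      using u_nonneg x by (intro sum_nonneg) auto
    hence "exp (- tanh h * (\<Sum>i<n. tanh (u i * x))) \<le> 1" using h by simp
    hence "marginal (- x) \<le> 1 * marginal x"
      using marginal_reflect_le[of x] h x marginal_pos[of x]
      by (meson less_imp_le mult_right_mono order.trans)
    moreover have "(- x - x0)\<^sup>2 \<le> 11 * (x - x0)\<^sup>2 + \<epsilon>"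
    proof -
      have "\<bar>- x - x0\<bar> \<le> \<bar>3 * (x - x0)\<bar>" using True x by simp
      hence "(- x - x0)\<^sup>2 \<le> (3 * (x - x0))\<^sup>2" by (simp only: abs_le_square_iff)
      also have "\<dots> = 9 * (x - x0)\<^sup>2" by (simp add: power2_eq_square algebra_simps)
      finally show ?thesis using \<epsilon> zero_le_power2[of "x - x0"] by linarith
    qed
    ultimately show ?thesis
      using marginal_pos[of x] by (intro mult_mono) auto
  next
    case False
    have "(\<Sum>i<n. tanh (u i * (x0 / 2))) \<le> (\<Sum>i<n. tanh (u i * x))"
      using False u_nonneg by (intro sum_mono tanh_real_le_iff[THEN iffD2] mult_left_mono) auto
    hence "\<delta> * real n \<le> (\<Sum>i<n. tanh (u i * x))" using \<delta> by linarith
    hence "\<kappa> * (\<delta> * real n) \<le> \<kappa> * (\<Sum>i<n. tanh (u i * x))"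
      using \<kappa> by (intro mult_left_mono) auto
    hence "exp (- tanh h * (\<Sum>i<n. tanh (u i * x))) \<le> exp (- (\<kappa> * \<delta> * real n))"
      by (simp add: \<kappa>_def mult_ac)
    \<comment> \<open>A gain of order \<open>1 / n\<close> is enough, so the exponential is traded
      for \<open>1 / t\<close>.\<close>
    also have "\<dots> \<le> 1 / (\<kappa> * \<delta> * real n)"
    proof -
      have pos: "0 < \<kappa> * \<delta> * real n" using \<kappa> \<delta> n_pos by simp
      have "\<kappa> * \<delta> * real n \<le> exp (\<kappa> * \<delta> * real n)"
        using exp_ge_add_one_self[of "\<kappa> * \<delta> * real n"] by linarith
      thus ?thesis using pos
        by (simp add: exp_minus inverse_eq_divide frac_le)
    qed
    finally have e: "exp (- tanh h * (\<Sum>i<n. tanh (u i * x))) \<le> 1 / (\<kappa> * \<delta> * real n)" .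
    have e1: "exp (- tanh h * (\<Sum>i<n. tanh (u i * x))) \<le> 1"
      using u_nonneg x h by (auto intro!: sum_nonneg mult_nonneg_nonneg)
    let ?e = "exp (- tanh h * (\<Sum>i<n. tanh (u i * x)))"
    have sq: "(- x - x0)\<^sup>2 \<le> 2 * (x - x0)\<^sup>2 + 8 * x0\<^sup>2"
      using zero_le_power2[of "x - 3 * x0"] by (simp add: power2_eq_square algebra_simps)
    have "?e * (- x - x0)\<^sup>2 \<le> ?e * (2 * (x - x0)\<^sup>2 + 8 * x0\<^sup>2)"
      using sq by (intro mult_left_mono) auto
    also have "\<dots> = ?e * (2 * (x - x0)\<^sup>2) + ?e * (8 * x0\<^sup>2)"
      by (rule distrib_left)
    also have "\<dots> \<le> 1 * (2 * (x - x0)\<^sup>2) + 1 / (\<kappa> * \<delta> * real n) * (8 * x0\<^sup>2)"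
      using e e1 by (intro add_mono mult_right_mono) auto
    also have "\<dots> \<le> 11 * (x - x0)\<^sup>2 + \<epsilon>"
      by (simp add: \<epsilon>_def)
    finally have *: "?e * (- x - x0)\<^sup>2 \<le> 11 * (x - x0)\<^sup>2 + \<epsilon>" .
    have "marginal (- x) * (- x - x0)\<^sup>2 \<le> ?e * marginal x * (- x - x0)\<^sup>2"
      using marginal_reflect_le[of x] h x by (intro mult_right_mono) auto
    also have "\<dots> = marginal x * (?e * (- x - x0)\<^sup>2)" by (simp add: mult_ac)
    also have "\<dots> \<le> marginal x * (11 * (x - x0)\<^sup>2 + \<epsilon>)"
      using * marginal_pos[of x] by (intro mult_left_mono) auto
    finally show ?thesis .
  qed

  have tame: "tame (\<lambda>x. (x - x0)\<^sup>2)" "tame (\<lambda>x. 11 * (x - x0)\<^sup>2 + \<epsilon>)"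
    by (intro tame_intros)+
  have int: "integrable lborel (\<lambda>x. indicator B x * (marginal x * f x))"
    if "tame f" "B \<in> sets borel" for f and B :: "real set"
    using integrable_real_mult_indicator[of B lborel, OF _ integrable_marginal[OF that(1)]] that
    by (simp add: mult.commute)
  define Ip where "Ip = (\<integral>x. ?I x * (marginal x * (x - x0)\<^sup>2) \<partial>lborel)"
  define Zp where "Zp = (\<integral>x. ?I x * marginal x \<partial>lborel)"
  have "einterval 0 \<infinity> = {0::real<..}"
    by (auto simp: einterval_def)
  moreover have swap: "(\<integral>x. indicator {0<..} x * g x \<partial>lborel) = (\<integral>x. ?I x * g x \<partial>lborel)"
    if [measurable]: "g \<in> borel_measurable borel" for g :: "real \<Rightarrow> real"
  proof (rule integral_cong_AE)
    show "AE x in lborel. indicator {0<..} x * g x = ?I x * g x"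
      using AE_lborel_singleton[of 0] by eventually_elim (auto simp: indicator_def)
  qed auto
  moreover have [measurable]: "marginal \<in> borel_measurable borel"
    using continuous_on_marginal by (rule borel_measurable_continuous_onI)
  moreover have "real n * \<kappa> * (\<integral>x. indicator (einterval 0 \<infinity>) x * (marginal x * (x - x0)\<^sup>2) \<partial>lborel)
    \<le> (\<integral>x. indicator (einterval 0 \<infinity>) x * marginal x \<partial>lborel)"
  proof (rule integral_deviation_le[where B = "(0 - x0) * marginal 0"])
    have "continuous_on UNIV (\<lambda>x. (x - x0) * marginal x)"
      by (intro continuous_intros continuous_on_marginal)
    hence "((\<lambda>x. (x - x0) * marginal x) \<longlongrightarrow> (0 - x0) * marginal 0) (at_right 0)"
      by (intro filterlim_at_split[THEN iffD1, THEN conjunct2] isContD)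
        (simp add: continuous_on_eq_continuous_at)
    thus "(((\<lambda>x. (x - x0) * marginal x) \<circ> real_of_ereal) \<longlongrightarrow> (0 - x0) * marginal 0) (at_right 0)"
      by (simp only: zero_ereal_def ereal_tendsto_simps1)
    \<comment> \<open>The boundary term at 0 has the right sign because the fixed point is
      positive.\<close>
    show "(0 - x0) * marginal 0 \<le> 0"
      using x0 marginal_pos[of 0] by simp
  qed (use drift in \<open>auto simp: \<kappa>_def\<close>)
  ultimately have "real n * \<kappa> * Ip \<le> Zp"
    by (simp add: Ip_def Zp_def)
  hence Ip: "Ip \<le> Zp / (real n * \<kappa>)"
    using n_pos \<kappa> by (simp add: field_simps)
  have Zp: "Zp \<le> J (\<lambda>_ _. 1)"
    unfolding Zp_def J_marginal
    using int[OF tame_const[of 1], of "{0..}"] integrable_marginal[OF tame_const[of 1]] marginal_pos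
    by (intro integral_mono) (auto simp: indicator_def less_imp_le)

  have "J (\<lambda>x \<sigma>. (x - x0)\<^sup>2)
      = (\<integral>x. ?I x * (marginal x * (x - x0)\<^sup>2) + indicator {..<0} x * (marginal x * (x - x0)\<^sup>2) \<partial>lborel)"
    unfolding J_marginal by (intro Bochner_Integration.integral_cong) (auto simp: indicator_def)
  also have "\<dots> = Ip + (\<integral>x. indicator {..<0} x * (marginal x * (x - x0)\<^sup>2) \<partial>lborel)"
    unfolding Ip_def using tame by (intro Bochner_Integration.integral_add int) auto
  also have "(\<integral>x. indicator {..<0} x * (marginal x * (x - x0)\<^sup>2) \<partial>lborel)
      = (\<integral>x. indicator {..<0} (- x) * (marginal (- x) * (- x - x0)\<^sup>2) \<partial>lborel)"
    by (subst lborel_integral_real_affine[where c = "- 1" and t = 0]) auto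
  also have "\<dots> \<le> (\<integral>x. ?I x * (marginal x * (11 * (x - x0)\<^sup>2 + \<epsilon>)) \<partial>lborel)"
  proof (rule integral_mono)
    show "integrable lborel (\<lambda>x. indicator {..<0} (- x) * (marginal (- x) * (- x - x0)\<^sup>2))"
      using lborel_integrable_real_affine[OF int[OF tame(1), of "{..<0}"], of "- 1" 0] by simp
    fix x :: real
    show "indicator {..<0} (- x) * (marginal (- x) * (- x - x0)\<^sup>2)
        \<le> ?I x * (marginal x * (11 * (x - x0)\<^sup>2 + \<epsilon>))"
      using reflect[of x] marginal_pos[of x] \<epsilon> by (auto simp: indicator_def)
  qed (use int tame in auto)
  also have "\<dots> = (\<integral>x. 11 * (?I x * (marginal x * (x - x0)\<^sup>2)) + \<epsilon> * (?I x * marginal x) \<partial>lborel)"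
    by (intro Bochner_Integration.integral_cong) (auto simp: algebra_simps)
  also have "\<dots> = 11 * Ip + \<epsilon> * Zp"
    unfolding Ip_def Zp_def
    using int[OF tame(1), of "{0..}"] int[OF tame_const[of 1], of "{0..}"]
    by (subst Bochner_Integration.integral_add) auto
  finally have "J (\<lambda>x \<sigma>. (x - x0)\<^sup>2) \<le> 12 * Ip + \<epsilon> * Zp" by simp
  also have "\<dots> \<le> 12 * (Zp / (real n * \<kappa>)) + \<epsilon> * Zp"
    using Ip by simp
  also have "\<dots> = (12 / \<kappa> + 8 * x0\<^sup>2 / (\<kappa> * \<delta>)) / real n * Zp"
    using n_pos \<kappa> \<delta> by (simp add: \<epsilon>_def field_simps)
  also have "\<dots> \<le> (12 / \<kappa> + 8 * x0\<^sup>2 / (\<kappa> * \<delta>)) / real n * J (\<lambda>_ _. 1)"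
    using \<kappa> \<delta> Zp by (intro mult_left_mono) auto
  finally show ?thesis by (simp add: \<kappa>_def)
qed

end

text \<open>cosh is even, so reversing the field mirrors the density of \<open>x\<close>. Only
  functions of \<open>x\<close> are involved, and the spins need no reflection.\<close>

lemma J_reflect:
  assumes "tilted_spins n u"
  shows "tilted_spins.J n u (- h) (\<lambda>x \<sigma>. f x) = tilted_spins.J n u h (\<lambda>x \<sigma>. f (- x))"
proof -
  interpret P: tilted_spins n u h by fact
  interpret N: tilted_spins n u "- h" by fact
  have "cosh (u i * x + - h) = cosh (u i * - x + h)" for i x
    by (subst cosh_minus[symmetric]) simp
  hence "N.marginal x = P.marginal (- x)" for x
    by (simp only: N.marginal_eq_prod P.marginal_eq_prod power2_minus)
  thus ?thesis
    unfolding N.J_marginal P.J_marginal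
    by (subst lborel_integral_real_affine[where c = "- 1" and t = 0]) auto
qed

section \<open>The fixed point\<close>

context tilted_spins
begin

text \<open>The fixed point map is Lipschitz with constant \<open>avg (\<lambda>i. (u i)^2)\<close>.
  The estimate has content when this is below 1, the high temperature regime.\<close>

lemma drift_strongly_monotone:
  assumes fp: "x0 = avg (\<lambda>i. u i * \<tau> i x0)"
  shows "(1 - avg (\<lambda>i. (u i)\<^sup>2)) * (x - x0)\<^sup>2 \<le> (x - x0) * drift x"
proof -
  have "\<bar>avg (\<lambda>i. u i * \<tau> i x - u i * \<tau> i x0)\<bar> \<le> avg (\<lambda>i. (u i)\<^sup>2 * \<bar>x - x0\<bar>)"
  proof (rule avg_abs_le)
    fix i assume i: "i < n"
    have "\<bar>u i * \<tau> i x - u i * \<tau> i x0\<bar> = u i * \<bar>\<tau> i x - \<tau> i x0\<bar>"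
      using u_nonneg[OF i] by (simp add: abs_mult flip: right_diff_distrib)
    also have "\<dots> \<le> u i * (u i * \<bar>x - x0\<bar>)"
      by (intro mult_left_mono \<tau>_lipschitz i u_nonneg)
    finally show "\<bar>u i * \<tau> i x - u i * \<tau> i x0\<bar> \<le> (u i)\<^sup>2 * \<bar>x - x0\<bar>"
      by (simp add: power2_eq_square)
  qed
  hence "\<bar>avg (\<lambda>i. u i * \<tau> i x) - x0\<bar> \<le> avg (\<lambda>i. (u i)\<^sup>2) * \<bar>x - x0\<bar>"
    unfolding avg_diff avg_mult_right fp[symmetric] .
  hence "\<bar>x - x0\<bar> * \<bar>avg (\<lambda>i. u i * \<tau> i x) - x0\<bar> \<le> \<bar>x - x0\<bar> * (avg (\<lambda>i. (u i)\<^sup>2) * \<bar>x - x0\<bar>)"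
    by (intro mult_left_mono) auto
  moreover have "(x - x0) * (avg (\<lambda>i. u i * \<tau> i x) - x0) \<le> \<bar>x - x0\<bar> * \<bar>avg (\<lambda>i. u i * \<tau> i x) - x0\<bar>"
    by (metis abs_ge_self abs_mult)
  moreover have "\<bar>x - x0\<bar> * (avg (\<lambda>i. (u i)\<^sup>2) * \<bar>x - x0\<bar>) = avg (\<lambda>i. (u i)\<^sup>2) * (x - x0)\<^sup>2"
    by (simp add: power2_eq_square mult_ac flip: abs_mult)
  moreover have "(x - x0) * drift x = (x - x0)\<^sup>2 - (x - x0) * (avg (\<lambda>i. u i * \<tau> i x) - x0)"
    by (simp add: drift_def power2_eq_square algebra_simps)
  ultimately show ?thesis by (simp add: left_diff_distrib)
qed

lemma fixpoint_le_avg: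
  assumes fp: "x0 = avg (\<lambda>i. u i * \<tau> i x0)"
  shows "\<bar>x0\<bar> \<le> avg u"
proof -
  have "\<bar>avg (\<lambda>i. u i * \<tau> i x0)\<bar> \<le> avg u"
    using u_nonneg abs_\<tau>_le_1 by (intro avg_abs_le) (auto simp: abs_mult intro!: mult_left_le)
  thus ?thesis using fp by simp
qed

text \<open>The fixed point map is concave on the positive half line, starts at \<open>P\<close> and
  crosses the diagonal at \<open>x0\<close>. Comparing the chords from 0 to \<open>x\<close> and to
  \<open>x0\<close> bounds \<open>drift\<close> by a line of slope \<open>P / x0\<close>, from below
  beyond \<open>x0\<close> and from above before it. That slope is at least \<open>tanh h\<close>,
  whatever the temperature.\<close>

lemma drift_monotone_positive_field:
  assumes h: "0 < h" and x0: "0 < x0" and fp: "x0 = avg (\<lambda>i. u i * \<tau> i x0)" and x: "0 \<le> x"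
  shows "tanh h * (x - x0)\<^sup>2 \<le> (x - x0) * drift x"
proof -
  define P where "P = tanh h * avg u"
  have P: "tanh h * x0 \<le> P"
    unfolding P_def using fixpoint_le_avg[OF fp] h by (intro mult_left_mono) auto
  have chord: "p * (avg (\<lambda>i. u i * \<tau> i q) - P) \<le> q * (avg (\<lambda>i. u i * \<tau> i p) - P)"
    if pq: "0 \<le> p" "p \<le> q" for p q
  proof -
    have "avg (\<lambda>i. p * (u i * \<tau> i q - tanh h * u i)) \<le> avg (\<lambda>i. q * (u i * \<tau> i p - tanh h * u i))"
    proof (rule avg_mono)
      fix i assume i: "i < n"
      have "u i * p * (tanh (u i * q + h) - tanh h) \<le> u i * q * (tanh (u i * p + h) - tanh h)"
        using h pq u_nonneg[OF i] by (intro tanh_real_chord mult_left_mono) auto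
      thus "p * (u i * \<tau> i q - tanh h * u i) \<le> q * (u i * \<tau> i p - tanh h * u i)"
        by (simp add: \<tau>_def algebra_simps)
    qed
    thus ?thesis by (simp add: avg_cmult avg_diff P_def)
  qed
  have dx: "avg (\<lambda>i. u i * \<tau> i x) = x - drift x" by (simp add: drift_def)
  have "(x - x0)\<^sup>2 * P \<le> x0 * ((x - x0) * drift x)"
  proof (cases "x0 \<le> x")
    case True
    have "(x - x0) * P \<le> x0 * drift x"
      using chord[of x0 x] x0 True unfolding fp[symmetric] dx by (simp add: algebra_simps)
    hence "(x - x0) * ((x - x0) * P) \<le> (x - x0) * (x0 * drift x)"
      using True by (intro mult_left_mono) auto
    thus ?thesis by (simp add: power2_eq_square mult_ac)
  next
    case False
    have "x0 * drift x \<le> (x - x0) * P"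
      using chord[of x x0] x False unfolding fp[symmetric] dx by (simp add: algebra_simps)
    hence "(x - x0) * ((x - x0) * P) \<le> (x - x0) * (x0 * drift x)"
      using False by (intro mult_left_mono_neg) auto
    thus ?thesis by (simp add: power2_eq_square mult_ac)
  qed
  moreover have "(x - x0)\<^sup>2 * (tanh h * x0) \<le> (x - x0)\<^sup>2 * P"
    using P by (intro mult_left_mono) auto
  ultimately have "x0 * (tanh h * (x - x0)\<^sup>2) \<le> x0 * ((x - x0) * drift x)"
    by (simp add: mult_ac)
  thus ?thesis using x0 by simp
qed

text \<open>The tangent of tanh at \<open>u i * x0 + h\<close> lies above the graph at
  \<open>h\<close>. Multiplying by \<open>u i\<close> and averaging turns this into a bound on the
  slope of the fixed point map.\<close>

lemma curvature_positive_field: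
  assumes h: "0 < h" and x0: "0 < x0" and fp: "x0 = avg (\<lambda>i. u i * \<tau> i x0)"
  shows "tanh h \<le> 1 - avg (\<lambda>i. (1 - (\<tau> i x0)\<^sup>2) * (u i)\<^sup>2)"
proof -
  have "avg (\<lambda>i. x0 * ((1 - (\<tau> i x0)\<^sup>2) * (u i)\<^sup>2)) \<le> avg (\<lambda>i. u i * \<tau> i x0 - tanh h * u i)"
  proof (rule avg_mono)
    fix i assume i: "i < n"
    have "tanh h \<le> \<tau> i x0 - (1 - (\<tau> i x0)\<^sup>2) * (u i * x0)"
      using tanh_real_le_tangent[of "u i * x0 + h" h] u_nonneg[OF i] x0 h by (simp add: \<tau>_def)
    hence "u i * ((1 - (\<tau> i x0)\<^sup>2) * (u i * x0)) \<le> u i * (\<tau> i x0 - tanh h)"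
      using u_nonneg[OF i] by (intro mult_left_mono) auto
    thus "x0 * ((1 - (\<tau> i x0)\<^sup>2) * (u i)\<^sup>2) \<le> u i * \<tau> i x0 - tanh h * u i"
      by (simp add: algebra_simps power2_eq_square)
  qed
  hence "x0 * avg (\<lambda>i. (1 - (\<tau> i x0)\<^sup>2) * (u i)\<^sup>2) \<le> x0 - tanh h * avg u"
    unfolding avg_cmult avg_diff fp[symmetric] .
  also have "\<dots> \<le> x0 - tanh h * x0"
    using fixpoint_le_avg[OF fp] h by (intro diff_left_mono mult_left_mono) auto
  also have "\<dots> = x0 * (1 - tanh h)" by (simp add: algebra_simps)
  finally show ?thesis using x0 by simp
qed

lemma fixpoint_exists_positive_field:
  assumes h: "0 < h" and u: "0 < avg u"
  shows "\<exists>x0>0. x0 = avg (\<lambda>i. u i * \<tau> i x0)"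
proof -
  have "continuous_on {0..avg u} drift"
    using tame_drift continuous_on_subset by (auto simp: tame_def)
  moreover have d0: "drift 0 < 0"
  proof -
    have "drift 0 = - (avg u * tanh h)" by (simp add: drift_def \<tau>_def avg_mult_right)
    thus ?thesis using u h by simp
  qed
  moreover have "0 \<le> drift (avg u)"
  proof -
    have "avg (\<lambda>i. u i * \<tau> i (avg u)) \<le> avg u"
      using u_nonneg abs_\<tau>_le_1 by (intro avg_mono) (auto simp: abs_le_iff intro!: mult_left_le)
    thus ?thesis by (simp add: drift_def)
  qed
  ultimately obtain x0 where x0: "0 \<le> x0" "drift x0 = 0"
    using IVT'[of drift 0 0 "avg u"] u by auto
  moreover have "x0 \<noteq> 0" using x0 d0 by auto
  ultimately show ?thesis
    by (intro exI[of _ x0]) (auto simp: drift_def)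
qed

text \<open>A second fixed point has zero drift, so the monotonicity estimate forces its squared
  distance from \<open>x0\<close> to vanish.\<close>

lemma fixpoint_unique_positive_field:
  assumes h: "0 < h" and "0 < x0" "x0 = avg (\<lambda>i. u i * \<tau> i x0)" "0 < x1" "x1 = avg (\<lambda>i. u i * \<tau> i x1)"
  shows "x1 = x0"
proof -
  have "tanh h * (x1 - x0)\<^sup>2 \<le> (x1 - x0) * drift x1"
    using assms by (intro drift_monotone_positive_field) auto
  also have "drift x1 = 0" using assms(5) by (simp add: drift_def)
  finally show ?thesis
    using h by (simp add: mult_le_0_iff)
qed

text \<open>Jensen's inequality for exp, in the form of the tangent at the mean \<open>m\<close>,
  applied to the exponential lower bound for \<open>1 - tanh^2\<close>. The result involves only the
  first moment, which also bounds \<open>x0\<close>.\<close>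

lemma avg_variance_ge:
  assumes fp: "x0 = avg (\<lambda>i. u i * \<tau> i x0)" and A: "avg u \<le> A"
  shows "exp (- 2 * (A\<^sup>2 + \<bar>h\<bar>)) \<le> avg (\<lambda>i. 1 - (\<tau> i x0)\<^sup>2)"
proof -
  define y where "y i = - 2 * (u i * \<bar>x0\<bar> + \<bar>h\<bar>)" for i
  define m where "m = avg y"
  have "exp m * (1 + y i - m) \<le> 1 - (\<tau> i x0)\<^sup>2" if i: "i < n" for i
  proof -
    have "exp m * (1 + (y i - m)) \<le> exp m * exp (y i - m)"
      by (intro mult_left_mono exp_ge_add_one_self) auto
    also have "\<dots> = exp (y i)" by (simp flip: exp_add)
    also have "\<dots> \<le> exp (- 2 * \<bar>u i * x0 + h\<bar>)"
    proof -
      have "\<bar>u i * x0 + h\<bar> \<le> u i * \<bar>x0\<bar> + \<bar>h\<bar>"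
        using u_nonneg[OF i] by (metis abs_mult abs_of_nonneg abs_triangle_ineq)
      thus ?thesis by (simp add: y_def)
    qed
    also have "\<dots> \<le> 1 - (\<tau> i x0)\<^sup>2"
      unfolding \<tau>_def by (rule one_minus_tanh_sq_ge)
    finally show ?thesis by (simp only: add_diff_eq)
  qed
  hence "avg (\<lambda>i. exp m * (1 + y i - m)) \<le> avg (\<lambda>i. 1 - (\<tau> i x0)\<^sup>2)"
    by (intro avg_mono)
  also have "avg (\<lambda>i. exp m * (1 + y i - m)) = exp m"
    by (simp add: avg_cmult avg_diff avg_add avg_const m_def)
  finally have "exp m \<le> avg (\<lambda>i. 1 - (\<tau> i x0)\<^sup>2)" .
  moreover have "- 2 * (A\<^sup>2 + \<bar>h\<bar>) \<le> m"
  proof -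
    have "m = - 2 * (avg u * \<bar>x0\<bar> + \<bar>h\<bar>)"
      unfolding m_def y_def[abs_def] avg_cmult avg_add avg_mult_right avg_const ..
    moreover have "avg u * \<bar>x0\<bar> \<le> A * A"
      using fixpoint_le_avg[OF fp] A avg_nonneg[of u] u_nonneg by (intro mult_mono) auto
    ultimately show ?thesis by (simp add: power2_eq_square)
  qed
  ultimately show ?thesis
    by (meson exp_le_cancel_iff order.trans)
qed

text \<open>Lowering \<open>b\<close> to \<open>b'\<close> by monotonicity keeps the quadratic loss
  of the minorant below the linear gain when \<open>b'\<close> is small.\<close>

lemma sum_tanh_ge:
  assumes "0 \<le> b'" "b' \<le> b"
  shows "(b' * avg u - b'\<^sup>2 * avg (\<lambda>i. (u i)\<^sup>2)) * real n \<le> (\<Sum>i<n. tanh (u i * b))"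
proof -
  have "(b' * avg u - b'\<^sup>2 * avg (\<lambda>i. (u i)\<^sup>2)) * real n = (\<Sum>i<n. u i * b' - (u i * b')\<^sup>2)"
    using n_pos by (simp add: avg_def sum_subtractf sum_distrib_right sum_distrib_left power_mult_distrib
        field_simps)
  also have "\<dots> \<le> (\<Sum>i<n. tanh (u i * b))"
  proof (rule sum_mono)
    fix i assume "i \<in> {..<n}"
    hence u: "0 \<le> u i" using u_nonneg by auto
    have "u i * b' - (u i * b')\<^sup>2 \<le> tanh (u i * b')"
      using u assms by (intro tanh_real_ge) auto
    also have "\<dots> \<le> tanh (u i * b)"
      using u assms by (auto intro!: mult_left_mono)
    finally show "u i * b' - (u i * b')\<^sup>2 \<le> tanh (u i * b)" .
  qed
  finally show ?thesis .
qed

end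

text \<open>The constant of \<open>variance_positive_field\<close> with \<open>x0 \<le> A\<close>
  and \<open>\<delta> = b * s / 2\<close>, where \<open>b\<close> is the minimum in the formula. Its
  first entry keeps \<open>b\<close> below \<open>x0 / 2\<close>, as
  \<open>x0 \<ge> tanh h * s\<close>; its second limits the quadratic loss in
  \<open>sum_tanh_ge\<close> to half of the linear term.\<close>

definition field_variance :: "real \<Rightarrow> real \<Rightarrow> real \<Rightarrow> real" where
  "field_variance A s h = 12 / tanh h
     + 8 * A\<^sup>2 / (tanh h * (min (tanh h * s / 2) (s / (2 * A)) * s / 2))"

lemma field_variance_nonneg: "0 < h \<Longrightarrow> 0 < s \<Longrightarrow> 1 \<le> A \<Longrightarrow> 0 \<le> field_variance A s h"
  unfolding field_variance_def by (intro add_nonneg_nonneg divide_nonneg_nonneg mult_nonneg_nonneg) auto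

lemma (in tilted_spins) positive_field:
  assumes h: "0 < h" and s: "0 < s" "s \<le> avg u" and A: "1 \<le> A" "avg u \<le> A" "avg (\<lambda>i. (u i)\<^sup>2) \<le> A"
  shows "\<exists>x0>0. x0 = avg (\<lambda>i. u i * \<tau> i x0) \<and>
    J (\<lambda>x \<sigma>. (x - x0)\<^sup>2) \<le> field_variance A s h / real n * J (\<lambda>_ _. 1)"
proof -
  obtain x0 where x0: "0 < x0" and fp: "x0 = avg (\<lambda>i. u i * \<tau> i x0)"
    using fixpoint_exists_positive_field[OF h] s by auto
  define b where "b = min (tanh h * s / 2) (s / (2 * A))"
  have th: "0 < tanh h" using h by simp
  have b: "0 < b" using th s A by (auto simp: b_def)
  have x0_ge: "tanh h * s \<le> x0"
  proof -
    have "avg (\<lambda>i. u i * tanh h) \<le> avg (\<lambda>i. u i * \<tau> i x0)"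
      using u_nonneg x0 by (intro avg_mono mult_left_mono) (auto simp: \<tau>_def)
    hence "avg u * tanh h \<le> x0" unfolding fp[symmetric] avg_mult_right .
    moreover have "s * tanh h \<le> avg u * tanh h" using s th by (intro mult_right_mono) auto
    ultimately show ?thesis by (simp add: mult.commute)
  qed
  have x0_le: "x0 \<le> A" using fixpoint_le_avg[OF fp] A x0 by simp
  have \<delta>: "b * s / 2 * real n \<le> (\<Sum>i<n. tanh (u i * (x0 / 2)))"
  proof -
    have "b * avg (\<lambda>i. (u i)\<^sup>2) \<le> (s / (2 * A)) * A"
      using b A s avg_nonneg[of "\<lambda>i. (u i)\<^sup>2"] by (intro mult_mono) (auto simp: b_def)
    also have "\<dots> = s / 2" using A by simp
    finally have "b * (s / 2) \<le> b * (avg u - b * avg (\<lambda>i. (u i)\<^sup>2))"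
      using b s by (intro mult_left_mono) auto
    hence "b * s / 2 * real n \<le> (b * avg u - b\<^sup>2 * avg (\<lambda>i. (u i)\<^sup>2)) * real n"
      by (intro mult_right_mono) (auto simp: algebra_simps power2_eq_square)
    also have "\<dots> \<le> (\<Sum>i<n. tanh (u i * (x0 / 2)))"
      using b x0_ge by (intro sum_tanh_ge) (auto simp: b_def)
    finally show ?thesis .
  qed
  have "J (\<lambda>x \<sigma>. (x - x0)\<^sup>2)
      \<le> (12 / tanh h + 8 * x0\<^sup>2 / (tanh h * (b * s / 2))) / real n * J (\<lambda>_ _. 1)"
    using b s by (intro variance_positive_field h x0 \<delta> drift_monotone_positive_field fp) auto
  also have "\<dots> \<le> field_variance A s h / real n * J (\<lambda>_ _. 1)"
    unfolding field_variance_def b_def[symmetric] using x0 x0_le th b s J_one_pos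
    by (intro mult_right_mono divide_right_mono add_left_mono mult_left_mono power_mono) auto
  finally show ?thesis using x0 fp by blast
qed

text \<open>For negative \<open>h\<close> everything is transported from \<open>- h\<close> by the
  symmetry \<open>x\<close> to \<open>- x\<close>, under which each \<open>\<tau> i\<close> changes
  sign. Existence and uniqueness are phrased with \<open>sgn\<close> to match the description
  defining \<open>xstar\<close>.\<close>

lemma nonzero_field:
  assumes "tilted_spins n u" "h \<noteq> 0"
  defines "fp \<equiv> \<lambda>x. x = tilted_spins.avg n (\<lambda>i. u i * tilted_spins.\<tau> u h i x)"
  assumes s: "0 < s" "s \<le> tilted_spins.avg n u"
    and A: "1 \<le> A" "tilted_spins.avg n u \<le> A" "tilted_spins.avg n (\<lambda>i. (u i)\<^sup>2) \<le> A"
  shows "\<exists>x0. sgn x0 = sgn h \<and> fp x0 \<and> (\<forall>x. fp x \<longrightarrow> sgn x = sgn h \<longrightarrow> x = x0) \<and>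
    tanh \<bar>h\<bar> \<le> 1 - tilted_spins.avg n (\<lambda>i. (1 - (tilted_spins.\<tau> u h i x0)\<^sup>2) * (u i)\<^sup>2) \<and>
    tilted_spins.J n u h (\<lambda>x \<sigma>. (x - x0)\<^sup>2)
      \<le> field_variance A s \<bar>h\<bar> / real n * tilted_spins.J n u h (\<lambda>_ _. 1)"
proof (cases "0 < h")
  case True
  interpret tilted_spins n u h by fact
  obtain x0 where x0: "0 < x0" "x0 = avg (\<lambda>i. u i * \<tau> i x0)"
    "J (\<lambda>x \<sigma>. (x - x0)\<^sup>2) \<le> field_variance A s h / real n * J (\<lambda>_ _. 1)"
    using positive_field[OF True s A] by blast
  have h: "sgn h = 1" "\<bar>h\<bar> = h" using True by auto
  have "fp x0" unfolding fp_def by (rule x0(2))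
  moreover have "x = x0" if "fp x" "sgn x = 1" for x
    using that unfolding fp_def sgn_1_pos by (intro fixpoint_unique_positive_field[OF True x0(1,2)])
  moreover have "sgn x0 = 1" using x0(1) by simp
  ultimately show ?thesis
    unfolding h using x0(3) curvature_positive_field[OF True x0(1,2)] by blast
next
  case False
  hence h: "0 < - h" using \<open>h \<noteq> 0\<close> by simp
  interpret N: tilted_spins n u "- h" by fact
  interpret tilted_spins n u h by fact
  have \<tau>_minus: "\<tau> i (- x) = - N.\<tau> i x" for i x
  proof -
    have "u i * - x + h = - (u i * x + - h)" by simp
    thus ?thesis by (simp only: \<tau>_def N.\<tau>_def tanh_minus)
  qed
  have fp_minus: "fp (- x) \<longleftrightarrow> x = N.avg (\<lambda>i. u i * N.\<tau> i x)" for x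
  proof -
    have "avg (\<lambda>i. u i * \<tau> i (- x)) = - avg (\<lambda>i. u i * N.\<tau> i x)"
      using avg_cmult[of "- 1" "\<lambda>i. u i * N.\<tau> i x"] by (simp add: \<tau>_minus)
    thus ?thesis by (auto simp: fp_def)
  qed
  obtain x0 where x0: "0 < x0" "x0 = N.avg (\<lambda>i. u i * N.\<tau> i x0)"
    "N.J (\<lambda>x \<sigma>. (x - x0)\<^sup>2) \<le> field_variance A s (- h) / real n * N.J (\<lambda>_ _. 1)"
    using N.positive_field[OF h s A] by blast
  have uniq: "x = - x0" if "fp x" "sgn x = - 1" for x
  proof -
    have "fp (- (- x))" using that by simp
    hence "- x = N.avg (\<lambda>i. u i * N.\<tau> i (- x))" using fp_minus by blast
    hence "- x = x0"
      using that x0 h by (intro N.fixpoint_unique_positive_field[OF h x0(1,2)]) (auto simp: sgn_1_neg)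
    thus ?thesis by simp
  qed
  have "N.J (\<lambda>x \<sigma>. (x - x0)\<^sup>2) = J (\<lambda>x \<sigma>. (- x - x0)\<^sup>2)"
    using J_reflect[OF \<open>tilted_spins n u\<close>, of h "\<lambda>x. (x - x0)\<^sup>2"] .
  also have "\<dots> = J (\<lambda>x \<sigma>. (x - - x0)\<^sup>2)"
  proof -
    have "(- x - x0)\<^sup>2 = (x - - x0)\<^sup>2" for x by (simp add: power2_eq_square algebra_simps)
    thus ?thesis by simp
  qed
  finally have "J (\<lambda>x \<sigma>. (x - - x0)\<^sup>2) \<le> field_variance A s (- h) / real n * J (\<lambda>_ _. 1)"
    using x0(3) J_reflect[OF \<open>tilted_spins n u\<close>, of h "\<lambda>_. 1"] by simp
  moreover have "tanh (- h) \<le> 1 - avg (\<lambda>i. (1 - (\<tau> i (- x0))\<^sup>2) * (u i)\<^sup>2)"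
    using N.curvature_positive_field[OF h x0(1,2)] by (simp add: \<tau>_minus)
  moreover have "fp (- x0)" using fp_minus x0(2) by blast
  moreover have sgn: "sgn h = - 1" "\<bar>h\<bar> = - h" using h by auto
  moreover have "sgn (- x0) = - 1" using x0(1) by simp
  ultimately show ?thesis
    unfolding sgn using uniq by blast
qed

section \<open>Kolmogorov bound under moment bounds\<close>

text \<open>Only the affine dependence on the last argument, which carries the third moment, matters.\<close>

definition be_const :: "real \<Rightarrow> real \<Rightarrow> real \<Rightarrow> real \<Rightarrow> real \<Rightarrow> real" where
  "be_const A \<kappa> V c e = (let L = 2 * A * (1 + A / \<kappa>); U = 1 + A / \<kappa> * A; Y = 2 + A\<^sup>2 * V; r = 1 / sqrt c in
     L * (V + 1) * r\<^sup>2 + U * r\<^sup>2 * (12 * r + 4 * Y * r\<^sup>2 + 4 * ((4 * Y + L * (V + 1) + 4 * e * V) * r\<^sup>2))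
       + 6 * e * V * r)"

lemma (in spins_at_fixpoint) J_standardized_be_const:
  "\<bar>J (\<lambda>x \<sigma>. of_bool ((S \<sigma> - real n * M) / sqrt (real n * chi) \<le> z)) - Phi z * Z\<bar>
     \<le> be_const A \<kappa> V chi0 E2 / sqrt (real n) * Z"
  unfolding be_const_def Let_def by (rule J_standardized)

lemma be_const_affine:
  assumes "1 \<le> A" "0 < \<kappa>" "0 \<le> V" "0 < c"
  obtains B0 B1 where "0 \<le> B0" "0 \<le> B1" "\<And>e. be_const A \<kappa> V c e = B0 + B1 * e"
proof -
  define L U Y r where "L = 2 * A * (1 + A / \<kappa>)" and "U = 1 + A / \<kappa> * A" and "Y = 2 + A\<^sup>2 * V"
    and "r = 1 / sqrt c"
  have nn: "0 \<le> L" "0 \<le> U" "0 \<le> Y" "0 \<le> r"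
    using assms by (auto simp: L_def U_def Y_def r_def intro!: mult_nonneg_nonneg add_nonneg_nonneg)
  have eq: "be_const A \<kappa> V c e
      = (L * (V + 1) * r\<^sup>2 + U * r\<^sup>2 * (12 * r + 4 * Y * r\<^sup>2 + 4 * ((4 * Y + L * (V + 1)) * r\<^sup>2)))
        + (U * r\<^sup>2 * (16 * V * r\<^sup>2) + 6 * V * r) * e" for e
    unfolding be_const_def Let_def L_def[symmetric] U_def[symmetric] Y_def[symmetric] r_def[symmetric]
    by (simp add: algebra_simps)
  show ?thesis
    by (rule that[OF _ _ eq])
      (use nn assms in \<open>auto intro!: mult_nonneg_nonneg add_nonneg_nonneg\<close>)
qed

text \<open>An affine function with nonnegative coefficients, evaluated at most at
  \<open>d0 + d1 * t\<close>, is absorbed into a constant times \<open>1 + t\<close>.\<close>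

lemma be_const_le:
  assumes "1 \<le> A" "0 < \<kappa>" "0 \<le> V" "0 < c" "0 \<le> d0" "0 \<le> d1" "0 \<le> t" "e \<le> d0 + d1 * t"
  shows "be_const A \<kappa> V c e \<le> be_const A \<kappa> V c (d0 + d1) * (1 + t)"
proof -
  obtain B0 B1 where B: "0 \<le> B0" "0 \<le> B1" "\<And>e. be_const A \<kappa> V c e = B0 + B1 * e"
    using be_const_affine assms by metis
  have "B0 + B1 * e \<le> B0 + B1 * (d0 + d1 * t)"
    using B assms by (intro add_left_mono mult_left_mono) auto
  also have "\<dots> \<le> \<dots> + (B0 * t + B1 * d0 * t + B1 * d1)"
    using B assms by auto
  also have "\<dots> = (B0 + B1 * (d0 + d1)) * (1 + t)"
    by (simp add: algebra_simps)
  finally show ?thesis by (simp add: B)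
qed

lemma be_const_nonneg:
  assumes "1 \<le> A" "0 < \<kappa>" "0 \<le> V" "0 < c" "0 \<le> e"
  shows "0 \<le> be_const A \<kappa> V c e"
proof -
  obtain B0 B1 where B: "0 \<le> B0" "0 \<le> B1" "\<And>e. be_const A \<kappa> V c e = B0 + B1 * e"
    using be_const_affine assms by metis
  thus ?thesis using assms by simp
qed

text \<open>Translates the abstract model back to \<open>cw_prob\<close>, \<open>Mn\<close>,
  \<open>chin\<close> and \<open>Xn\<close>. The point \<open>x0\<close> is tied to
  \<open>Tn\<close> and not to \<open>xstar\<close>, which leaves room for
  \<open>\<beta> = 0\<close>, where both give the same \<open>Tn\<close> without being
  equal.\<close>

lemma dK_normal_le:
  fixes w :: "nat \<Rightarrow> nat \<Rightarrow> real"
  defines "a \<equiv> \<lambda>n \<beta>. sqrt (\<beta> / EWn w n id)"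
  assumes n: "0 < n" and W: "0 < EWn w n id" and \<beta>: "0 \<le> \<beta>"
    and T: "\<And>v. Tn w \<beta> h n v = tanh (a n \<beta> * v * x0 + h)"
    and sp: "spins_at_fixpoint n (\<lambda>i. a n \<beta> * w n i) h x0 A \<kappa> V c0"
  shows "dK_normal w \<beta> h n
    \<le> be_const A \<kappa> V c0 (2 * A + A / \<kappa> * (2 * (a n \<beta> ^ 3 * EWn w n (\<lambda>v. v ^ 3)))) / sqrt (real n)"
proof -
  interpret spins_at_fixpoint n "\<lambda>i. a n \<beta> * w n i" h x0 A \<kappa> V c0 by fact
  define b where "b = a n \<beta>"
  have b2: "b\<^sup>2 = \<beta> / EWn w n id" using \<beta> W by (simp add: b_def a_def)
  have EWn_avg: "EWn w n f = avg (\<lambda>i. f (w n i))" for f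
    by (simp add: EWn_def avg_def)
  have \<tau>_Tn: "\<tau> i x0 = Tn w \<beta> h n (w n i)" for i
    by (simp add: \<tau>_def T)
  have M_Mn: "M = Mn w \<beta> h n"
    by (simp add: M_def Mn_def EWn_avg \<tau>_Tn)
  have chi_chin: "chi = chin w \<beta> h n"
  proof -
    define f where "f v = 1 - (Tn w \<beta> h n v)\<^sup>2" for v
    have 1: "avg (\<lambda>i. (1 - (\<tau> i x0)\<^sup>2) * (a n \<beta> * w n i)) = b * EWn w n (\<lambda>v. f v * v)"
      by (simp add: EWn_avg \<tau>_Tn f_def b_def mult_ac flip: avg_cmult)
    have 2: "avg (\<lambda>i. (1 - (\<tau> i x0)\<^sup>2) * (a n \<beta> * w n i)\<^sup>2) = b\<^sup>2 * EWn w n (\<lambda>v. f v * v\<^sup>2)"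
      by (simp add: EWn_avg \<tau>_Tn f_def b_def power_mult_distrib mult_ac flip: avg_cmult)
    have "chi = avg (\<lambda>i. (1 - (\<tau> i x0)\<^sup>2) + c * ((1 - (\<tau> i x0)\<^sup>2) * (a n \<beta> * w n i)))"
      by (simp add: chi_def \<alpha>_def algebra_simps)
    also have "\<dots> = avg (\<lambda>i. 1 - (\<tau> i x0)\<^sup>2) + c * (b * EWn w n (\<lambda>v. f v * v))"
      unfolding avg_add avg_cmult 1 ..
    also have "\<dots> = 1 - EWn w n (\<lambda>v. (Tn w \<beta> h n v)\<^sup>2)
        + b\<^sup>2 * (EWn w n (\<lambda>v. f v * v))\<^sup>2 / (1 - b\<^sup>2 * EWn w n (\<lambda>v. f v * v\<^sup>2))"
      unfolding c_def 1 2 by (simp add: avg_diff avg_const EWn_avg \<tau>_Tn power2_eq_square)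
    finally show ?thesis
      by (simp add: chin_def Let_def b2 f_def)
  qed
  have gibbs_eq: "cw_weight w \<beta> h n \<sigma> = gibbs \<sigma>" for \<sigma>
  proof -
    have "R \<sigma> = b * (\<Sum>i<n. w n i * \<sigma> i)"
      by (simp add: R_def b_def sum_distrib_left mult_ac)
    moreover have "ell w n = real n * EWn w n id"
      using n by (simp add: ell_def EWn_def)
    ultimately have "(R \<sigma>)\<^sup>2 / (2 * real n) = \<beta> / (2 * ell w n) * (\<Sum>i<n. w n i * \<sigma> i)\<^sup>2"
      by (simp add: power_mult_distrib b2)
    thus ?thesis by (simp add: cw_weight_def gibbs_def S_def)
  qed
  have prob: "cw_prob w \<beta> h n P = J (\<lambda>x \<sigma>. of_bool (P \<sigma>)) / Z" for P
  proof -
    have "(\<Sum>\<sigma>\<in>Conf n. if P \<sigma> then cw_weight w \<beta> h n \<sigma> else 0) = (\<Sum>\<sigma>\<in>Conf n. gibbs \<sigma> * of_bool (P \<sigma>))"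
      by (intro sum.cong) (auto simp: gibbs_eq)
    thus ?thesis
      using n by (simp add: cw_prob_def J_spins gibbs_eq)
  qed
  have Xn_eq: "Xn w \<beta> h n \<sigma> = (S \<sigma> - real n * M) / sqrt (real n * chi)" for \<sigma>
  proof -
    have "S \<sigma> / real n - M = (S \<sigma> - real n * M) / real n"
      using n by (simp add: diff_divide_distrib)
    hence "sqrt (real n) * (S \<sigma> / real n - M) = sqrt (real n) / real n * (S \<sigma> - real n * M)"
      by simp
    also have "\<dots> = inverse (sqrt (real n)) * (S \<sigma> - real n * M)"
      by (simp only: sqrt_divide_self_eq of_nat_0_le_iff)
    finally have "sqrt (real n) * (S \<sigma> / real n - M) = (S \<sigma> - real n * M) / sqrt (real n)"
      by (simp only: divide_inverse mult.commute)
    thus ?thesis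
      by (simp add: Xn_def magn_def M_Mn chi_chin S_def real_sqrt_mult)
  qed
  have E2: "E2 = 2 * A + A / \<kappa> * (2 * (a n \<beta> ^ 3 * EWn w n (\<lambda>v. v ^ 3)))"
    by (simp add: E2_def EWn_avg power_mult_distrib avg_cmult)
  show ?thesis
    unfolding dK_normal_def
  proof (rule cSUP_least)
    fix z
    define I where "I = J (\<lambda>x \<sigma>. of_bool ((S \<sigma> - real n * M) / sqrt (real n * chi) \<le> z))"
    have "cw_prob w \<beta> h n (\<lambda>\<sigma>. Xn w \<beta> h n \<sigma> \<le> z) - Phi z = (I - Phi z * Z) / Z"
      unfolding prob Xn_eq I_def using J_one_pos by (simp add: field_simps)
    hence "\<bar>cw_prob w \<beta> h n (\<lambda>\<sigma>. Xn w \<beta> h n \<sigma> \<le> z) - Phi z\<bar> = \<bar>I - Phi z * Z\<bar> / Z"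
      using J_one_pos by (simp add: abs_divide)
    also have "\<dots> \<le> be_const A \<kappa> V c0 E2 / sqrt (real n) * Z / Z"
      unfolding I_def using J_one_pos by (intro divide_right_mono J_standardized_be_const) auto
    finally show "\<bar>cw_prob w \<beta> h n (\<lambda>\<sigma>. Xn w \<beta> h n \<sigma> \<le> z) - Phi z\<bar>
        \<le> be_const A \<kappa> V c0 (2 * A + A / \<kappa> * (2 * (a n \<beta> ^ 3 * EWn w n (\<lambda>v. v ^ 3)))) / sqrt (real n)"
      using J_one_pos unfolding E2 by simp
  qed auto
qed

lemma EWn_nonneg: "(\<And>i. i < n \<Longrightarrow> 0 < w n i) \<Longrightarrow> (\<And>v. 0 < v \<Longrightarrow> 0 \<le> f v) \<Longrightarrow> 0 \<le> EWn w n f"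
  unfolding EWn_def by (intro divide_nonneg_nonneg sum_nonneg) auto

lemma EWn_mono: "(\<And>i. i < n \<Longrightarrow> f (w n i) \<le> g (w n i)) \<Longrightarrow> EWn w n f \<le> EWn w n g"
  unfolding EWn_def by (intro divide_right_mono sum_mono) auto

text \<open>One fixed \<open>n\<close>, with moment bounds that will not depend on it:
  \<open>m1\<close> and \<open>m2\<close> enclose the first moment, \<open>m3\<close> bounds the
  second. They yield the constant \<open>A\<close> for the scaled weights.\<close>

locale bounded_moments =
  fixes w :: "nat \<Rightarrow> nat \<Rightarrow> real" and \<beta> h m1 m2 m3 :: real and n :: nat
  assumes n: "0 < n" and w: "\<And>i. i < n \<Longrightarrow> 0 < w n i" and \<beta>: "0 \<le> \<beta>"
    and m1: "0 < m1" "m1 \<le> EWn w n id" and m2: "EWn w n id \<le> m2" and m3: "EWn w n (\<lambda>v. v\<^sup>2) \<le> m3"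
begin

definition a :: real where "a = sqrt (\<beta> / EWn w n id)"

lemma a_nonneg: "0 \<le> a"
  using \<beta> m1 by (auto simp: a_def)

abbreviation "A \<equiv> 1 + \<beta> * m2 + \<beta> * m3 / m1"

sublocale tilted_spins n "\<lambda>i. a * w n i" h
proof
  show "0 \<le> a * w n i" if "i < n" for i using w[OF that] a_nonneg by simp
qed (rule n)

lemma EWn_avg: "EWn w n f = avg (\<lambda>i. f (w n i))"
  by (simp add: EWn_def avg_def)

lemma a_sq: "a\<^sup>2 = \<beta> / EWn w n id"
  using \<beta> m1 by (simp add: a_def)

lemma avg_u: "avg (\<lambda>i. a * w n i) = sqrt (\<beta> * EWn w n id)"
proof -
  have "avg (\<lambda>i. a * w n i) = a * EWn w n id" by (simp add: avg_cmult EWn_avg)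
  also have "\<dots> = sqrt (a\<^sup>2 * (EWn w n id)\<^sup>2)"
    using m1 a_nonneg by (simp add: real_sqrt_mult)
  also have "a\<^sup>2 * (EWn w n id)\<^sup>2 = \<beta> * EWn w n id"
    unfolding a_sq using m1 by (simp add: power2_eq_square)
  finally show ?thesis .
qed

lemma avg_u_sq: "avg (\<lambda>i. (a * w n i)\<^sup>2) \<le> \<beta> * m3 / m1"
proof -
  have "avg (\<lambda>i. (a * w n i)\<^sup>2) = \<beta> * EWn w n (\<lambda>v. v\<^sup>2) / EWn w n id"
    unfolding power_mult_distrib avg_cmult a_sq EWn_avg[of "\<lambda>v. v\<^sup>2"] by simp
  also have "\<dots> \<le> \<beta> * m3 / m1"
    using \<beta> m1 m3 EWn_nonneg[of n w "\<lambda>v. v\<^sup>2"] w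
    by (intro frac_le mult_left_mono mult_nonneg_nonneg) auto
  finally show ?thesis .
qed

lemma m3_nonneg: "0 \<le> m3"
  using m3 EWn_nonneg[of n w "\<lambda>v. v\<^sup>2"] w by auto

lemma A_bounds: "1 \<le> A" "avg (\<lambda>i. a * w n i) \<le> A" "avg (\<lambda>i. (a * w n i)\<^sup>2) \<le> A"
proof -
  have m: "0 \<le> \<beta> * m2" "0 \<le> \<beta> * m3 / m1" using \<beta> m1 m2 m3_nonneg by auto
  thus "1 \<le> A" "avg (\<lambda>i. (a * w n i)\<^sup>2) \<le> A" using avg_u_sq by auto
  have y: "0 \<le> \<beta> * EWn w n id" using \<beta> m1 by simp
  have "sqrt (\<beta> * EWn w n id) \<le> 1 + \<beta> * EWn w n id"
  proof -
    have "sqrt y \<le> 1 + y" if "0 \<le> y" for y :: real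
      using that by (intro real_le_lsqrt) (auto simp: power2_eq_square algebra_simps)
    thus ?thesis using y by blast
  qed
  also have "\<beta> * EWn w n id \<le> \<beta> * m2" using \<beta> m2 by (intro mult_left_mono) auto
  finally show "avg (\<lambda>i. a * w n i) \<le> A" unfolding avg_u using m by simp
qed

lemma dK_normal_bound:
  assumes fp: "x0 = avg (\<lambda>i. a * w n i * \<tau> i x0)"
    and \<kappa>: "0 < \<kappa>" "\<kappa> \<le> 1 - avg (\<lambda>i. (1 - (\<tau> i x0)\<^sup>2) * (a * w n i)\<^sup>2)"
    and V: "0 \<le> V" "J (\<lambda>x \<sigma>. (x - x0)\<^sup>2) \<le> V / real n * J (\<lambda>_ _. 1)"
    and T: "\<And>v. Tn w \<beta> h n v = tanh (a * v * x0 + h)"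
  shows "dK_normal w \<beta> h n
    \<le> be_const A \<kappa> V (exp (- 2 * (A\<^sup>2 + \<bar>h\<bar>))) (2 * A + A / \<kappa> * (2 * sqrt (\<beta> / m1) ^ 3))
      * (1 + EWn w n (\<lambda>v. v ^ 3)) / sqrt (real n)"
proof -
  let ?c = "exp (- 2 * (A\<^sup>2 + \<bar>h\<bar>))"
  have sp: "spins_at_fixpoint n (\<lambda>i. a * w n i) h x0 A \<kappa> V ?c"
    using avg_variance_ge[OF fp A_bounds(2)]
    by unfold_locales (use fp \<kappa> V A_bounds in auto)
  have E3: "0 \<le> EWn w n (\<lambda>v. v ^ 3)"
    using w by (intro EWn_nonneg) auto
  have "a \<le> sqrt (\<beta> / m1)"
    unfolding a_def using \<beta> m1 by (intro real_sqrt_le_mono divide_left_mono) auto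
  hence "a ^ 3 \<le> sqrt (\<beta> / m1) ^ 3"
    using \<beta> m1 by (intro power_mono) (auto simp: a_def)
  hence "a ^ 3 * EWn w n (\<lambda>v. v ^ 3) \<le> sqrt (\<beta> / m1) ^ 3 * EWn w n (\<lambda>v. v ^ 3)"
    using E3 by (intro mult_right_mono)
  hence "A / \<kappa> * (2 * (a ^ 3 * EWn w n (\<lambda>v. v ^ 3))) \<le> A / \<kappa> * (2 * (sqrt (\<beta> / m1) ^ 3 * EWn w n (\<lambda>v. v ^ 3)))"
    using A_bounds(1) \<kappa> by (intro mult_left_mono) auto
  hence e: "2 * A + A / \<kappa> * (2 * (a ^ 3 * EWn w n (\<lambda>v. v ^ 3)))
      \<le> 2 * A + A / \<kappa> * (2 * sqrt (\<beta> / m1) ^ 3) * EWn w n (\<lambda>v. v ^ 3)"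
    by (simp only: mult.assoc add_le_cancel_left)
  have W: "0 < EWn w n id" using m1 by linarith
  have "dK_normal w \<beta> h n
      \<le> be_const A \<kappa> V ?c (2 * A + A / \<kappa> * (2 * (a ^ 3 * EWn w n (\<lambda>v. v ^ 3)))) / sqrt (real n)"
    using dK_normal_le[OF n W \<beta>, of h x0 A \<kappa> V ?c] T sp unfolding a_def by blast
  also have "\<dots> \<le> be_const A \<kappa> V ?c (2 * A + A / \<kappa> * (2 * sqrt (\<beta> / m1) ^ 3))
      * (1 + EWn w n (\<lambda>v. v ^ 3)) / sqrt (real n)"
  proof (intro divide_right_mono be_const_le e)
    show "0 \<le> A / \<kappa> * (2 * sqrt (\<beta> / m1) ^ 3)"
      using A_bounds(1) \<kappa> \<beta> m1 by (intro mult_nonneg_nonneg divide_nonneg_nonneg) auto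
  qed (use A_bounds(1) \<kappa> V E3 in auto)
  finally show ?thesis .
qed

lemma fp_eq_iff: "fp_eq w \<beta> h n x \<longleftrightarrow> x = avg (\<lambda>i. a * w n i * \<tau> i x)"
proof -
  have "EWn w n (\<lambda>v. tanh (a * v * x + h) * (a * v)) = avg (\<lambda>i. a * w n i * \<tau> i x)"
    unfolding EWn_avg \<tau>_def by (intro arg_cong[of _ _ avg] ext) (rule mult.commute)
  thus ?thesis by (simp add: fp_eq_def flip: a_def)
qed

text \<open>For \<open>\<beta> = 0\<close> and \<open>h \<noteq> 0\<close> the only fixed point is \<open>0\<close>, so \<open>xstar\<close> is a junk value; it is multiplied
  by \<open>sqrt 0\<close> in \<open>Tn\<close>.\<close>

lemma dK_normal_bound_high_temperature:
  assumes "h = 0 \<or> \<beta> = 0" "\<beta> * m3 / m1 < 1"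
  shows "dK_normal w \<beta> h n
    \<le> be_const A (1 - \<beta> * m3 / m1) (1 / (1 - \<beta> * m3 / m1)) (exp (- 2 * (A\<^sup>2 + \<bar>h\<bar>)))
        (2 * A + A / (1 - \<beta> * m3 / m1) * (2 * sqrt (\<beta> / m1) ^ 3))
      * (1 + EWn w n (\<lambda>v. v ^ 3)) / sqrt (real n)"
proof (rule dK_normal_bound[where ?x0.0 = 0])
  let ?\<kappa> = "1 - \<beta> * m3 / m1"
  show \<kappa>: "0 < ?\<kappa>" using assms by simp
  have "a = 0" if "\<beta> = 0" unfolding a_def using that by simp
  thus fp: "0 = avg (\<lambda>i. a * w n i * \<tau> i 0)"
    using assms(1) by (auto simp: \<tau>_def avg_const)
  show "Tn w \<beta> h n v = tanh (a * v * 0 + h)" for v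
  proof (cases "\<beta> = 0")
    case False
    hence "h = 0" using assms by simp
    have "xstar w \<beta> h n = 0"
      unfolding xstar_def \<open>h = 0\<close>
    \<comment> \<open>For zero field the sign condition in \<open>xstar\<close> already forces the
      value 0, even before uniqueness of fixed points is considered.\<close>
    proof (rule the_equality)
      show "fp_eq w \<beta> 0 n 0 \<and> sgn (0 :: real) = sgn 0"
        by (simp add: fp_eq_def EWn_def)
    qed (auto simp: sgn_0_0)
    thus ?thesis by (simp add: Tn_def)
  qed (simp add: Tn_def)
  have "avg (\<lambda>i. (1 - (\<tau> i 0)\<^sup>2) * (a * w n i)\<^sup>2) \<le> avg (\<lambda>i. (a * w n i)\<^sup>2)"
    using \<tau>_sq_le_1 by (intro avg_mono) (auto intro!: mult_left_le_one_le)
  thus "?\<kappa> \<le> 1 - avg (\<lambda>i. (1 - (\<tau> i 0)\<^sup>2) * (a * w n i)\<^sup>2)"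
    using avg_u_sq by simp
  have "?\<kappa> * (x - 0)\<^sup>2 \<le> (x - 0) * drift x" for x
  proof -
    have "?\<kappa> * (x - 0)\<^sup>2 \<le> (1 - avg (\<lambda>i. (a * w n i)\<^sup>2)) * (x - 0)\<^sup>2"
      using avg_u_sq by (intro mult_right_mono) auto
    also have "\<dots> \<le> (x - 0) * drift x"
      by (rule drift_strongly_monotone[OF fp])
    finally show ?thesis .
  qed
  thus "J (\<lambda>x \<sigma>. (x - 0)\<^sup>2) \<le> 1 / ?\<kappa> / real n * J (\<lambda>_ _. 1)"
    by (rule variance_convex[OF \<kappa>])
qed (use assms in auto)

text \<open>Positive \<open>\<beta>\<close> makes the mean of the scaled weights at least
  \<open>sqrt (\<beta> * m1) > 0\<close>, the lower bound \<open>s\<close> on which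
  \<open>field_variance\<close> depends.\<close>

lemma dK_normal_bound_field:
  assumes "h \<noteq> 0" "0 < \<beta>"
  shows "dK_normal w \<beta> h n
    \<le> be_const A (tanh \<bar>h\<bar>) (field_variance A (sqrt (\<beta> * m1)) \<bar>h\<bar>) (exp (- 2 * (A\<^sup>2 + \<bar>h\<bar>)))
        (2 * A + A / tanh \<bar>h\<bar> * (2 * sqrt (\<beta> / m1) ^ 3))
      * (1 + EWn w n (\<lambda>v. v ^ 3)) / sqrt (real n)"
proof -
  have s: "0 < sqrt (\<beta> * m1)" "sqrt (\<beta> * m1) \<le> avg (\<lambda>i. a * w n i)"
    unfolding avg_u using assms m1 by (auto intro!: mult_left_mono)
  obtain x0 where x0: "sgn x0 = sgn h" "x0 = avg (\<lambda>i. a * w n i * \<tau> i x0)"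
    "\<And>x. x = avg (\<lambda>i. a * w n i * \<tau> i x) \<Longrightarrow> sgn x = sgn h \<Longrightarrow> x = x0"
    "tanh \<bar>h\<bar> \<le> 1 - avg (\<lambda>i. (1 - (\<tau> i x0)\<^sup>2) * (a * w n i)\<^sup>2)"
    "J (\<lambda>x \<sigma>. (x - x0)\<^sup>2) \<le> field_variance A (sqrt (\<beta> * m1)) \<bar>h\<bar> / real n * J (\<lambda>_ _. 1)"
    using nonzero_field[OF tilted_spins_axioms assms(1) s A_bounds] by blast
  have "xstar w \<beta> h n = x0"
    unfolding xstar_def fp_eq_iff using x0(1,2,3) by (intro the_equality conjI) blast+
  hence "Tn w \<beta> h n v = tanh (a * v * x0 + h)" for v
    by (simp add: Tn_def a_def)
  thus ?thesis
    using assms s A_bounds by (intro dK_normal_bound[OF x0(2) _ x0(4) _ x0(5)] field_variance_nonneg) auto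
qed

end

section \<open>A priori bounds for the Kolmogorov distance\<close>

lemma dK_normal_bdd:
  "bdd_above (range (\<lambda>z. \<bar>cw_prob w \<beta> h n (\<lambda>\<sigma>. Xn w \<beta> h n \<sigma> \<le> z) - Phi z\<bar>))"
  "\<bar>cw_prob w \<beta> h n P - Phi z\<bar> \<le> 1"
proof -
  have *: "\<bar>cw_prob w \<beta> h n P - Phi z\<bar> \<le> 1" for P z
  proof -
    have pos: "0 < (\<Sum>\<sigma>\<in>Conf n. cw_weight w \<beta> h n \<sigma>)"
      using Conf_nonempty by (intro sum_pos) (auto simp: cw_weight_def)
    have "0 \<le> cw_prob w \<beta> h n P"
      unfolding cw_prob_def using pos
      by (intro divide_nonneg_pos sum_nonneg) (auto simp: cw_weight_def)
    moreover have "cw_prob w \<beta> h n P \<le> 1"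
      unfolding cw_prob_def using pos
      by (auto intro!: sum_mono simp: cw_weight_def)
    ultimately show ?thesis
      using Phi_ge_0[of z] Phi_le_1[of z] by linarith
  qed
  show "\<bar>cw_prob w \<beta> h n P - Phi z\<bar> \<le> 1" by (rule *)
  show "bdd_above (range (\<lambda>z. \<bar>cw_prob w \<beta> h n (\<lambda>\<sigma>. Xn w \<beta> h n \<sigma> \<le> z) - Phi z\<bar>))"
    using * by (intro bdd_aboveI[of _ 1]) auto
qed

lemma dK_normal_le_1: "dK_normal w \<beta> h n \<le> 1"
  unfolding dK_normal_def by (intro cSUP_least dK_normal_bdd) auto

lemma dK_normal_nonneg: "0 \<le> dK_normal w \<beta> h n"
  unfolding dK_normal_def by (rule cSUP_upper2[OF dK_normal_bdd(1), of 0]) auto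

section \<open>Regular weights\<close>

lemma EWn_eq_integral:
  assumes "0 < n"
  shows "(\<integral>x. f x \<partial>lawWn w n) = EWn w n f"
proof -
  have "(\<integral>x. f x \<partial>lawWn w n) = measure_pmf.expectation (pmf_of_set {..<n}) (\<lambda>i. f (w n i))"
    by (simp add: lawWn_def)
  also have "\<dots> = EWn w n f"
    using assms by (subst integral_pmf_of_set) (auto simp: EWn_def lessThan_empty_iff)
  finally show ?thesis .
qed

text \<open>Truncation to a bounded continuous function, to which weak convergence applies; it is
  the identity between 0 and \<open>k\<close>.\<close>

definition clip :: "nat \<Rightarrow> real \<Rightarrow> real" where
  "clip k v = min (max v 0) (real k)"

lemma clip_bounds: "0 \<le> clip k v" "clip k v \<le> real k" "\<bar>clip k v\<bar> \<le> \<bar>v\<bar>"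
  by (auto simp: clip_def)

lemma clip_le: "0 \<le> v \<Longrightarrow> clip k v \<le> v"
  by (auto simp: clip_def)

lemma continuous_on_clip: "continuous_on A (clip k)"
  unfolding clip_def by (intro continuous_intros)

lemma measurable_clip [measurable]: "clip k \<in> borel_measurable borel"
  unfolding clip_def by measurable

lemma clip_tendsto: "0 \<le> v \<Longrightarrow> (\<lambda>k. clip k v) \<longlonglongrightarrow> v"
proof (rule tendsto_eventually)
  assume "0 \<le> v"
  obtain K :: nat where "v \<le> real K" using real_arch_simple by blast
  thus "\<forall>\<^sub>F k in sequentially. clip k v = v"
    using \<open>0 \<le> v\<close> by (intro eventually_sequentiallyI[of K]) (auto simp: clip_def)
qed

locale weights =
  fixes w :: "nat \<Rightarrow> nat \<Rightarrow> real" and D :: "real measure"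
  assumes wpos: "\<And>n i. i < n \<Longrightarrow> w n i > 0"
    and D: "real_distribution D"
    and EW_pos: "(\<integral>x. x \<partial>D) > 0"
    and conv_dist: "weak_conv_m (lawWn w) D"
    and W2_int: "integrable D (\<lambda>x. x\<^sup>2)"
    and conv2: "(\<lambda>n. EWn w n (\<lambda>v. v\<^sup>2)) \<longlonglongrightarrow> (\<integral>x. x\<^sup>2 \<partial>D)"
begin

sublocale D: real_distribution D by (rule D)

text \<open>\<open>lawWn w n\<close> carries the discrete sigma-algebra of a pmf, so it is first
  pushed to the Borel sets without changing its distribution function. The value at
  \<open>n = 0\<close>, uniform choice from an empty set, is excluded eventually.\<close>

lemma EWn_tendsto:
  assumes cont: "continuous_on UNIV f" and bdd: "\<And>x. \<bar>f x\<bar> \<le> B"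
  shows "(\<lambda>n. EWn w n f) \<longlonglongrightarrow> (\<integral>x. f x \<partial>D)"
proof -
  define \<mu> where "\<mu> n = distr (lawWn w n) borel (\<lambda>x. x)" for n
  have [measurable]: "f \<in> borel_measurable borel"
    using cont by (rule borel_measurable_continuous_onI)
  have "real_distribution (\<mu> n)" for n
    unfolding \<mu>_def lawWn_def by (intro prob_space.real_distribution_distr) (auto intro: prob_space_measure_pmf)
  moreover have "cdf (\<mu> n) = cdf (lawWn w n)" for n
    by (simp add: fun_eq_iff cdf_def \<mu>_def lawWn_def measure_distr)
  hence "weak_conv_m \<mu> D"
    using conv_dist by (simp add: weak_conv_m_def)
  ultimately have "(\<lambda>n. \<integral>x. f x \<partial>\<mu> n) \<longlonglongrightarrow> (\<integral>x. f x \<partial>D)"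
    using D cont bdd
    by (intro weak_conv_imp_integral_bdd_continuous_conv[where B = B])
      (auto simp: continuous_on_eq_continuous_at)
  moreover have "(\<integral>x. f x \<partial>\<mu> n) = EWn w n f" if "0 < n" for n
    using EWn_eq_integral[OF that, of w f] by (simp add: \<mu>_def integral_distr lawWn_def)
  hence "\<forall>\<^sub>F n in sequentially. (\<integral>x. f x \<partial>\<mu> n) = EWn w n f"
    by (intro eventually_sequentiallyI[of 1]) auto
  ultimately show ?thesis
    by (rule Lim_transform_eventually)
qed

text \<open>A bounded continuous function vanishing exactly on the nonnegative reals has mean zero
  under every empirical law, hence under the limit.\<close>

lemma AE_nonneg: "AE x in D. 0 \<le> x"
proof -
  define g :: "real \<Rightarrow> real" where "g x = min (max (- x) 0) 1" for x
  have g: "0 \<le> g x" "g x \<le> 1" for x by (auto simp: g_def)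
  have cont: "continuous_on UNIV g" unfolding g_def by (intro continuous_intros)
  have [measurable]: "g \<in> borel_measurable borel"
    using cont by (rule borel_measurable_continuous_onI)
  have "(\<lambda>n. EWn w n g) \<longlonglongrightarrow> (\<integral>x. g x \<partial>D)"
    by (rule EWn_tendsto[OF cont, of 1]) (use g in \<open>auto simp: abs_le_iff intro: order.trans[of _ 0]\<close>)
  moreover have "EWn w n g = 0" for n
    using wpos by (auto simp: EWn_def g_def less_imp_le max_def)
  ultimately have "(\<integral>x. g x \<partial>D) = 0"
    by (simp add: LIMSEQ_const_iff)
  moreover have "integrable D g"
    by (rule D.integrable_const_bound[of _ 1]) (use g in auto)
  ultimately have "AE x in D. g x = 0"
    using g by (subst (asm) integral_nonneg_eq_0_iff_AE) auto
  thus ?thesis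
    by eventually_elim (auto simp: g_def min_def max_def split: if_splits)
qed

text \<open>The integral of a non-integrable function is 0 by convention, which the positive mean
  rules out.\<close>

lemma integrable_D: "integrable D (\<lambda>x. x)"
  using EW_pos not_integrable_integral_eq by fastforce

lemma clip_integral_tendsto: "(\<lambda>k. \<integral>x. clip k x \<partial>D) \<longlonglongrightarrow> (\<integral>x. x \<partial>D)"
proof (rule integral_dominated_convergence[where w = "\<lambda>x. \<bar>x\<bar>"])
  show "AE x in D. (\<lambda>k. clip k x) \<longlonglongrightarrow> x"
    using AE_nonneg by eventually_elim (rule clip_tendsto)
  show "AE x in D. norm (clip k x) \<le> \<bar>x\<bar>" for k
    using clip_bounds(3)[of k] by simp
qed (simp_all add: integrable_D)

lemma clip_sq_integral_tendsto: "(\<lambda>k. \<integral>x. (clip k x)\<^sup>2 \<partial>D) \<longlonglongrightarrow> (\<integral>x. x\<^sup>2 \<partial>D)"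
proof (rule integral_dominated_convergence[where w = "\<lambda>x. x\<^sup>2"])
  show "AE x in D. (\<lambda>k. (clip k x)\<^sup>2) \<longlonglongrightarrow> x\<^sup>2"
    using AE_nonneg by eventually_elim (intro tendsto_power clip_tendsto)
  show "AE x in D. norm ((clip k x)\<^sup>2) \<le> x\<^sup>2" for k
    using clip_bounds(3)[of k] by (simp add: abs_le_square_iff)
qed (simp_all add: W2_int)

lemma EWn_clip_tendsto: "(\<lambda>n. EWn w n (clip k)) \<longlonglongrightarrow> (\<integral>x. clip k x \<partial>D)"
  using clip_bounds(1,2) by (intro EWn_tendsto[where B = "real k"] continuous_on_clip) (auto simp: abs_le_iff intro: order.trans[of _ 0])

lemma EWn_clip_sq_tendsto: "(\<lambda>n. EWn w n (\<lambda>v. (clip k v)\<^sup>2)) \<longlonglongrightarrow> (\<integral>x. (clip k x)\<^sup>2 \<partial>D)"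
  using clip_bounds(1,2)
  by (intro EWn_tendsto[where B = "(real k)\<^sup>2"] continuous_on_power continuous_on_clip) (auto intro!: power_mono)

text \<open>A truncated mean of \<open>D\<close> still exceeds \<open>m\<close>; it is the limit of
  the truncated empirical means, which lie below the full ones.\<close>

lemma eventually_EWn_id_ge:
  assumes "m < (\<integral>x. x \<partial>D)"
  shows "\<forall>\<^sub>F n in sequentially. m \<le> EWn w n id"
proof -
  have "\<forall>\<^sub>F k in sequentially. m < (\<integral>x. clip k x \<partial>D)"
    using clip_integral_tendsto assms by (rule order_tendstoD)
  then obtain k where "m < (\<integral>x. clip k x \<partial>D)"
    using eventually_happens by fastforce
  hence "\<forall>\<^sub>F n in sequentially. m < EWn w n (clip k)"
    using EWn_clip_tendsto order_tendstoD(1) by blast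
  thus ?thesis
  proof eventually_elim
    case (elim n)
    also have "EWn w n (clip k) \<le> EWn w n id"
      using wpos by (intro EWn_mono) (simp add: clip_le less_imp_le)
    finally show ?case by simp
  qed
qed

text \<open>Convergence of the second moments makes the squared weights uniformly integrable, so no single
  weight contributes a positive fraction of the second moment.\<close>

lemma eventually_weights_small:
  assumes "0 < \<epsilon>"
  shows "\<forall>\<^sub>F n in sequentially. \<forall>i<n. (w n i)\<^sup>2 \<le> \<epsilon> * real n"
proof -
  have "\<forall>\<^sub>F k in sequentially. (\<integral>x. x\<^sup>2 \<partial>D) - \<epsilon> / 2 < (\<integral>x. (clip k x)\<^sup>2 \<partial>D)"
    using clip_sq_integral_tendsto by (rule order_tendstoD) (use assms in auto)
  then obtain k where "(\<integral>x. x\<^sup>2 \<partial>D) - \<epsilon> / 2 < (\<integral>x. (clip k x)\<^sup>2 \<partial>D)"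
    using eventually_happens'[OF sequentially_bot] by blast
  hence k: "(\<integral>x. x\<^sup>2 \<partial>D) - (\<integral>x. (clip k x)\<^sup>2 \<partial>D) < \<epsilon> / 2" by linarith
  have "(\<lambda>n. EWn w n (\<lambda>v. v\<^sup>2) - EWn w n (\<lambda>v. (clip k v)\<^sup>2)) \<longlonglongrightarrow> (\<integral>x. x\<^sup>2 \<partial>D) - (\<integral>x. (clip k x)\<^sup>2 \<partial>D)"
    by (intro tendsto_diff conv2 EWn_clip_sq_tendsto)
  hence "\<forall>\<^sub>F n in sequentially. EWn w n (\<lambda>v. v\<^sup>2) - EWn w n (\<lambda>v. (clip k v)\<^sup>2) < \<epsilon> / 2"
    using k by (rule order_tendstoD)
  moreover have "\<forall>\<^sub>F n in sequentially. (real k)\<^sup>2 / (\<epsilon> / 2) \<le> real n"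
    using filterlim_real_sequentially by (simp add: filterlim_at_top)
  ultimately show ?thesis
  proof eventually_elim
    case (elim n)
    show ?case
    proof (intro allI impI)
      fix i assume i: "i < n"
      \<comment> \<open>The excess over the truncation is nonnegative for every weight, so a single
        excess is at most the sum, \<open>n\<close> times a difference of second moments that is
        eventually below \<open>\<epsilon> / 2\<close>.\<close>
      have "(w n i)\<^sup>2 - (clip k (w n i))\<^sup>2 \<le> (\<Sum>j<n. (w n j)\<^sup>2 - (clip k (w n j))\<^sup>2)"
      proof (rule member_le_sum[of i "{..<n}" "\<lambda>j. (w n j)\<^sup>2 - (clip k (w n j))\<^sup>2"])
        fix j assume "j \<in> {..<n} - {i}"
        hence "0 < w n j" using wpos by auto
        thus "0 \<le> (w n j)\<^sup>2 - (clip k (w n j))\<^sup>2"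
          using clip_bounds(1)[of k] clip_le[of "w n j" k] by (simp add: power_mono)
      qed (use i in auto)
      also have "\<dots> = (EWn w n (\<lambda>v. v\<^sup>2) - EWn w n (\<lambda>v. (clip k v)\<^sup>2)) * real n"
        using i by (simp add: EWn_def sum_subtractf flip: diff_divide_distrib)
      also have "\<dots> \<le> \<epsilon> / 2 * real n"
        using elim(1) by (intro mult_right_mono) auto
      finally have "(w n i)\<^sup>2 \<le> (clip k (w n i))\<^sup>2 + \<epsilon> / 2 * real n" by simp
      moreover have "(clip k (w n i))\<^sup>2 \<le> (real k)\<^sup>2"
        using clip_bounds by (intro power_mono) auto
      moreover have "(real k)\<^sup>2 \<le> \<epsilon> / 2 * real n"
        using elim(2) assms by (simp add: field_simps)
      ultimately show "(w n i)\<^sup>2 \<le> \<epsilon> * real n" by linarith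
    qed
  qed
qed

text \<open>The cube of a weight is at most the largest weight times its square; the largest weight
  is \<open>o(sqrt n)\<close> and the second moments converge.\<close>

lemma third_moment_tendsto_0: "(\<lambda>n. EWn w n (\<lambda>v. v ^ 3) / sqrt (real n)) \<longlonglongrightarrow> 0"
proof (rule tendstoI)
  fix e :: real assume e: "0 < e"
  define m where "m = (\<integral>x. x\<^sup>2 \<partial>D) + 1"
  have m: "0 < m"
    unfolding m_def by (intro add_nonneg_pos Bochner_Integration.integral_nonneg) auto
  \<comment> \<open>Chosen so that \<open>sqrt \<epsilon> * m = e / 2\<close>.\<close>
  define \<epsilon> where "\<epsilon> = (e / (2 * m))\<^sup>2"
  have \<epsilon>: "0 < \<epsilon>" using e m by (simp add: \<epsilon>_def)
  have "\<forall>\<^sub>F n in sequentially. EWn w n (\<lambda>v. v\<^sup>2) < m"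
    using conv2 by (rule order_tendstoD) (simp add: m_def)
  with eventually_weights_small[OF \<epsilon>] eventually_gt_at_top[of 0]
  show "\<forall>\<^sub>F n in sequentially. dist (EWn w n (\<lambda>v. v ^ 3) / sqrt (real n)) 0 < e"
  proof eventually_elim
    case (elim n)
    have "EWn w n (\<lambda>v. v ^ 3) \<le> EWn w n (\<lambda>v. sqrt (\<epsilon> * real n) * v\<^sup>2)"
    proof (rule EWn_mono)
      fix i assume i: "i < n"
      have "w n i \<le> sqrt (\<epsilon> * real n)"
        using elim(1) i by (intro real_le_rsqrt) auto
      hence "w n i * (w n i)\<^sup>2 \<le> sqrt (\<epsilon> * real n) * (w n i)\<^sup>2"
        by (intro mult_right_mono) auto
      thus "(w n i) ^ 3 \<le> sqrt (\<epsilon> * real n) * (w n i)\<^sup>2"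
        by (simp add: power3_eq_cube power2_eq_square mult_ac)
    qed
    also have "\<dots> = sqrt (\<epsilon> * real n) * EWn w n (\<lambda>v. v\<^sup>2)"
      by (simp add: EWn_def flip: sum_distrib_left)
    also have "\<dots> \<le> sqrt (\<epsilon> * real n) * m"
      using elim \<epsilon> by (intro mult_left_mono) auto
    finally have "EWn w n (\<lambda>v. v ^ 3) / sqrt (real n) \<le> sqrt (\<epsilon> * real n) * m / sqrt (real n)"
      by (intro divide_right_mono) auto
    also have "\<dots> = e / 2"
      using elim(2) e m by (simp add: real_sqrt_mult \<epsilon>_def)
    also have "\<dots> < e" using e by simp
    finally have "EWn w n (\<lambda>v. v ^ 3) / sqrt (real n) < e" .
    moreover have "0 \<le> EWn w n (\<lambda>v. v ^ 3) / sqrt (real n)"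
      using wpos by (intro divide_nonneg_nonneg EWn_nonneg) auto
    ultimately show ?case by simp
  qed
qed

text \<open>Convergence of the moments supplies bounds \<open>m1\<close>, \<open>m2\<close>,
  \<open>m3\<close> valid for all large \<open>n\<close>, so the constants of
  \<open>bounded_moments\<close> become independent of \<open>n\<close>.\<close>

lemma dK_normal_eventually_le:
  assumes U: "(\<beta> \<ge> 0 \<and> h \<noteq> 0) \<or>
            (h = 0 \<and> 0 < \<beta> \<and> \<beta> < (\<integral>x. x \<partial>D) / (\<integral>x. x\<^sup>2 \<partial>D))"
  shows "\<exists>K\<ge>0. \<forall>\<^sub>F n in sequentially. dK_normal w \<beta> h n \<le> K * (1 + EWn w n (\<lambda>v. v ^ 3)) / sqrt (real n)"
proof -
  define \<mu>1 where "\<mu>1 = (\<integral>x. x \<partial>D)"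
  define \<mu>2 where "\<mu>2 = (\<integral>x. x\<^sup>2 \<partial>D)"
  have \<mu>1: "0 < \<mu>1" using EW_pos by (simp add: \<mu>1_def)
  have \<mu>2: "0 \<le> \<mu>2" unfolding \<mu>2_def by (intro Bochner_Integration.integral_nonneg) auto
  have \<beta>: "0 \<le> \<beta>" using U by auto
  have \<beta>\<mu>: "\<beta> * \<mu>2 < \<mu>1" if "h = 0 \<or> \<beta> = 0"
  proof (cases "h = 0")
    case True
    hence "0 < \<beta>" "\<beta> < \<mu>1 / \<mu>2" using U by (auto simp: \<mu>1_def \<mu>2_def)
    \<comment> \<open>With \<open>\<mu>2 = 0\<close> the quotient would be 0 by convention,
      contradicting \<open>0 < \<beta>\<close>.\<close>
    moreover from this have "\<mu>2 \<noteq> 0" by auto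
    ultimately show ?thesis using \<mu>2 by (simp add: field_simps)
  qed (use that \<mu>1 in auto)
  \<comment> \<open>The slack in the moment bounds. At most half of \<open>\<mu>1\<close> keeps
    \<open>m1\<close> positive; in the high temperature case half of the available gap preserves the
    strict inequality \<open>\<beta> * (\<mu>2 + \<eta>) < \<mu>1 - \<eta>\<close>.\<close>
  define \<eta> where "\<eta> = (if h = 0 \<or> \<beta> = 0 then min (\<mu>1 / 2) ((\<mu>1 - \<beta> * \<mu>2) / (2 * (1 + \<beta>))) else \<mu>1 / 2)"
  have \<eta>: "0 < \<eta>" "\<eta> \<le> \<mu>1 / 2"
    using \<mu>1 \<beta> \<beta>\<mu> unfolding \<eta>_def
    by (auto intro: min.coboundedI1 simp del: le_divide_eq_numeral1)
  define m1 where "m1 = \<mu>1 - \<eta>"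
  define m3 where "m3 = \<mu>2 + \<eta>"
  define m2 where "m2 = 1 + m3"
  have m1: "0 < m1" using \<eta> \<mu>1 by (simp add: m1_def)
  have hot: "\<beta> * m3 / m1 < 1" if "h = 0 \<or> \<beta> = 0"
  proof -
    have "\<eta> \<le> (\<mu>1 - \<beta> * \<mu>2) / (2 * (1 + \<beta>))" using that by (auto simp: \<eta>_def)
    hence "\<eta> * (2 * (1 + \<beta>)) \<le> \<mu>1 - \<beta> * \<mu>2" using \<beta> by (simp add: pos_le_divide_eq)
    moreover have "\<eta> * (2 * (1 + \<beta>)) = \<eta> * (1 + \<beta>) + \<eta> * (1 + \<beta>)" by simp
    moreover have "0 < \<eta> * (1 + \<beta>)" using \<eta> \<beta> by simp
    ultimately have "\<eta> * (1 + \<beta>) < \<mu>1 - \<beta> * \<mu>2" by linarith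
    hence "\<beta> * m3 < m1" by (simp add: m1_def m3_def algebra_simps)
    thus ?thesis using m1 by simp
  qed
  have ev: "\<forall>\<^sub>F n in sequentially. bounded_moments w \<beta> m1 m2 m3 n"
  proof -
    have "\<forall>\<^sub>F n in sequentially. m1 \<le> EWn w n id"
      using \<eta> by (intro eventually_EWn_id_ge) (simp add: m1_def \<mu>1_def)
    moreover have "\<forall>\<^sub>F n in sequentially. EWn w n (\<lambda>v. v\<^sup>2) < m3"
      using conv2 by (rule order_tendstoD) (use \<eta> in \<open>simp add: m3_def \<mu>2_def\<close>)
    ultimately show ?thesis
      using eventually_gt_at_top[of 0]
    proof eventually_elim
      case (elim n)
      have "EWn w n id \<le> EWn w n (\<lambda>v. 1 + v\<^sup>2)"
      proof (rule EWn_mono)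
        fix i
        show "id (w n i) \<le> 1 + (w n i)\<^sup>2"
          using abs_le_scaled_square[of 1 "w n i"] zero_le_power2[of "w n i"] by simp
      qed
      also have "\<dots> = 1 + EWn w n (\<lambda>v. v\<^sup>2)"
        using elim(3) by (simp add: EWn_def sum.distrib add_divide_distrib)
      finally have "EWn w n id \<le> m2" using elim(2) by (simp add: m2_def)
      thus ?case
        using elim m1 \<beta> wpos by unfold_locales auto
    qed
  qed
  have m23: "0 \<le> m2" "0 \<le> m3" using \<mu>2 \<eta> by (auto simp: m2_def m3_def)
  define A where "A = 1 + \<beta> * m2 + \<beta> * m3 / m1"
  have A: "1 \<le> A" using \<beta> m1 m23 by (simp add: A_def)
  show ?thesis
  proof (cases "h = 0 \<or> \<beta> = 0")
    case True
    let ?\<kappa> = "1 - \<beta> * m3 / m1"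
    let ?K = "be_const A ?\<kappa> (1 / ?\<kappa>) (exp (- 2 * (A\<^sup>2 + \<bar>h\<bar>))) (2 * A + A / ?\<kappa> * (2 * sqrt (\<beta> / m1) ^ 3))"
    have "0 \<le> ?K"
      using A hot[OF True] \<beta> m1
      by (intro be_const_nonneg add_nonneg_nonneg mult_nonneg_nonneg divide_nonneg_nonneg) auto
    moreover have "\<forall>\<^sub>F n in sequentially. dK_normal w \<beta> h n \<le> ?K * (1 + EWn w n (\<lambda>v. v ^ 3)) / sqrt (real n)"
      using ev unfolding A_def
      by eventually_elim (rule bounded_moments.dK_normal_bound_high_temperature[OF _ True hot[OF True]])
    ultimately show ?thesis by blast
  next
    case False
    hence h: "h \<noteq> 0" "0 < \<beta>" using \<beta> by auto
    let ?K = "be_const A (tanh \<bar>h\<bar>) (field_variance A (sqrt (\<beta> * m1)) \<bar>h\<bar>) (exp (- 2 * (A\<^sup>2 + \<bar>h\<bar>)))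
        (2 * A + A / tanh \<bar>h\<bar> * (2 * sqrt (\<beta> / m1) ^ 3))"
    have th: "0 < tanh \<bar>h\<bar>" using h by (subst tanh_real_pos_iff) auto
    have "0 \<le> ?K"
      using A h m1 th less_imp_le[OF th]
      by (intro be_const_nonneg field_variance_nonneg add_nonneg_nonneg mult_nonneg_nonneg divide_nonneg_nonneg) auto
    moreover have "\<forall>\<^sub>F n in sequentially. dK_normal w \<beta> h n \<le> ?K * (1 + EWn w n (\<lambda>v. v ^ 3)) / sqrt (real n)"
      using ev unfolding A_def
      by eventually_elim (rule bounded_moments.dK_normal_bound_field[OF _ h])
    ultimately show ?thesis by blast
  qed
qed

end

theorem theorem1p3:
  fixes w :: "nat \<Rightarrow> nat \<Rightarrow> real" and D :: "real measure" and \<beta> h :: real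
  assumes wpos: "\<And>n i. i < n \<Longrightarrow> w n i > 0"
    and D: "real_distribution D"
    and EW_pos: "(\<integral>x. x \<partial>D) > 0"
    and conv_dist: "weak_conv_m (lawWn w) D"
    and W2_int: "integrable D (\<lambda>x. x^2)"
    and conv2: "(\<lambda>n. EWn w n (\<lambda>v. v^2)) \<longlonglongrightarrow> (\<integral>x. x^2 \<partial>D)"
    and U: "(\<beta> \<ge> 0 \<and> h \<noteq> 0) \<or>
            (h = 0 \<and> 0 < \<beta> \<and> \<beta> < (\<integral>x. x \<partial>D) / (\<integral>x. x^2 \<partial>D))"
  shows "(integrable D (\<lambda>x. x^3) \<and> (\<lambda>n. EWn w n (\<lambda>v. v^3)) \<longlonglongrightarrow> (\<integral>x. x^3 \<partial>D)
            \<longrightarrow> (\<exists>C>0. \<forall>n\<ge>1. dK_normal w \<beta> h n \<le> C / sqrt (real n)))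
       \<and> (\<lambda>n. dK_normal w \<beta> h n) \<longlonglongrightarrow> 0"
proof -
  interpret weights w D by (rule weights.intro; fact)
  obtain K where K: "0 \<le> K"
    "\<forall>\<^sub>F n in sequentially. dK_normal w \<beta> h n \<le> K * (1 + EWn w n (\<lambda>v. v ^ 3)) / sqrt (real n)"
    using dK_normal_eventually_le[OF U] by blast
  have "\<exists>C>0. \<forall>n\<ge>1. dK_normal w \<beta> h n \<le> C / sqrt (real n)"
    if conv3: "(\<lambda>n. EWn w n (\<lambda>v. v ^ 3)) \<longlonglongrightarrow> (\<integral>x. x ^ 3 \<partial>D)"
  proof -
    obtain B where B: "\<And>n. \<bar>EWn w n (\<lambda>v. v ^ 3)\<bar> \<le> B"
      using convergent_imp_Bseq[OF convergentI[OF conv3]] by (auto simp: Bseq_def)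
    have B0: "0 \<le> B" using B[of 0] by simp
    obtain N where N: "\<And>n. N \<le> n \<Longrightarrow> dK_normal w \<beta> h n \<le> K * (1 + EWn w n (\<lambda>v. v ^ 3)) / sqrt (real n)"
      using K(2) by (auto simp: eventually_sequentially)
    \<comment> \<open>The term \<open>sqrt N\<close> covers the finitely many \<open>n < N\<close>,
      where the distance is at most 1 and \<open>sqrt N / sqrt n\<close> is at least 1; the summand
      1 makes \<open>C\<close> positive.\<close>
    define C where "C = K * (1 + B) + sqrt (real N) + 1"
    have C: "0 < C" using K B0 by (simp add: C_def add_nonneg_pos)
    moreover have "dK_normal w \<beta> h n \<le> C / sqrt (real n)" if n: "1 \<le> n" for n
    proof (cases "N \<le> n")
      case True
      have "K * (1 + EWn w n (\<lambda>v. v ^ 3)) \<le> K * (1 + B)"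
        using B[of n] K by (intro mult_left_mono) auto
      also have "\<dots> \<le> C" by (simp add: C_def)
      finally have "K * (1 + EWn w n (\<lambda>v. v ^ 3)) / sqrt (real n) \<le> C / sqrt (real n)"
        by (intro divide_right_mono) auto
      thus ?thesis using N[OF True] by linarith
    next
      case False
      have "sqrt (real n) \<le> sqrt (real N)" using False by simp
      also have "\<dots> \<le> C" using K B0 by (simp add: C_def)
      finally have "1 \<le> C / sqrt (real n)" using n by (simp add: field_simps)
      thus ?thesis using dK_normal_le_1[of w \<beta> h n] by linarith
    qed
    ultimately show ?thesis by blast
  qed
  moreover have "(\<lambda>n. dK_normal w \<beta> h n) \<longlonglongrightarrow> 0"
  proof (rule tendsto_sandwich[OF _ K(2) tendsto_const])
    have "(\<lambda>n. K * (1 / sqrt (real n) + EWn w n (\<lambda>v. v ^ 3) / sqrt (real n))) \<longlonglongrightarrow> K * (0 + 0)"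
      by (intro tendsto_mult tendsto_const tendsto_add third_moment_tendsto_0) real_asymp
    thus "(\<lambda>n. K * (1 + EWn w n (\<lambda>v. v ^ 3)) / sqrt (real n)) \<longlonglongrightarrow> 0"
      by (simp add: add_divide_distrib del: times_divide_eq_right flip: times_divide_eq_right)
  qed (simp add: dK_normal_nonneg)
  ultimately show ?thesis by blast
qed

end
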